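(* Let $\Phi$ be an algebraically closed field of characteristic $0$, let $n\ge 1$ be an integer and let $r\geq 3$ be an integer. There is no simple finite-dimensional $r$-ary Filippov superalgebra of type $A(0,n)$ over $\Phi$.
   Context: For an integer $r\ge 2$, an $r$-ary Filippov superalgebra over a field $k$ is a $\mathbb{Z}_2$-graded vector space $\mathcal F=\mathcal F_{\bar 0}\oplus\mathcal F_{\bar 1}$ over $k$ with an $r$-linear operation $[\cdot,\ldots,\cdot]$ that respects the grading (if $x_i\in\mathcal F_{\alpha_i}$ then $[x_1,\ldots,x_r]\in\mathcal F_{\alpha_1+\cdots+\alpha_r}$) and satisfies, for homogeneous elements with parities $p(\cdot)$: (1) $[x_1,\ldots,x_{i-1},x_i,\ldots,x_r]=-(-1)^{p(x_{i-1})p(x_i)}[x_1,\ldots,x_i,x_{i-1},\ldots,x_r]$; (2) $[y_2,\ldots,y_r,[x_1,\ldots,x_r]]=\sum_{i=1}^r(-1)^{p q_i}[x_1,\ldots,[y_2,\ldots,y_r,x_i],\ldots,x_r]$, where $p=\sum_{j=2}^r p(y_j)$ and $q_i=\sum_{j=1}^{i-1}p(x_j)$. An ideal of $\mathcal F$ is a $\mathbb Z_2$-graded subspace $I$ with $[I,\mathcal F,\ldots,\mathcal F]\subseteq I$. $\mathcal F$ is simple if $[\mathcal F,\ldots,\mathcal F]\ne 0$ and its only ideals are $0$ and $\mathcal F$. $Inder(\mathcal F)$ is the linear span in $End(\mathcal F)$ of the left multiplications $L(x_1,\ldots,x_{r-1}):y\mapsto[x_1,\ldots,x_{r-1},y]$;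 it is a Lie superalgebra under the supercommutator $[a,b]=ab-(-1)^{p(a)p(b)}ba$. For a Lie superalgebra $G$, $\mathcal F$ has type $G$ if $Inder(\mathcal F)\cong G$ as Lie superalgebras. $A(0,n):=sl(1,n+1)$ is the Lie superalgebra (under the supercommutator) of block matrices $\begin{pmatrix}A&B\\C&D\end{pmatrix}$ over $\Phi$ with $A$ of size $1\times1$, $D$ of size $(n+1)\times(n+1)$ and $\mathrm{tr}(A)=\mathrm{tr}(D)$; the even part is given by $B=0,C=0$ and the odd part by $A=0,D=0$. *)

theory Defs
  imports
    "HOL-Library.Z2"
    "HOL-Library.Function_Algebras"
    "HOL-Computational_Algebra.Polynomial"
    "Jordan_Normal_Form.Matrix"
begin

section \<open>Superspaces\<close>

text \<open>
  Parities are elements of the two-element field \<^typ>\<open>bit\<close>. The zero vector has both parities.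
\<close>

definition parity_sign :: "bit \<Rightarrow> 'k::ring_1"  \<comment> \<open>\<open>(-1)\<^sup>p\<close>\<close>
  where "parity_sign p = (if p = 0 then 1 else - 1)"

record ('k, 'v) superspace =
  scal :: "'k \<Rightarrow> 'v \<Rightarrow> 'v"
  part :: "bit \<Rightarrow> 'v set"

text \<open>Homogeneous component of parity \<open>p\<close>, for a grading \<open>gr\<close> of the elements concerned.\<close>

definition hcomp :: "(bit \<Rightarrow> 'a::minus set) \<Rightarrow> bit \<Rightarrow> 'a \<Rightarrow> 'a"
  where "hcomp gr p a = (THE x. x \<in> gr p \<and> a - x \<in> gr (p + 1))"

text \<open>
  The bilinear extension of \<open>[a, b] = a b - (-1)\<^bsup>p(a) p(b)\<^esup> b a\<close> from homogeneous to arbitrary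
  elements, for an associative product \<open>mul\<close>.
\<close>

definition supercommutator ::
    "(bit \<Rightarrow> 'a::{plus,minus} set) \<Rightarrow> ('a \<Rightarrow> 'a \<Rightarrow> 'a) \<Rightarrow> 'a \<Rightarrow> 'a \<Rightarrow> 'a" where
  "supercommutator gr mul a b =
    (let a0 = hcomp gr 0 a; a1 = hcomp gr 1 a; b0 = hcomp gr 0 b; b1 = hcomp gr 1 b
     in (mul a0 b0 - mul b0 a0) + (mul a0 b1 - mul b1 a0)
        + (mul a1 b0 - mul b0 a1) + (mul a1 b1 + mul b1 a1))"


section \<open>Lie superalgebras\<close>

text \<open>
  Only the data are recorded. The underlying space need not exhaust the type: it is
  the sum of the two homogeneous parts.
\<close>

record ('k, 'a) lie_superalgebra = "('k, 'a) superspace" +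
  lbr :: "'a \<Rightarrow> 'a \<Rightarrow> 'a"

definition lie_carrier :: "('k, 'a::plus) lie_superalgebra \<Rightarrow> 'a set"
  where "lie_carrier G = {x + y | x y. x \<in> part G 0 \<and> y \<in> part G 1}"

definition lie_superalgebra_iso ::
    "('k, 'a::plus) lie_superalgebra \<Rightarrow> ('k, 'b::plus) lie_superalgebra \<Rightarrow> ('a \<Rightarrow> 'b) \<Rightarrow> bool" where
  "lie_superalgebra_iso G H \<phi> \<longleftrightarrow>
     bij_betw \<phi> (lie_carrier G) (lie_carrier H) \<and>
     (\<forall>x\<in>lie_carrier G. \<forall>y\<in>lie_carrier G. \<phi> (x + y) = \<phi> x + \<phi> y) \<and>
     (\<forall>c. \<forall>x\<in>lie_carrier G. \<phi> (scal G c x) = scal H c (\<phi> x)) \<and>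
     (\<forall>p. \<phi> ` part G p = part H p) \<and>
     (\<forall>x\<in>lie_carrier G. \<forall>y\<in>lie_carrier G. \<phi> (lbr G x y) = lbr H (\<phi> x) (\<phi> y))"

definition lie_superalgebra_isomorphic ::
    "('k, 'a::plus) lie_superalgebra \<Rightarrow> ('k, 'b::plus) lie_superalgebra \<Rightarrow> bool"
  where "lie_superalgebra_isomorphic G H \<longleftrightarrow> (\<exists>\<phi>. lie_superalgebra_iso G H \<phi>)"


section \<open>Filippov superalgebras\<close>

text \<open>
  The underlying space is the whole type \<^typ>\<open>'v\<close>. The \<open>r\<close>-ary operation takes the list of
  its arguments; its values on lists of length other than \<open>r\<close> are irrelevant.
\<close>

record ('k, 'v) filippov = "('k, 'v) superspace" +
  fbr :: "'v list \<Rightarrow> 'v"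

locale super_vector_space =
  vector_space "scal F" for F :: "('k::field, 'v::ab_group_add, 'z) superspace_scheme" +
  assumes part_subspace: "subspace (part F p)"
    and part_disjoint: "part F 0 \<inter> part F 1 = {0}"
    and part_sum: "\<exists>a\<in>part F 0. \<exists>b\<in>part F 1. x = a + b"

text \<open>
  \<open>homogeneous F xs ps\<close>: the entries of \<open>xs\<close> are homogeneous, with the parities listed in \<open>ps\<close>.
\<close>

definition homogeneous ::
    "('k, 'v, 'z) superspace_scheme \<Rightarrow> 'v list \<Rightarrow> bit list \<Rightarrow> bool"
  where "homogeneous F xs ps \<longleftrightarrow> list_all2 (\<lambda>x p. x \<in> part F p) xs ps"

text \<open>
  List positions count from \<open>0\<close>. In the last axiom \<open>ys\<close> stands for \<open>y\<^sub>2, \<dots>, y\<^sub>r\<close>.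
\<close>

locale filippov_superalgebra =
  super_vector_space F for r :: nat and F :: "('k::field, 'v::ab_group_add) filippov" +
  assumes arity: "r \<ge> 2"
    and fbr_add: "\<lbrakk>length xs = r; i < r\<rbrakk> \<Longrightarrow>
      fbr F (xs[i := a + b]) = fbr F (xs[i := a]) + fbr F (xs[i := b])"
    and fbr_scal: "\<lbrakk>length xs = r; i < r\<rbrakk> \<Longrightarrow>
      fbr F (xs[i := scal F c a]) = scal F c (fbr F (xs[i := a]))"
    and fbr_graded: "\<lbrakk>length xs = r; homogeneous F xs ps\<rbrakk> \<Longrightarrow>
      fbr F xs \<in> part F (sum_list ps)"
    and fbr_anticomm: "\<lbrakk>length xs = r; homogeneous F xs ps; 0 < i; i < r\<rbrakk> \<Longrightarrow>
      fbr F xs = - scal F (parity_sign (ps ! (i - 1) * ps ! i))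
                     (fbr F (xs[i - 1 := xs ! i, i := xs ! (i - 1)]))"
    and fbr_fundamental:
      "\<lbrakk>length ys = r - 1; homogeneous F ys qs; length xs = r; homogeneous F xs ps\<rbrakk> \<Longrightarrow>
      fbr F (ys @ [fbr F xs]) =
        (\<Sum>i<r. scal F (parity_sign (sum_list qs * sum_list (take i ps)))
                   (fbr F (xs[i := fbr F (ys @ [xs ! i])])))"

definition finite_dimensional ::
    "('k::field, 'v::ab_group_add, 'z) superspace_scheme \<Rightarrow> bool"
  where "finite_dimensional F \<longleftrightarrow> (\<exists>B. finite B \<and> module.span (scal F) B = UNIV)"

definition filippov_ideal ::
    "nat \<Rightarrow> ('k::field, 'v::ab_group_add) filippov \<Rightarrow> 'v set \<Rightarrow> bool" where
  "filippov_ideal r F I \<longleftrightarrow>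
     module.subspace (scal F) I \<and>
     (\<forall>x\<in>I. \<exists>a\<in>I \<inter> part F 0. \<exists>b\<in>I \<inter> part F 1. x = a + b) \<and>
     (\<forall>x\<in>I. \<forall>ys. length ys = r - 1 \<longrightarrow> fbr F (x # ys) \<in> I)"

definition simple_filippov ::
    "nat \<Rightarrow> ('k::field, 'v::ab_group_add) filippov \<Rightarrow> bool" where
  "simple_filippov r F \<longleftrightarrow>
     (\<exists>xs. length xs = r \<and> fbr F xs \<noteq> 0) \<and>
     (\<forall>I. filippov_ideal r F I \<longrightarrow> I = {0} \<or> I = UNIV)"

definition left_mult :: "('k, 'v) filippov \<Rightarrow> 'v list \<Rightarrow> 'v \<Rightarrow> 'v"
  where "left_mult F xs = (\<lambda>y. fbr F (xs @ [y]))"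

definition end_part ::
    "('k::field, 'v::ab_group_add, 'z) superspace_scheme \<Rightarrow> bit \<Rightarrow> ('v \<Rightarrow> 'v) set" where
  "end_part F p =
     {f. Vector_Spaces.linear (scal F) (scal F) f \<and> (\<forall>q. f ` part F q \<subseteq> part F (p + q))}"

definition end_scal ::
    "('k, 'v, 'z) superspace_scheme \<Rightarrow> 'k \<Rightarrow> ('v \<Rightarrow> 'v) \<Rightarrow> ('v \<Rightarrow> 'v)"
  where "end_scal F c f = (\<lambda>x. scal F c (f x))"

text \<open>
  \<open>Inder\<close> carries the grading induced from \<open>End\<close>. Sums and differences of endomorphisms are
  pointwise; their product is composition, not the pointwise product \<open>(*)\<close>.
\<close>

definition Inder ::
    "nat \<Rightarrow> ('k::field, 'v::ab_group_add) filippov \<Rightarrow> ('k, 'v \<Rightarrow> 'v) lie_superalgebra" where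
  "Inder r F =
     \<lparr> scal = end_scal F,
       part = (\<lambda>p. end_part F p \<inter>
                 module.span (end_scal F) {left_mult F xs | xs. length xs = r - 1}),
       lbr = supercommutator (end_part F) (\<circ>) \<rparr>"

definition has_type ::
    "nat \<Rightarrow> ('k::field, 'v::ab_group_add) filippov \<Rightarrow> ('k, 'a::plus) lie_superalgebra \<Rightarrow> bool"
  where "has_type r F G \<longleftrightarrow> lie_superalgebra_isomorphic (Inder r F) G"


section \<open>The Lie superalgebras \<open>A(0,n) = sl(1,n+1)\<close>\<close>

definition mat_trace :: "'k::comm_monoid_add mat \<Rightarrow> 'k"
  where "mat_trace A = (\<Sum>i<dim_row A. A $$ (i, i))"

text \<open>The grading of all block matrices with diagonal blocks of sizes \<open>1\<close> and \<open>m\<close>.\<close>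

definition gl1_part :: "nat \<Rightarrow> bit \<Rightarrow> 'k::field mat set" where
  "gl1_part m p =
     (if p = 0
      then {four_block_mat A (0\<^sub>m 1 m) (0\<^sub>m m 1) D | A D.
              A \<in> carrier_mat 1 1 \<and> D \<in> carrier_mat m m}
      else {four_block_mat (0\<^sub>m 1 1) B C (0\<^sub>m m m) | B C.
              B \<in> carrier_mat 1 m \<and> C \<in> carrier_mat m 1})"

definition sl1 :: "nat \<Rightarrow> 'k::field mat set" where
  "sl1 m = {four_block_mat A B C D | A B C D.
              A \<in> carrier_mat 1 1 \<and> B \<in> carrier_mat 1 m \<and>
              C \<in> carrier_mat m 1 \<and> D \<in> carrier_mat m m \<and> mat_trace A = mat_trace D}"

definition lie_A0 :: "nat \<Rightarrow> ('k::field, 'k mat) lie_superalgebra" where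
  "lie_A0 n =
     \<lparr> scal = (\<cdot>\<^sub>m),
       part = (\<lambda>p. sl1 (n + 1) \<inter> gl1_part (n + 1) p),
       lbr = supercommutator (gl1_part (n + 1)) (*) \<rparr>"

end

theory Submission
  imports Defs
begin

text \<open>
  Let \<open>m = n + 1\<close>. The image \<open>z\<close> in \<open>Inder F\<close> of the central element of the even part \<open>gl(m)\<close> of \<open>sl(1,m)\<close>
  acts diagonalisably on \<open>F\<close>; this grades \<open>F\<close>, and after scaling \<open>Inder F\<close> has the degrees \<open>-1, 0, 1\<close> only.
  Hence the degrees of the entries of a list with nonzero bracket add up, any one of them being omitted,
  to \<open>-1\<close>, \<open>0\<close> or \<open>1\<close>. Since \<open>z\<close> is itself a combination of left multiplications and does not kill the components of
  extremal degree, the degrees of \<open>F\<close> are either \<open>\<lambda>, \<lambda> - 1\<close> with \<open>0 < \<lambda> < 1\<close>, which contradicts the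
  vanishing of the supertrace of \<open>z\<close>, or \<open>1, 0, -1\<close>. In the second case some nonzero left multiplication
  of degree \<open>0\<close> kills the components of degree \<open>1\<close> and \<open>-1\<close>, so \<open>sl(m)\<close> acts trivially on both. This forces
  \<open>m = 2\<close> and a basis of four weight vectors, for which a weight count excludes both parities.
\<close>

section \<open>Linear algebra\<close>

text \<open>The proof alternates between operators and lists. An element of \<open>Inder F\<close>
  that carries an eigenvector to a nonzero eigenvector must involve a left multiplication by
  eigenvectors with the right sum of eigenvalues, hence a nonzero bracket. Conversely, the arguments
  of a nonzero homogeneous bracket may be permuted up to sign, so each choice of the last argument
  gives another nonzero left multiplication, whose degree is restricted by the structure of
  \<open>sl(1,m)\<close>. For \<open>r = 2\<close> the adjoint representation of
  \<open>sl(1,m)\<close> is an example, so \<open>r \<ge> 3\<close> has to enter. It does so where a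
  nonzero bracket of one vector of degree \<open>1\<close> with vectors of degree \<open>0\<close>
  contains two of the latter: one is traded for a vector of degree \<open>-1\<close>, the other
  witnesses that the resulting operator of degree \<open>0\<close> is nonzero. Simplicity is used as
  irreducibility: a nonzero subspace that is spanned by homogeneous vectors and stable under the
  images of a basis of \<open>sl(1,m)\<close> is everything. This is why one eigenvector of
  \<open>z\<close> already makes \<open>z\<close> diagonalisable.\<close>

lemma adjacent_swap_invariant:
  assumes swap: "\<And>as x y bs. P (as @ x # y # bs) \<Longrightarrow> P (as @ y # x # bs)"
    and "mset xs = mset ys" and "P (as @ xs)"
  shows "P (as @ ys)"
  using assms(2,3)
proof (induction xs arbitrary: as ys)
  case Nil
  then show ?case by simp
next
  case (Cons x xs)
  \<comment> \<open>Adjacent swaps carry \<open>x\<close> past the block \<open>us\<close>. The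
    matched head then joins the prefix, which is why \<open>as\<close> is arbitrary in the
    induction.\<close>
  have move: "P (as @ x # us @ vs) \<Longrightarrow> P (as @ us @ x # vs)" for as us vs
  proof (induction us arbitrary: as)
    case Nil
    then show ?case by simp
  next
    case (Cons u us)
    from Cons.prems have "P ((as @ [u]) @ x # us @ vs)"
      using swap[of as x u "us @ vs"] by simp
    from Cons.IH[OF this] show ?case by simp
  qed
  have "x \<in> set ys"
    using Cons.prems(1) by (metis list.set_intros(1) mset_eq_setD)
  then obtain us vs where ys: "ys = us @ x # vs"
    by (meson split_list)
  have "mset xs = mset (us @ vs)"
    using Cons.prems(1) ys by simp
  then have "P ((as @ [x]) @ us @ vs)"
    using Cons.IH[of "us @ vs" "as @ [x]"] Cons.prems(2) by simp
  then show ?case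
    using move[of as us vs] ys by simp
qed

context vector_space
begin

text \<open>\<open>T\<close> is the product of the operators \<open>h - b\<close> with
  \<open>b\<close> in \<open>A\<close>. It kills the eigenvectors with eigenvalue in
  \<open>A\<close> and multiplies the others by nonzero factors, which separates eigenspaces inside
  a linear combination.\<close>

lemma linear_eigen_filter:
  assumes lin: "Vector_Spaces.linear scale scale h" and "finite A"
  shows "\<exists>T. Vector_Spaces.linear scale scale T \<and>
           (\<forall>a y. h y = scale a y \<longrightarrow> T y = scale (\<Prod>b\<in>A. a - b) y)"
  using assms(2)
proof (induction A)
  case empty
  have "Vector_Spaces.linear scale scale (\<lambda>x. x)"
    by (simp add: Vector_Spaces.linear_def module_hom_def module_hom_axioms_def module_axioms
        vector_space_axioms)
  then show ?case by auto
next
  case (insert c A)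
  interpret h: Vector_Spaces.linear scale scale h by (fact lin)
  from insert.IH obtain T where T: "Vector_Spaces.linear scale scale T"
    "\<And>a y. h y = scale a y \<Longrightarrow> T y = scale (\<Prod>b\<in>A. a - b) y" by blast
  interpret T: Vector_Spaces.linear scale scale T by (fact T(1))
  let ?T = "\<lambda>y. h (T y) - scale c (T y)"
  have "Vector_Spaces.linear scale scale ?T"
    by unfold_locales (simp_all add: T.add h.add T.scale h.scale algebra_simps)
  moreover have "?T y = scale (\<Prod>b\<in>insert c A. a - b) y" if "h y = scale a y" for a y
  proof -
    have "?T y = scale (\<Prod>b\<in>A. a - b) (scale a y) - scale c (scale (\<Prod>b\<in>A. a - b) y)"
      using T(2)[OF that] that by (simp add: h.scale)
    also have "\<dots> = scale ((a - c) * (\<Prod>b\<in>A. a - b)) y"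
      by (simp add: algebra_simps)
    finally show ?thesis
      using insert.hyps by simp
  qed
  ultimately show ?case by blast
qed

text \<open>A combination of eigenvectors is filtered by the eigenvalues other than \<open>s\<close>
  that occur in it: the terms outside the eigenspace of \<open>s\<close> vanish, while
  \<open>v\<close> is only multiplied by a nonzero constant.\<close>

lemma eigenvector_in_span:
  assumes lin: "Vector_Spaces.linear scale scale h"
    and X: "\<And>x. x \<in> X \<Longrightarrow> \<exists>a. h x = scale a x"
    and v: "v \<in> span X" "h v = scale s v"
  shows "v \<in> span {x \<in> X. h x = scale s x}"
proof -
  obtain ev where ev: "\<And>x. x \<in> X \<Longrightarrow> h x = scale (ev x) x"
    using X by metis
  obtain t r where t: "finite t" "t \<subseteq> X" "v = (\<Sum>x\<in>t. scale (r x) x)"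
    using v(1) unfolding span_explicit by blast
  let ?A = "ev ` t - {s}"
  obtain T where T: "Vector_Spaces.linear scale scale T"
    "\<And>a y. h y = scale a y \<Longrightarrow> T y = scale (\<Prod>b\<in>?A. a - b) y"
    using linear_eigen_filter[OF lin, of ?A] t(1) by auto
  interpret T: Vector_Spaces.linear scale scale T by (fact T(1))
  let ?k = "\<Prod>b\<in>?A. s - b"
  have k: "?k \<noteq> 0" using t(1) by auto
  have "scale ?k v = T v" using T(2)[OF v(2)] by simp
  also have "\<dots> = (\<Sum>x\<in>t. scale (r x) (T x))"
    by (simp add: t(3) T.sum T.scale)
  also have "\<dots> = (\<Sum>x\<in>t. if ev x = s then scale (r x * ?k) x else 0)"
  proof (rule sum.cong[OF refl])
    fix x assume x: "x \<in> t"
    have Tx: "T x = scale (\<Prod>b\<in>?A. ev x - b) x"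
      using T(2) ev x t(2) by blast
    show "scale (r x) (T x) = (if ev x = s then scale (r x * ?k) x else 0)"
    proof (cases "ev x = s")
      case False
      then have "(\<Prod>b\<in>?A. ev x - b) = 0"
        using t(1) x by (intro prod_zero) auto
      then show ?thesis using Tx False by simp
    qed (simp add: Tx)
  qed
  also have "\<dots> \<in> span {x \<in> X. h x = scale s x}"
  proof (rule span_sum)
    fix x assume "x \<in> t"
    then have "x \<in> X" using t(2) by blast
    then show "(if ev x = s then scale (r x * ?k) x else 0) \<in> span {x \<in> X. h x = scale s x}"
      using ev[of x] by (cases "ev x = s") (simp_all add: span_scale span_base span_zero)
  qed
  finally have "scale (inverse ?k) (scale ?k v) \<in> span {x \<in> X. h x = scale s x}"
    by (rule span_scale)
  then show ?thesis using k by simp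
qed

lemma nonzero_eigenvector_in_span:
  assumes "Vector_Spaces.linear scale scale h"
    and "\<And>x. x \<in> X \<Longrightarrow> \<exists>a. h x = scale a x"
    and "v \<in> span X" "h v = scale s v" "v \<noteq> 0"
  shows "\<exists>x\<in>X. h x = scale s x \<and> x \<noteq> 0"
proof (rule ccontr)
  assume none: "\<not> ?thesis"
  have "v \<in> span {x \<in> X. h x = scale s x}"
    by (rule eigenvector_in_span) (use assms in auto)
  moreover have "span {x \<in> X. h x = scale s x} \<subseteq> {0}"
    using none by (intro span_minimal) (auto simp: subspace_single_0)
  ultimately show False using assms(5) by blast
qed

text \<open>The entries are expanded over \<open>X\<close> one position at a time. In the inner
  claim the positions below \<open>k\<close> may hold arbitrary vectors of the span, and those from
  \<open>k\<close> on already lie in \<open>X\<close>.\<close>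

lemma multilinear_in_span:
  fixes f :: "'b list \<Rightarrow> 'c::ab_group_add"
  assumes W: "vector_space scaleW"
    and add: "\<And>xs i a b. \<lbrakk>length xs = n; i < n\<rbrakk> \<Longrightarrow> f (xs[i := a + b]) = f (xs[i := a]) + f (xs[i := b])"
    and scale: "\<And>xs i c a. \<lbrakk>length xs = n; i < n\<rbrakk> \<Longrightarrow> f (xs[i := scale c a]) = scaleW c (f (xs[i := a]))"
    and xs: "length xs = n" "set xs \<subseteq> span X"
  shows "f xs \<in> module.span scaleW {f ys | ys. length ys = n \<and> set ys \<subseteq> X}"
proof -
  interpret W: vector_space scaleW by (fact W)
  let ?S = "W.span {f ys | ys. length ys = n \<and> set ys \<subseteq> X}"
  have "f xs \<in> ?S"
    if "k \<le> n" "length xs = n" "set xs \<subseteq> span X" "\<And>i. k \<le> i \<Longrightarrow> i < n \<Longrightarrow> xs ! i \<in> X" for k xs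
    using that
  proof (induction k arbitrary: xs)
    case 0
    then have "set xs \<subseteq> X" by (auto simp: in_set_conv_nth)
    then show ?case using 0 by (auto intro!: W.span_base)
  next
    case (Suc k)
    have "xs ! k \<in> span X" using Suc.prems by auto
    then have "f (xs[k := xs ! k]) \<in> ?S"
    proof (induction rule: span_induct_alt)
      case base
      have "f (xs[k := scale 0 0]) = scaleW 0 (f (xs[k := 0]))"
        by (rule scale) (use Suc.prems in auto)
      then show ?case by (simp add: W.span_zero)
    next
      case (step c x y)
      have "f (xs[k := scale c x + y]) = scaleW c (f (xs[k := x])) + f (xs[k := y])"
        using Suc.prems by (simp add: add scale)
      moreover have "f (xs[k := x]) \<in> ?S"
      proof (rule Suc.IH)
        show "set (xs[k := x]) \<subseteq> span X"
          using Suc.prems(3) step(1) by (intro set_update_subsetI) (auto intro: span_base)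
        show "xs[k := x] ! i \<in> X" if "k \<le> i" "i < n" for i
          using that Suc.prems step(1) by (cases "i = k") auto
      qed (use Suc.prems in auto)
      ultimately show ?case
        using step(2) by (simp add: W.span_add W.span_scale)
    qed
    then show ?case by simp
  qed
  from this[of n xs] xs show ?thesis by simp
qed

text \<open>The trace of a product of maps does not depend on the order of the factors. Here the
  maps go between the spans of \<open>A\<close> and \<open>B\<close>, and both sums of products are
  scalars, so their traces are the dimensions times these scalars.\<close>

lemma trace_comm:
  assumes A: "finite A" "independent A" and B: "finite B" "independent B"
    and lin: "\<And>i. i \<in> I \<Longrightarrow> Vector_Spaces.linear scale scale (b i)"
      "\<And>i. i \<in> I \<Longrightarrow> Vector_Spaces.linear scale scale (c i)"
    and into: "\<And>i x. \<lbrakk>i \<in> I; x \<in> A\<rbrakk> \<Longrightarrow> c i x \<in> span B" "\<And>i y. \<lbrakk>i \<in> I; y \<in> B\<rbrakk> \<Longrightarrow> b i y \<in> span A"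
    and eq: "\<And>x. x \<in> A \<Longrightarrow> (\<Sum>i\<in>I. b i (c i x)) = scale \<alpha> x"
      "\<And>y. y \<in> B \<Longrightarrow> (\<Sum>i\<in>I. c i (b i y)) = scale \<beta> y"
  shows "of_nat (card A) * \<alpha> = of_nat (card B) * \<beta>"
proof -
  \<comment> \<open>The diagonal coefficient of the scalar map at one basis vector, expanded through
    the other basis. It is stated for arbitrary \<open>A\<close>, \<open>B\<close>, \<open>b\<close>
    and \<open>c\<close> so that it also applies with the roles exchanged.\<close>
  have coeff: "\<gamma> = (\<Sum>i\<in>I. \<Sum>y\<in>B. representation B (c i x) y * representation A (b i y) x)"
    if A: "finite A" "independent A" and B: "finite B" "independent B"
      and lin: "\<And>i. i \<in> I \<Longrightarrow> Vector_Spaces.linear scale scale (b i)"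
      and into: "\<And>i x. \<lbrakk>i \<in> I; x \<in> A\<rbrakk> \<Longrightarrow> c i x \<in> span B"
        "\<And>i y. \<lbrakk>i \<in> I; y \<in> B\<rbrakk> \<Longrightarrow> b i y \<in> span A"
      and eq: "(\<Sum>i\<in>I. b i (c i x)) = scale \<gamma> x" and x: "x \<in> A"
    for A B b c x \<gamma>
  proof -
    have bc: "b i (c i x) = (\<Sum>y\<in>B. scale (representation B (c i x) y) (b i y))" if "i \<in> I" for i
    proof -
      interpret b: Vector_Spaces.linear scale scale "b i" by (rule lin[OF that])
      have "c i x = (\<Sum>y\<in>B. scale (representation B (c i x) y) y)"
        using sum_representation_eq[OF B(2) into(1)[OF that x] B(1)] by simp
      then have "b i (c i x) = b i (\<Sum>y\<in>B. scale (representation B (c i x) y) y)" by simp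
      then show ?thesis by (simp add: b.sum b.scale)
    qed
    have "\<gamma> = representation A (scale \<gamma> x) x"
      using A x by (simp add: representation_scale span_base representation_basis)
    also have "\<dots> = representation A (\<Sum>i\<in>I. \<Sum>y\<in>B. scale (representation B (c i x) y) (b i y)) x"
      by (simp add: eq[symmetric] bc)
    also have "\<dots> = (\<Sum>i\<in>I. \<Sum>y\<in>B. representation B (c i x) y * representation A (b i y) x)"
      using A into(2)
      by (simp add: representation_sum representation_scale span_sum span_scale)
    finally show ?thesis .
  qed
  have "of_nat (card A) * \<alpha>
      = (\<Sum>x\<in>A. \<Sum>i\<in>I. \<Sum>y\<in>B. representation B (c i x) y * representation A (b i y) x)"
    by (subst sum_constant[symmetric], intro sum.cong refl,
        rule coeff[OF A B lin(1) into(1) into(2) eq(1)])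
  also have "\<dots> = (\<Sum>y\<in>B. \<Sum>i\<in>I. \<Sum>x\<in>A. representation A (b i y) x * representation B (c i x) y)"
    by (subst sum.swap, subst (2) sum.swap, subst sum.swap) (simp add: mult.commute)
  also have "\<dots> = of_nat (card B) * \<beta>"
    by (subst sum_constant[symmetric], intro sum.cong refl,
        rule coeff[OF B A lin(2) into(2) into(1) eq(2), symmetric])
  finally show ?thesis .
qed

end

text \<open>The iterates of \<open>h\<close> on \<open>v\<close> are dependent, so some nonzero
  polynomial in \<open>h\<close> kills \<open>v\<close>. Linear factors are split off one at a time:
  as soon as the quotient no longer kills \<open>v\<close>, its value at \<open>v\<close> is an
  eigenvector for the last root.\<close>

lemma eigenvector_exists:
  fixes scale :: "'k::alg_closed_field \<Rightarrow> 'v::ab_group_add \<Rightarrow> 'v"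
  assumes V: "vector_space scale"
    and lin: "Vector_Spaces.linear scale scale h"
    and fin: "finite B" "module.span scale B = UNIV" and v: "(v::'v) \<noteq> 0"
  obtains s w where "w \<noteq> 0" "h w = scale s w"
proof -
  interpret V: vector_space scale by (fact V)
  interpret h: Vector_Spaces.linear scale scale h by (fact lin)
  \<comment> \<open>This is \<open>p(h) v\<close> provided that \<open>N\<close> is at least the
    degree of \<open>p\<close>.\<close>
  define ev where "ev N p = (\<Sum>i\<le>N. scale (coeff p i) ((h ^^ i) v))" for N p
  have pow_lin: "h (\<Sum>i\<le>N. scale (q i) ((h ^^ i) v)) = (\<Sum>i\<le>N. scale (q i) ((h ^^ Suc i) v))"
    for N q by (simp add: h.sum h.scale)
  have ev_mult: "ev (Suc N) ([:- a, 1:] * q) = h (ev N q) - scale a (ev N q)"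
    if "degree q \<le> N" for N a q
  proof -
    have "coeff q (Suc N) = 0" using that by (simp add: coeff_eq_0)
    then have "(\<Sum>i\<le>Suc N. scale (a * coeff q i) ((h ^^ i) v)) = scale a (ev N q)"
      by (simp add: ev_def V.scale_sum_right)
    moreover have "(\<Sum>i\<le>Suc N. scale (coeff (pCons 0 q) i) ((h ^^ i) v)) = h (ev N q)"
      unfolding ev_def pow_lin by (subst sum.atMost_Suc_shift) (simp del: funpow.simps)
    moreover have "ev (Suc N) ([:- a, 1:] * q)
       = (\<Sum>i\<le>Suc N. scale (coeff (pCons 0 q) i) ((h ^^ i) v)) - (\<Sum>i\<le>Suc N. scale (a * coeff q i) ((h ^^ i) v))"
      unfolding ev_def sum_subtractf[symmetric]
    proof (rule sum.cong[OF refl])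
      fix i
      have "coeff ([:- a, 1:] * q) i = coeff (pCons 0 q) i - a * coeff q i"
        by (simp add: mult_pCons_left)
      then show "scale (coeff ([:- a, 1:] * q) i) ((h ^^ i) v) =
          scale (coeff (pCons 0 q) i) ((h ^^ i) v) - scale (a * coeff q i) ((h ^^ i) v)"
        by (simp only: V.scale_left_diff_distrib)
    qed
    ultimately show ?thesis by (simp only:)
  qed
  have "\<exists>s w. w \<noteq> 0 \<and> h w = scale s w" if "p \<noteq> 0" "degree p \<le> N" "ev N p = 0" for N p
    using that
  proof (induction N arbitrary: p)
    case 0
    then have "coeff p 0 \<noteq> 0" using leading_coeff_0_iff[of p] by simp
    then show ?case using "0.prems"(3) v by (simp add: ev_def)
  next
    case (Suc N)
    show ?case
    proof (cases "degree p = 0")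
      case True
      then have "coeff p i = 0" if "i > 0" for i using that by (simp add: coeff_eq_0)
      then have "ev (Suc N) p = scale (coeff p 0) v"
        unfolding ev_def by (subst sum.atMost_Suc_shift) simp
      moreover have "coeff p 0 \<noteq> 0" using True Suc.prems(1) leading_coeff_0_iff[of p] by simp
      ultimately show ?thesis using Suc.prems v by simp
    next
      case False
      then obtain a where "poly p a = 0" using alg_closed_imp_poly_has_root[of p] by blast
      then obtain q where q: "p = [:- a, 1:] * q" unfolding poly_eq_0_iff_dvd by (elim dvdE)
      then have "q \<noteq> 0" using Suc.prems(1) by auto
      then have "degree p = Suc (degree q)" unfolding q by (subst degree_mult_eq) auto
      then have dq: "degree q \<le> N" using Suc.prems(2) by simp
      show ?thesis
      proof (cases "ev N q = 0")
        case True
        then show ?thesis using Suc.IH[OF \<open>q \<noteq> 0\<close> dq] by blast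
      next
        case False
        moreover have "h (ev N q) = scale a (ev N q)"
          using ev_mult[OF dq, of a] Suc.prems(3) q by simp
        ultimately show ?thesis by blast
      qed
    qed
  qed
  moreover have "\<exists>p. p \<noteq> 0 \<and> degree p \<le> card B \<and> ev (card B) p = 0"
  proof (cases "inj_on (\<lambda>i. (h ^^ i) v) {..card B}")
    \<comment> \<open>If two iterates coincide, the set of iterates may be too small for the
      dimension count of the other case, but a difference of two monomials already kills
      \<open>v\<close>.\<close>
    case False
    then obtain i j where ij: "i \<le> card B" "j \<le> card B" "i \<noteq> j" "(h ^^ i) v = (h ^^ j) v"
      by (auto simp: inj_on_def)
    let ?p = "monom 1 i - monom 1 j :: 'k poly"
    have c: "coeff ?p k = (if k = i then 1 else 0) - (if k = j then 1 else 0)" for k by auto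
    have "coeff ?p i \<noteq> 0" unfolding c using ij(3) by simp
    then have "?p \<noteq> 0" by (metis coeff_0)
    moreover have "degree ?p \<le> card B"
      using ij by (intro degree_diff_le) (auto simp: degree_monom_eq)
    moreover have "ev (card B) ?p = 0"
    proof -
      have "ev (card B) ?p
          = (\<Sum>k\<le>card B. (if k = i then (h ^^ k) v else 0) - (if k = j then (h ^^ k) v else 0))"
        unfolding ev_def c by (intro sum.cong refl) (auto simp: V.scale_left_diff_distrib)
      also have "\<dots> = 0"
        using ij(1,2,4) by (simp only: sum_subtractf sum.delta finite_atMost) simp
      finally show ?thesis .
    qed
    ultimately show ?thesis by blast
  next
    case True
    let ?S = "(\<lambda>i. (h ^^ i) v) ` {..card B}"
    have "card ?S = Suc (card B)" using True by (simp add: card_image)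
    then have "V.dependent ?S" using V.independent_span_bound[OF fin(1), of ?S] fin(2) by auto
    then obtain u x where u: "x \<in> ?S" "u x \<noteq> 0" "(\<Sum>v\<in>?S. scale (u v) v) = 0"
      by (subst (asm) V.dependent_finite) auto
    let ?p = "poly_of_list (map (\<lambda>i. u ((h ^^ i) v)) [0..<Suc (card B)])"
    have c: "coeff ?p i = (if i \<le> card B then u ((h ^^ i) v) else 0)" for i
      by (simp del: upt_Suc add: nth_default_def)
    obtain i where "i \<le> card B" "x = (h ^^ i) v" using u(1) by auto
    then have "coeff ?p i \<noteq> 0" unfolding c using u(2) by simp
    then have "?p \<noteq> 0" by (metis coeff_0)
    moreover have "degree ?p \<le> card B"
      by (rule degree_le) (use c in simp)
    moreover have "ev (card B) ?p = 0"
    proof -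
      have "ev (card B) ?p = (\<Sum>i\<le>card B. scale (u ((h ^^ i) v)) ((h ^^ i) v))"
        unfolding ev_def c by (intro sum.cong refl) simp
      also have "\<dots> = (\<Sum>v\<in>?S. scale (u v) v)"
        by (subst sum.reindex[OF True]) (simp add: o_def)
      finally show ?thesis using u(3) by simp
    qed
    ultimately show ?thesis by blast
  qed
  ultimately show thesis using that by blast
qed

section \<open>Filippov superalgebras\<close>

context filippov_superalgebra
begin

definition hmg :: "'v set"
  where "hmg = part F 0 \<union> part F 1"

lemma part_hmg: "x \<in> part F p \<Longrightarrow> x \<in> hmg"
  by (cases p) (auto simp: hmg_def)

lemma hmg_part: "x \<in> hmg \<Longrightarrow> \<exists>p. x \<in> part F p"
  by (auto simp: hmg_def)

lemma hmg_homogeneous: "set xs \<subseteq> hmg \<Longrightarrow> \<exists>ps. homogeneous F xs ps"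
proof (induction xs)
  case (Cons x xs)
  then obtain ps where "homogeneous F xs ps" by auto
  moreover obtain p where "x \<in> part F p" using Cons.prems hmg_part[of x] by auto
  ultimately have "homogeneous F (x # xs) (p # ps)" by (simp add: homogeneous_def)
  then show ?case ..
qed (auto simp: homogeneous_def)

lemma span_hmg: "span hmg = UNIV"
proof -
  have "x \<in> span hmg" for x
  proof -
    obtain a b where "a \<in> hmg" "b \<in> hmg" "x = a + b" using part_sum[of x] part_hmg by metis
    then show ?thesis by (simp add: span_add span_base)
  qed
  then show ?thesis by blast
qed

lemma part_Int: "x \<in> part F p \<Longrightarrow> x \<in> part F (p + 1) \<Longrightarrow> x = 0"
  using part_disjoint by (cases p) auto

lemma fbr_swap:
  assumes "length (as @ x # y # bs) = r" "x \<in> part F p" "y \<in> part F q"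
    and "set as \<subseteq> hmg" "set bs \<subseteq> hmg"
  shows "fbr F (as @ x # y # bs) = - scal F (parity_sign (p * q)) (fbr F (as @ y # x # bs))"
proof -
  obtain as' bs' where as': "homogeneous F as as'" and bs': "homogeneous F bs bs'"
    using assms(4,5) hmg_homogeneous by blast
  have len: "length as' = length as" using as' by (simp add: homogeneous_def list_all2_lengthD)
  have "homogeneous F (as @ x # y # bs) (as' @ p # q # bs')"
    using as' bs' assms(2,3) by (simp add: homogeneous_def list_all2_appendI)
  from fbr_anticomm[OF assms(1) this, of "Suc (length as)"] assms(1) show ?thesis
    by (simp add: nth_append len list_update_append)
qed

text \<open>Only vanishing and membership in a subspace are transported along permutations, so the
  sign, which depends on the parities, is left open.\<close>

lemma fbr_permute:
  assumes "mset xs = mset ys" "length xs = r" "set xs \<subseteq> hmg"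
  shows "fbr F ys = fbr F xs \<or> fbr F ys = - fbr F xs"
proof -
  let ?P = "\<lambda>zs. length zs = r \<and> set zs \<subseteq> hmg \<and> (fbr F zs = fbr F xs \<or> fbr F zs = - fbr F xs)"
  have "?P ([] @ ys)"
  proof (rule adjacent_swap_invariant[OF _ assms(1)])
    fix as x y bs
    assume P: "?P (as @ x # y # bs)"
    then have "x \<in> hmg" "y \<in> hmg" by auto
    then obtain p q where "x \<in> part F p" "y \<in> part F q" using hmg_part by blast
    then have "fbr F (as @ y # x # bs) = - scal F (parity_sign (q * p)) (fbr F (as @ x # y # bs))"
      using P by (intro fbr_swap) auto
    then show "?P (as @ y # x # bs)" using P by (auto simp: parity_sign_def)
  next
    show "?P ([] @ xs)" using assms(2,3) by simp
  qed
  then show ?thesis by simp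
qed

lemma left_mult_linear:
  assumes "length xs = r - 1"
  shows "Vector_Spaces.linear (scal F) (scal F) (left_mult F xs)"
proof -
  have len: "length (xs @ [0]) = r" "r - 1 < r" using assms arity by auto
  have upd: "(xs @ [0])[r - 1 := a] = xs @ [a]" for a using assms by (simp add: list_update_append)
  have "fbr F (xs @ [a + b]) = fbr F (xs @ [a]) + fbr F (xs @ [b])" for a b
    using fbr_add[OF len, of a b] by (simp only: upd)
  moreover have "fbr F (xs @ [scal F c a]) = scal F c (fbr F (xs @ [a]))" for c a
    using fbr_scal[OF len, of c a] by (simp only: upd)
  ultimately show ?thesis
    by (auto simp: Vector_Spaces.linear_iff left_mult_def vector_space_axioms)
qed

lemma left_mult_add:
  assumes "length xs = r - 1" "i < r - 1"
  shows "left_mult F (xs[i := a + b]) = left_mult F (xs[i := a]) + left_mult F (xs[i := b])"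
proof
  fix y
  have "fbr F ((xs @ [y])[i := a + b]) = fbr F ((xs @ [y])[i := a]) + fbr F ((xs @ [y])[i := b])"
    using assms arity by (intro fbr_add) auto
  then show "left_mult F (xs[i := a + b]) y = (left_mult F (xs[i := a]) + left_mult F (xs[i := b])) y"
    using assms by (simp add: left_mult_def list_update_append)
qed

lemma left_mult_scal:
  assumes "length xs = r - 1" "i < r - 1"
  shows "left_mult F (xs[i := scal F c a]) = end_scal F c (left_mult F (xs[i := a]))"
proof
  fix y
  have "fbr F ((xs @ [y])[i := scal F c a]) = scal F c (fbr F ((xs @ [y])[i := a]))"
    using assms arity by (intro fbr_scal) auto
  then show "left_mult F (xs[i := scal F c a]) y = end_scal F c (left_mult F (xs[i := a])) y"
    using assms by (simp add: left_mult_def list_update_append end_scal_def)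
qed

section \<open>Inner derivations: parity, derivation rule and eigenvectors\<close>

lemma end_vector_space: "vector_space (end_scal F)"
  by unfold_locales (auto simp: end_scal_def algebra_simps)

sublocale E: vector_space "end_scal F"
  by (rule end_vector_space)

lemma end_part_subspace: "E.subspace (end_part F p)"
proof -
  have "0 \<in> part F q" for q using subspace_0[OF part_subspace] .
  then show ?thesis
    unfolding E.subspace_def end_part_def
    by (auto simp: Vector_Spaces.linear_iff vector_space_axioms end_scal_def algebra_simps
        image_subset_iff subspace_add[OF part_subspace] subspace_scale[OF part_subspace])
qed

lemma end_part_Int:
  assumes "f \<in> end_part F p" "f \<in> end_part F (p + 1)"
  shows "f = 0"
proof
  fix x
  obtain a b where ab: "a \<in> part F 0" "b \<in> part F 1" "x = a + b" using part_sum by blast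
  interpret f: Vector_Spaces.linear "scal F" "scal F" f using assms(1) by (simp add: end_part_def)
  have "f y = 0" if "y \<in> part F q" for y q
  proof (rule part_Int)
    show "f y \<in> part F (p + q)" using assms(1) that unfolding end_part_def by blast
    have "f y \<in> part F (p + 1 + q)" using assms(2) that unfolding end_part_def by blast
    then show "f y \<in> part F (p + q + 1)" by (simp only: add_ac)
  qed
  then show "f x = 0 x" using ab f.add by auto
qed

lemma left_mult_graded:
  assumes "length ys = r - 1" "homogeneous F ys qs"
  shows "left_mult F ys \<in> part (Inder r F) (sum_list qs)"
proof -
  have "fbr F (ys @ [x]) \<in> part F (sum_list qs + q)" if "x \<in> part F q" for x q
  proof -
    have "homogeneous F (ys @ [x]) (qs @ [q])"
      using assms that by (simp add: homogeneous_def list_all2_appendI)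
    from fbr_graded[OF _ this] show ?thesis using assms(1) arity by simp
  qed
  then show ?thesis
    using assms(1) left_mult_linear[OF assms(1)]
    unfolding Inder_def
    by (auto simp: end_part_def image_subset_iff simp del: add_bit_eq_xor intro!: E.span_base)
      (simp_all add: left_mult_def del: add_bit_eq_xor)
qed

lemma Inder_linear: "D \<in> part (Inder r F) p \<Longrightarrow> Vector_Spaces.linear (scal F) (scal F) D"
  by (simp add: Inder_def end_part_def)

lemma Inder_graded: "D \<in> part (Inder r F) p \<Longrightarrow> x \<in> part F q \<Longrightarrow> D x \<in> part F (p + q)"
  unfolding Inder_def end_part_def by (simp del: add_bit_eq_xor) blast

lemma Inder_hmg: "D \<in> part (Inder r F) p \<Longrightarrow> x \<in> hmg \<Longrightarrow> D x \<in> hmg"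
  by (meson Inder_graded hmg_part part_hmg)

lemma left_mult_in_span:
  assumes "length xs = r - 1" "set xs \<subseteq> span X"
  shows "left_mult F xs \<in> E.span {left_mult F ys | ys. length ys = r - 1 \<and> set ys \<subseteq> X}"
  by (rule multilinear_in_span[OF end_vector_space left_mult_add left_mult_scal assms])

lemma Inder_in_span:
  assumes "D \<in> part (Inder r F) p" "span X = UNIV"
  shows "D \<in> E.span {left_mult F ys | ys. length ys = r - 1 \<and> set ys \<subseteq> X}"
proof -
  have "D \<in> E.span {left_mult F xs | xs. length xs = r - 1}"
    using assms(1) by (simp add: Inder_def)
  moreover have "E.span {left_mult F xs | xs. length xs = r - 1}
      \<subseteq> E.span {left_mult F ys | ys. length ys = r - 1 \<and> set ys \<subseteq> X}"
    by (rule E.span_minimal) (use left_mult_in_span[of _ X] assms(2) in auto)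
  ultimately show ?thesis by blast
qed

lemma left_mult_app_in_span:
  assumes "length xs = r - 1" "set xs \<subseteq> span X"
  shows "fbr F (xs @ [v]) \<in> span {fbr F (ys @ [v]) | ys. length ys = r - 1 \<and> set ys \<subseteq> X}"
    (is "_ \<in> span ?S")
proof -
  have "left_mult F xs \<in> {D. D v \<in> span ?S}"
    using left_mult_in_span[OF assms]
  proof (rule set_mp[OF E.span_minimal, rotated 2])
    show "{left_mult F ys |ys. length ys = r - 1 \<and> set ys \<subseteq> X} \<subseteq> {D. D v \<in> span ?S}"
      by (auto simp: left_mult_def intro!: span_base)
    show "E.subspace {D. D v \<in> span ?S}"
      by (auto simp: E.subspace_def end_scal_def span_zero span_add span_scale)
  qed
  then show ?thesis by (simp add: left_mult_def)
qed

lemma Inder_app_in_span: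
  assumes "D \<in> part (Inder r F) p" "span X = UNIV"
  shows "D v \<in> span {fbr F (ys @ [v]) | ys. length ys = r - 1 \<and> set ys \<subseteq> X}"
    (is "_ \<in> span ?S")
proof -
  have "D \<in> {D. D v \<in> span ?S}"
    using Inder_in_span[OF assms]
  proof (rule set_mp[OF E.span_minimal, rotated 2])
    show "{left_mult F ys |ys. length ys = r - 1 \<and> set ys \<subseteq> X} \<subseteq> {D. D v \<in> span ?S}"
      by (auto simp: left_mult_def intro!: span_base)
    show "E.subspace {D. D v \<in> span ?S}"
      by (auto simp: E.subspace_def end_scal_def span_zero span_add span_scale)
  qed
  then show ?thesis by simp
qed

definition hmg_left_mults :: "bit \<Rightarrow> ('v \<Rightarrow> 'v) set"
  where "hmg_left_mults p =
    {left_mult F ys | ys. length ys = r - 1 \<and> (\<exists>qs. homogeneous F ys qs \<and> sum_list qs = p)}"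

text \<open>Expansion over homogeneous left multiplications gives one summand of each parity. The
  summand of the wrong parity is also a difference of two operators of parity \<open>p\<close>, so
  it has both parities and vanishes.\<close>

lemma Inder_span_hmg:
  assumes D: "D \<in> part (Inder r F) p"
  shows "D \<in> E.span (hmg_left_mults p)"
proof -
  let ?L = hmg_left_mults
  have "{left_mult F ys | ys. length ys = r - 1 \<and> set ys \<subseteq> hmg} \<subseteq> ?L p \<union> ?L (p + 1)"
  proof
    fix d assume "d \<in> {left_mult F ys | ys. length ys = r - 1 \<and> set ys \<subseteq> hmg}"
    then obtain ys where ys: "d = left_mult F ys" "length ys = r - 1" "set ys \<subseteq> hmg" by blast
    obtain qs where qs: "homogeneous F ys qs" using hmg_homogeneous ys(3) by blast
    have "sum_list qs = p \<or> sum_list qs = p + 1" by (cases "sum_list qs"; cases p) auto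
    with ys qs show "d \<in> ?L p \<union> ?L (p + 1)" unfolding hmg_left_mults_def by blast
  qed
  then have "D \<in> E.span (?L p \<union> ?L (p + 1))"
    using Inder_in_span[OF D span_hmg] E.span_mono by blast
  then obtain d0 d1 where d: "D = d0 + d1" "d0 \<in> E.span (?L p)" "d1 \<in> E.span (?L (p + 1))"
    unfolding E.span_Un by blast
  have L: "E.span (?L q) \<subseteq> end_part F q" for q
    by (rule E.span_minimal[OF _ end_part_subspace])
      (use left_mult_graded in \<open>auto simp: Inder_def hmg_left_mults_def\<close>)
  have "d1 = 0"
  proof (rule end_part_Int)
    have "d1 = D - d0" using d by simp
    then show "d1 \<in> end_part F p"
      using D d(2) L[of p] E.subspace_diff[OF end_part_subspace] by (auto simp: Inder_def)
    show "d1 \<in> end_part F (p + 1)" using d(3) L[of "p + 1"] by blast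
  qed
  then show ?thesis using d by simp
qed

text \<open>For a left multiplication of total parity \<open>0\<close> all signs in the fundamental
  identity are \<open>1\<close>, and the derivation rule is linear in \<open>D\<close>.\<close>

lemma even_derivation:
  assumes D: "D \<in> part (Inder r F) 0" and xs: "length xs = r" "set xs \<subseteq> hmg"
  shows "D (fbr F xs) = (\<Sum>i<r. fbr F (xs[i := D (xs ! i)]))"
proof -
  have "E.span (hmg_left_mults 0) \<subseteq> {D. D (fbr F xs) = (\<Sum>i<r. fbr F (xs[i := D (xs ! i)]))}"
  proof (rule E.span_minimal)
    show "hmg_left_mults 0 \<subseteq> {D. D (fbr F xs) = (\<Sum>i<r. fbr F (xs[i := D (xs ! i)]))}"
      unfolding hmg_left_mults_def
    proof safe
      fix ys qs assume ys: "length ys = r - 1" "homogeneous F ys qs" "sum_list qs = 0"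
      obtain ps where "homogeneous F xs ps" using hmg_homogeneous xs(2) by blast
      from fbr_fundamental[OF ys(1,2) xs(1) this] ys(3)
      show "left_mult F ys (fbr F xs) = (\<Sum>i<r. fbr F (xs[i := left_mult F ys (xs ! i)]))"
        by (simp add: left_mult_def parity_sign_def)
    qed
    have "fbr F (xs[i := 0]) = 0" if "i < r" for i
      using fbr_scal[OF xs(1) that, of 0 0] by simp
    then show "E.subspace {D. D (fbr F xs) = (\<Sum>i<r. fbr F (xs[i := D (xs ! i)]))}"
      using xs(1) by (auto simp: E.subspace_def end_scal_def fbr_add fbr_scal sum.distrib scale_sum_right)
  qed
  then show ?thesis using Inder_span_hmg[OF D] by blast
qed

lemma derivation_eigen:
  assumes D: "D \<in> part (Inder r F) 0" and len: "length xs = r" and hmg: "set xs \<subseteq> hmg"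
    and ts: "list_all2 (\<lambda>x t. D x = scal F t x) xs ts"
  shows "D (fbr F xs) = scal F (sum_list ts) (fbr F xs)"
proof -
  have "fbr F (xs[i := D (xs ! i)]) = scal F (ts ! i) (fbr F xs)" if "i < r" for i
    using that len ts fbr_scal[OF len that, of "ts ! i" "xs ! i"] by (simp add: list_all2_conv_all_nth)
  then have "D (fbr F xs) = (\<Sum>i<r. scal F (ts ! i) (fbr F xs))"
    using even_derivation[OF D len hmg] by simp
  also have "\<dots> = scal F (sum_list ts) (fbr F xs)"
    using list_all2_lengthD[OF ts] len
    by (simp add: sum_list_sum_nth scale_sum_left atLeast0LessThan)
  finally show ?thesis .
qed

text \<open>An even operator preserves both homogeneous parts, so the components of an eigenvector
  satisfy the same eigenvalue equation. Thus eigenvectors can be taken homogeneous, as the rules for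
  the bracket demand.\<close>

lemma eigen_hmg:
  assumes D: "D \<in> part (Inder r F) 0" and v: "D v = scal F s v"
  shows "v \<in> span {x \<in> hmg. D x = scal F s x}"
proof -
  interpret D: Vector_Spaces.linear "scal F" "scal F" D using Inder_linear[OF D] .
  obtain a b where ab: "a \<in> part F 0" "b \<in> part F 1" "v = a + b" using part_sum by blast
  have "D a - scal F s a \<in> part F 0" "D b - scal F s b \<in> part F 1"
    using Inder_graded[OF D ab(1)] Inder_graded[OF D ab(2)] ab
    by (auto intro!: subspace_diff[OF part_subspace] subspace_scale[OF part_subspace])
  moreover have "D a - scal F s a = - (D b - scal F s b)"
    using v by (simp add: ab(3) D.add algebra_simps)
  ultimately have "D a - scal F s a = 0" "D b - scal F s b = 0"
    using part_disjoint subspace_neg[OF part_subspace] by (metis IntI singletonD neg_0_equal_iff_equal)+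
  then have "a \<in> {x \<in> hmg. D x = scal F s x}" "b \<in> {x \<in> hmg. D x = scal F s x}"
    using ab by (auto intro: part_hmg)
  then show ?thesis unfolding ab(3) by (intro span_add span_base)
qed

text \<open>Expanding \<open>Q\<close> over left multiplications by lists from \<open>X\<close>
  writes \<open>Q v\<close> as a combination of brackets \<open>[ys, v]\<close>, each an eigenvector
  of \<open>D\<close> or zero. One of them must be nonzero and share the eigenvalue of
  \<open>Q v\<close>. This turns a nonzero operator into a nonzero bracket with a prescribed sum of
  eigenvalues.\<close>

lemma eigen_list:
  assumes D: "D \<in> part (Inder r F) 0"
    and X: "X \<subseteq> hmg" "span X = UNIV" "\<And>x. x \<in> X \<Longrightarrow> \<exists>t. D x = scal F t x"
    and Q: "Q \<in> part (Inder r F) p"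
    and v: "v \<in> hmg" "D v = scal F s v" "D (Q v) = scal F s' (Q v)" "Q v \<noteq> 0"
  obtains ys ts where "length ys = r - 1" "set ys \<subseteq> X" "list_all2 (\<lambda>x t. D x = scal F t x) ys ts"
    "fbr F (ys @ [v]) \<noteq> 0" "s' = sum_list ts + s"
proof -
  let ?S = "{fbr F (ys @ [v]) | ys. length ys = r - 1 \<and> set ys \<subseteq> X}"
  obtain ev where ev: "\<And>x. x \<in> X \<Longrightarrow> D x = scal F (ev x) x" using X(3) by metis
  have eig: "D (fbr F (ys @ [v])) = scal F (sum_list (map ev ys) + s) (fbr F (ys @ [v]))"
    if "length ys = r - 1" "set ys \<subseteq> X" for ys
  proof -
    have "D (fbr F (ys @ [v])) = scal F (sum_list (map ev ys @ [s])) (fbr F (ys @ [v]))"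
    proof (rule derivation_eigen[OF D])
      show "list_all2 (\<lambda>x t. D x = scal F t x) (ys @ [v]) (map ev ys @ [s])"
        using that(2) ev v(2)
        by (intro list_all2_appendI) (auto simp: list.rel_map intro!: list.rel_refl_strong)
    qed (use that arity X(1) v(1) in auto)
    then show ?thesis by simp
  qed
  have "\<exists>x\<in>?S. D x = scal F s' x \<and> x \<noteq> 0"
    by (rule nonzero_eigenvector_in_span[OF Inder_linear[OF D] _ Inder_app_in_span[OF Q X(2)] v(3,4)])
      (use eig in blast)
  then obtain ys where ys: "length ys = r - 1" "set ys \<subseteq> X"
    "D (fbr F (ys @ [v])) = scal F s' (fbr F (ys @ [v]))" "fbr F (ys @ [v]) \<noteq> 0" by blast
  then have "s' = sum_list (map ev ys) + s" using eig[OF ys(1,2)] by simp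
  then show thesis
    using that[OF ys(1,2) _ ys(4), of "map ev ys"] ys(2) ev
    by (auto simp: list.rel_map intro!: list.rel_refl_strong)
qed

text \<open>Homogeneous spanning vectors make the subspace graded. An ideal has its element in the
  first place and a left multiplication in the last; \<open>fbr_permute\<close> bridges this up to
  sign, and multilinearity reduces the other arguments to homogeneous ones.\<close>

lemma simple_span_UNIV:
  assumes simple: "simple_filippov r F" and Y: "Y \<subseteq> hmg" "y \<in> Y" "y \<noteq> 0"
    and inv: "\<And>ys v. \<lbrakk>length ys = r - 1; set ys \<subseteq> hmg; v \<in> Y\<rbrakk> \<Longrightarrow> fbr F (ys @ [v]) \<in> span Y"
  shows "span Y = UNIV"
proof -
  have "filippov_ideal r F (span Y)"
    unfolding filippov_ideal_def
  proof (intro conjI ballI allI impI)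
    show "subspace (span Y)" by simp
  next
    fix x assume "x \<in> span Y"
    then show "\<exists>a\<in>span Y \<inter> part F 0. \<exists>b\<in>span Y \<inter> part F 1. x = a + b"
    proof (induction rule: span_induct_alt)
      case base
      show ?case by (intro bexI[of _ 0]) (auto simp: subspace_0 part_subspace span_zero)
    next
      case (step c x y)
      then obtain a b where ab: "a \<in> span Y" "a \<in> part F 0" "b \<in> span Y" "b \<in> part F 1" "y = a + b"
        by blast
      have cx: "scal F c x \<in> span Y" using step(1) by (intro span_scale span_base)
      from step(1) Y(1) consider "x \<in> part F 0" | "x \<in> part F 1" by (auto simp: hmg_def)
      then show ?case
      proof cases
        case 1
        then show ?thesis using ab cx
          by (intro bexI[of _ "scal F c x + a"] bexI[of _ b])
            (auto simp: span_add subspace_add[OF part_subspace] subspace_scale[OF part_subspace] add_ac)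
      next
        case 2
        then show ?thesis using ab cx
          by (intro bexI[of _ a] bexI[of _ "scal F c x + b"])
            (auto simp: span_add subspace_add[OF part_subspace] subspace_scale[OF part_subspace] add_ac)
      qed
    qed
  next
    fix x and ys :: "'v list" assume x: "x \<in> span Y" and ys: "length ys = r - 1"
    have hom: "fbr F (x # zs) \<in> span Y" if "x \<in> Y" "length zs = r - 1" "set zs \<subseteq> hmg" for x zs
    proof -
      have "fbr F (x # zs) = fbr F (zs @ [x]) \<or> fbr F (x # zs) = - fbr F (zs @ [x])"
        by (rule fbr_permute) (use that Y(1) arity in auto)
      then show ?thesis using inv[OF that(2,3,1)] span_neg by metis
    qed
    have hom': "fbr F (x # zs) \<in> span Y" if zs: "length zs = r - 1" "set zs \<subseteq> hmg" for zs
      using x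
    proof (induction rule: span_induct_alt)
      case base
      have "fbr F (0 # zs) = 0"
        using fbr_scal[of "0 # zs" 0 0 0] zs arity by simp
      then show ?case by (simp add: span_zero)
    next
      case (step c x y)
      have "fbr F ((scal F c x + y) # zs) = scal F c (fbr F (x # zs)) + fbr F (y # zs)"
        using fbr_add[of "0 # zs" 0 "scal F c x" y] fbr_scal[of "0 # zs" 0 c x] zs arity by simp
      then show ?case using step(2) hom[OF step(1) zs] by (simp add: span_add span_scale)
    qed
    have "fbr F (x # ys) \<in> span {fbr F (x # zs) | zs. length zs = r - 1 \<and> set zs \<subseteq> hmg}"
    proof (rule multilinear_in_span[OF vector_space_axioms, where f = "\<lambda>zs. fbr F (x # zs)"])
      show "fbr F (x # zs[i := a + b]) = fbr F (x # zs[i := a]) + fbr F (x # zs[i := b])"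
        if "length zs = r - 1" "i < r - 1" for zs i a b
        using fbr_add[of "x # zs" "Suc i" a b] that by simp
      show "fbr F (x # zs[i := scal F c a]) = scal F c (fbr F (x # zs[i := a]))"
        if "length zs = r - 1" "i < r - 1" for zs i c a
        using fbr_scal[of "x # zs" "Suc i" c a] that by simp
    qed (use ys span_hmg in auto)
    moreover have "span {fbr F (x # zs) | zs. length zs = r - 1 \<and> set zs \<subseteq> hmg} \<subseteq> span Y"
      by (rule span_minimal) (use hom' in auto)
    ultimately show "fbr F (x # ys) \<in> span Y" by blast
  qed
  moreover have "span Y \<noteq> {0}" using Y(2,3) span_base by blast
  ultimately show ?thesis using simple unfolding simple_filippov_def by blast
qed

lemma Inder_subspace: "E.subspace (part (Inder r F) p)"
  unfolding Inder_def by (simp add: E.subspace_inter end_part_subspace)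

lemma Inder_add: "D \<in> part (Inder r F) p \<Longrightarrow> D (x + y) = D x + D y"
  using Inder_linear by (auto simp: Vector_Spaces.linear_iff)

lemma Inder_scal: "D \<in> part (Inder r F) p \<Longrightarrow> D (scal F a x) = scal F a (D x)"
  using Inder_linear by (auto simp: Vector_Spaces.linear_iff)

lemma Inder_zero: "D \<in> part (Inder r F) p \<Longrightarrow> D 0 = 0"
  using Inder_add[of D p 0 0] by simp

lemma Inder_minus: "D \<in> part (Inder r F) p \<Longrightarrow> D (- x) = - D x"
  using Inder_add[of D p x "- x"] Inder_zero[of D p] by (simp add: eq_neg_iff_add_eq_0 add.commute)

lemma Inder_diff: "D \<in> part (Inder r F) p \<Longrightarrow> D (x - y) = D x - D y"
  using Inder_add[of D p x "- y"] Inder_minus by simp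

lemma Inder_sum: "D \<in> part (Inder r F) p \<Longrightarrow> D (\<Sum>i\<in>I. f i) = (\<Sum>i\<in>I. D (f i))"
  by (induction I rule: infinite_finite_induct) (auto simp: Inder_zero Inder_add)

lemma fbr_zero_entry:
  assumes "0 \<in> set xs" "length xs = r"
  shows "fbr F xs = 0"
proof -
  obtain i where i: "i < r" "xs ! i = 0" using assms by (auto simp: in_set_conv_nth)
  have "xs[i := scal F 0 0] = xs" using i by (metis list_update_id scale_zero_left)
  then show ?thesis using fbr_scal[OF assms(2) i(1), of 0 0] by simp
qed

end

section \<open>Gradings of a Filippov superalgebra of type \<open>A(0,n)\<close>\<close>

text \<open>
  The operators \<open>e i j\<close>, \<open>b i\<close>, \<open>c i\<close> are the images of the basis \<open>E\<^sub>i\<^sub>j + \<delta>\<^sub>i\<^sub>j E\<^sub>0\<^sub>0\<close>, \<open>E\<^sub>0\<^sub>i\<close>, \<open>E\<^sub>i\<^sub>0\<close>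
  of \<open>sl(1,m)\<close>, where the indices \<open>i\<close> and \<open>j\<close> of the lower right block count from \<open>0\<close>.
\<close>

locale A0_filippov = filippov_superalgebra r F
  for r :: nat and F :: "('k::{alg_closed_field,field_char_0}, 'v::ab_group_add) filippov" +
  fixes m :: nat and e :: "nat \<Rightarrow> nat \<Rightarrow> 'v \<Rightarrow> 'v" and b c :: "nat \<Rightarrow> 'v \<Rightarrow> 'v"
  assumes m_ge: "m \<ge> 2" and r_ge: "r \<ge> 3"
    and fin: "finite_dimensional F" and simple: "simple_filippov r F"
    and e_Inder: "\<lbrakk>i < m; j < m\<rbrakk> \<Longrightarrow> e i j \<in> part (Inder r F) 0"
    and b_Inder: "i < m \<Longrightarrow> b i \<in> part (Inder r F) 1"
    and c_Inder: "i < m \<Longrightarrow> c i \<in> part (Inder r F) 1"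
    and ee: "\<lbrakk>i < m; j < m; k < m; l < m\<rbrakk> \<Longrightarrow>
      e i j (e k l v) - e k l (e i j v) = (if j = k then e i l v else 0) - (if l = i then e k j v else 0)"
    and eb: "\<lbrakk>i < m; l < m; k < m\<rbrakk> \<Longrightarrow>
      e i l (b k v) - b k (e i l v) = (if i = l then b k v else 0) - (if k = i then b l v else 0)"
    and ec: "\<lbrakk>i < m; l < m; k < m\<rbrakk> \<Longrightarrow>
      e i l (c k v) - c k (e i l v) = (if l = k then c i v else 0) - (if i = l then c k v else 0)"
    and bc: "\<lbrakk>i < m; l < m\<rbrakk> \<Longrightarrow> b l (c i v) + c i (b l v) = e i l v"
    and cc: "\<lbrakk>i < m; l < m\<rbrakk> \<Longrightarrow> c i (c l v) = - c l (c i v)"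
    and Inder_even: "L \<in> part (Inder r F) 0 \<Longrightarrow>
      \<exists>g. \<forall>v. L v = (\<Sum>i<m. \<Sum>j<m. scal F (g i j) (e i j v))"
    and Inder_odd: "L \<in> part (Inder r F) 1 \<Longrightarrow>
      \<exists>\<beta> \<gamma>. \<forall>v. L v = (\<Sum>i<m. scal F (\<beta> i) (b i v)) + (\<Sum>i<m. scal F (\<gamma> i) (c i v))"
    and b_nonzero: "i < m \<Longrightarrow> \<exists>v. b i v \<noteq> 0"
    and c_nonzero: "i < m \<Longrightarrow> \<exists>v. c i v \<noteq> 0"
begin

lemmas e_simps = Inder_add[OF e_Inder] Inder_scal[OF e_Inder] Inder_zero[OF e_Inder]
  Inder_minus[OF e_Inder] Inder_diff[OF e_Inder] Inder_sum[OF e_Inder]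
lemmas b_simps = Inder_add[OF b_Inder] Inder_scal[OF b_Inder] Inder_zero[OF b_Inder]
  Inder_minus[OF b_Inder] Inder_diff[OF b_Inder] Inder_sum[OF b_Inder]
lemmas c_simps = Inder_add[OF c_Inder] Inder_scal[OF c_Inder] Inder_zero[OF c_Inder]
  Inder_minus[OF c_Inder] Inder_diff[OF c_Inder] Inder_sum[OF c_Inder]

text \<open>Each homogeneous left multiplication is a combination of the \<open>e i j\<close>, or of
  the \<open>b i\<close> and \<open>c i\<close>, so stability under these operators already gives an
  ideal.\<close>

lemma span_UNIV:
  assumes Y: "Y \<subseteq> hmg" "y \<in> Y" "y \<noteq> 0"
    and inv: "\<And>v i j. \<lbrakk>v \<in> Y; i < m; j < m\<rbrakk> \<Longrightarrow> e i j v \<in> span Y"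
      "\<And>v i. \<lbrakk>v \<in> Y; i < m\<rbrakk> \<Longrightarrow> b i v \<in> span Y" "\<And>v i. \<lbrakk>v \<in> Y; i < m\<rbrakk> \<Longrightarrow> c i v \<in> span Y"
  shows "span Y = UNIV"
proof (rule simple_span_UNIV[OF simple Y])
  fix ys v assume ys: "length ys = r - 1" "set ys \<subseteq> hmg" and v: "v \<in> Y"
  obtain qs where qs: "homogeneous F ys qs" using ys(2) hmg_homogeneous by blast
  have L: "left_mult F ys \<in> part (Inder r F) (sum_list qs)" using left_mult_graded[OF ys(1) qs] .
  have "sum_list qs = 0 \<or> sum_list qs = 1" by (cases "sum_list qs") auto
  then have "left_mult F ys v \<in> span Y"
  proof
    assume "sum_list qs = 0"
    then have "left_mult F ys \<in> part (Inder r F) 0" using L by simp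
    then obtain g where "\<forall>v. left_mult F ys v = (\<Sum>i<m. \<Sum>j<m. scal F (g i j) (e i j v))"
      using Inder_even by blast
    then show ?thesis using inv(1)[OF v] by (auto intro!: span_sum span_scale)
  next
    assume "sum_list qs = 1"
    then have "left_mult F ys \<in> part (Inder r F) 1" using L by simp
    then obtain \<beta> \<gamma> where
      "\<forall>v. left_mult F ys v = (\<Sum>i<m. scal F (\<beta> i) (b i v)) + (\<Sum>i<m. scal F (\<gamma> i) (c i v))"
      using Inder_odd by blast
    then show ?thesis using inv(2,3)[OF v] by (auto intro!: span_sum span_scale span_add)
  qed
  then show "fbr F (ys @ [v]) \<in> span Y" by (simp add: left_mult_def)
qed

section \<open>The grading by the eigenvalues of \<open>z\<close>\<close>

definition z :: "'v \<Rightarrow> 'v"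
  where "z v = (\<Sum>i<m. e i i v)"

text \<open>\<open>z\<close> is the image of the diagonal matrix with entries
  \<open>m, 1, ..., 1\<close>. The difference \<open>m - 1\<close> of its two values is the
  eigenvalue of its commutator on the upper right block, and the negative one on the lower left
  block.\<close>

definition M :: 'k
  where "M = of_nat m - 1"

text \<open>With this normalisation \<open>b i\<close> and \<open>c i\<close> shift the degree by \<open>1\<close> and \<open>-1\<close>.\<close>

definition deg :: "'k \<Rightarrow> 'v set"
  where "deg t = {v. z v = scal F (M * t) v}"

lemma M_nonzero: "M \<noteq> 0"
proof
  assume "M = 0"
  then have "of_nat m = (of_nat 1 :: 'k)" by (simp add: M_def)
  then show False using m_ge by (simp only: of_nat_eq_iff)
qed

lemma z_Inder: "z \<in> part (Inder r F) 0"
proof -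
  have "z = (\<Sum>i<m. e i i)"
  proof
    have "(\<Sum>i\<in>I. e i i) v = (\<Sum>i\<in>I. e i i v)" for I v
      by (induction I rule: infinite_finite_induct) auto
    then show "z v = (\<Sum>i<m. e i i) v" for v by (simp add: z_def)
  qed
  then show ?thesis using e_Inder by (auto intro!: E.subspace_sum[OF Inder_subspace])
qed

lemmas z_simps = Inder_add[OF z_Inder] Inder_scal[OF z_Inder] Inder_zero[OF z_Inder]
  Inder_minus[OF z_Inder] Inder_diff[OF z_Inder] Inder_sum[OF z_Inder]

lemma z_e:
  assumes "i < m" "j < m"
  shows "z (e i j v) = e i j (z v)"
proof -
  have "z (e i j v) - e i j (z v) = (\<Sum>k<m. e k k (e i j v) - e i j (e k k v))"
    using assms by (simp add: z_def e_simps sum_subtractf)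
  also have "\<dots> = (\<Sum>k<m. (if k = i then e k j v else 0) - (if j = k then e i k v else 0))"
    using assms by (intro sum.cong refl ee) auto
  also have "\<dots> = 0"
    using assms by (simp add: sum_subtractf)
  finally show ?thesis by simp
qed

lemma z_b:
  assumes "k < m"
  shows "z (b k v) = b k (z v) + scal F M (b k v)"
proof -
  have "z (b k v) - b k (z v) = (\<Sum>i<m. e i i (b k v) - b k (e i i v))"
    using assms by (simp add: z_def b_simps sum_subtractf)
  also have "\<dots> = (\<Sum>i<m. b k v - (if k = i then b i v else 0))"
    using assms by (intro sum.cong refl) (simp add: eb)
  also have "\<dots> = scal F M (b k v)"
    using assms by (simp add: sum_subtractf sum_constant_scale M_def scale_left_diff_distrib)
  finally show ?thesis by (simp add: algebra_simps)
qed

lemma z_c: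
  assumes "k < m"
  shows "z (c k v) = c k (z v) - scal F M (c k v)"
proof -
  have "z (c k v) - c k (z v) = (\<Sum>i<m. e i i (c k v) - c k (e i i v))"
    using assms by (simp add: z_def c_simps sum_subtractf)
  also have "\<dots> = (\<Sum>i<m. (if i = k then c i v else 0) - c k v)"
    using assms by (intro sum.cong refl) (simp add: ec)
  also have "\<dots> = - scal F M (c k v)"
    using assms by (simp add: sum_subtractf sum_constant_scale M_def scale_left_diff_distrib)
  finally show ?thesis by (simp add: algebra_simps)
qed

lemma deg_e: "\<lbrakk>i < m; j < m; v \<in> deg t\<rbrakk> \<Longrightarrow> e i j v \<in> deg t"
  by (simp add: deg_def z_e e_simps)

lemma deg_b: "\<lbrakk>i < m; v \<in> deg t\<rbrakk> \<Longrightarrow> b i v \<in> deg (t + 1)"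
  by (simp add: deg_def z_b b_simps algebra_simps)

lemma deg_c: "\<lbrakk>i < m; v \<in> deg t\<rbrakk> \<Longrightarrow> c i v \<in> deg (t - 1)"
  by (simp add: deg_def z_c c_simps algebra_simps)

lemma deg_subspace: "subspace (deg t)"
  by (auto simp: subspace_def deg_def z_simps algebra_simps)

lemma deg_unique: "\<lbrakk>v \<in> deg s; v \<in> deg t; v \<noteq> 0\<rbrakk> \<Longrightarrow> s = t"
  using M_nonzero by (auto simp: deg_def)

lemma deg_hmg: "v \<in> deg t \<Longrightarrow> v \<in> span (hmg \<inter> deg t)"
  using eigen_hmg[OF z_Inder, of v "M * t"] by (simp add: deg_def Int_def)

lemma deg_hmg_nonzero:
  assumes "v \<in> deg t" "v \<noteq> 0"
  shows "\<exists>x\<in>hmg \<inter> deg t. x \<noteq> 0"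
proof (rule ccontr)
  assume "\<not> ?thesis"
  then have "span (hmg \<inter> deg t) \<subseteq> {0}" by (intro span_minimal) (auto simp: subspace_single_0)
  then show False using assms deg_hmg by blast
qed

lemma deg_in_span:
  assumes "\<And>x. x \<in> X \<Longrightarrow> \<exists>t. x \<in> deg t" "v \<in> span X" "v \<in> deg t"
  shows "v \<in> span (X \<inter> deg t)"
  using eigenvector_in_span[OF Inder_linear[OF z_Inder], of X v "M * t"] assms
  by (auto simp: deg_def Int_def)

lemma deg_in_span_nonzero:
  assumes "\<And>x. x \<in> X \<Longrightarrow> \<exists>t. x \<in> deg t" "v \<in> span X" "v \<in> deg t" "v \<noteq> 0"
  shows "\<exists>x\<in>X \<inter> deg t. x \<noteq> 0"
proof -
  have "\<exists>x\<in>X. z x = scal F (M * t) x \<and> x \<noteq> 0"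
    by (rule nonzero_eigenvector_in_span[OF Inder_linear[OF z_Inder] _ assms(2)])
      (use assms in \<open>auto simp: deg_def\<close>)
  then show ?thesis by (auto simp: deg_def)
qed

text \<open>One eigenvector of \<open>z\<close> suffices: \<open>e\<close>, \<open>b\<close> and
  \<open>c\<close> shift degrees by integers, so the vectors whose degree lies in its coset of the
  integers span a stable subspace, which is everything by irreducibility.\<close>

lemma integral_degrees:
  obtains \<tau> where "span {v \<in> hmg. \<exists>k::int. v \<in> deg (\<tau> + of_int k)} = UNIV"
proof -
  obtain B where B: "finite B" "span B = UNIV" using fin by (auto simp: finite_dimensional_def)
  obtain xs where "fbr F xs \<noteq> 0" using simple by (auto simp: simple_filippov_def)
  then obtain s w where w: "w \<noteq> 0" "z w = scal F s w"
    using eigenvector_exists[OF vector_space_axioms Inder_linear[OF z_Inder] B] by blast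
  then have "w \<in> deg (s / M)" using M_nonzero by (simp add: deg_def)
  then obtain x where x: "x \<in> hmg" "x \<in> deg (s / M)" "x \<noteq> 0" using deg_hmg_nonzero w(1) by blast
  let ?Y = "{v \<in> hmg. \<exists>k::int. v \<in> deg (s / M + of_int k)}"
  have "span ?Y = UNIV"
  proof (rule span_UNIV[of _ x])
    show "x \<in> ?Y" using x by (auto intro: exI[of _ 0])
    fix v i assume v: "v \<in> ?Y" and i: "i < m"
    then obtain k :: int where k: "v \<in> deg (s / M + of_int k)" by blast
    show "e i j v \<in> span ?Y" if "j < m" for j
      using v deg_e[OF i that k] Inder_hmg[OF e_Inder[OF i that]] by (intro span_base) auto
    have "b i v \<in> deg (s / M + of_int (k + 1))" using deg_b[OF i k] by (simp add: algebra_simps)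
    then show "b i v \<in> span ?Y" using v Inder_hmg[OF b_Inder[OF i]] by (intro span_base) blast
    have "c i v \<in> deg (s / M + of_int (k - 1))" using deg_c[OF i k] by (simp add: algebra_simps)
    then show "c i v \<in> span ?Y" using v Inder_hmg[OF c_Inder[OF i]] by (intro span_base) blast
  qed (use x in auto)
  then show thesis by (rule that)
qed

definition weights :: "'v set"
  where "weights = {v \<in> hmg. \<exists>t. v \<in> deg t}"

lemma span_weights: "span weights = UNIV"
proof -
  obtain \<tau> where "span {v \<in> hmg. \<exists>k::int. v \<in> deg (\<tau> + of_int k)} = UNIV"
    by (rule integral_degrees)
  moreover have "{v \<in> hmg. \<exists>k::int. v \<in> deg (\<tau> + of_int k)} \<subseteq> weights"
    by (auto simp: weights_def)
  ultimately show ?thesis using span_mono by blast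
qed

text \<open>Finitely many homogeneous eigenvectors of \<open>z\<close> span the space, and each
  degree that occurs is the degree of one of them. So the degrees form a finite subset of one coset
  of the integers, with least element \<open>\<kappa>\<close> and greatest element
  \<open>\<kappa> + n\<close>; it is not claimed that those in between occur.\<close>

lemma degree_range:
  obtains \<kappa> n where "\<exists>v\<in>deg \<kappa>. v \<noteq> 0" "\<exists>v\<in>deg (\<kappa> + of_nat n). v \<noteq> 0"
    "\<And>v t. \<lbrakk>v \<in> deg t; v \<noteq> 0\<rbrakk> \<Longrightarrow> \<exists>i\<le>n. t = \<kappa> + of_nat i"
proof -
  obtain \<tau> where \<tau>: "span {v \<in> hmg. \<exists>k::int. v \<in> deg (\<tau> + of_int k)} = UNIV" (is "span ?X = _")
    by (rule integral_degrees)
  have X: "\<exists>t. x \<in> deg t" if "x \<in> ?X" for x using that by blast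
  obtain B where B: "finite B" "span B = UNIV" using fin by (auto simp: finite_dimensional_def)
  have "\<exists>t. finite t \<and> t \<subseteq> ?X \<and> x \<in> span t" for x
  proof -
    have "x \<in> span ?X" using \<tau> by blast
    then obtain t q where "finite t" "t \<subseteq> ?X" "x = (\<Sum>a\<in>t. scal F (q a) a)"
      unfolding span_explicit by blast
    moreover have "(\<Sum>a\<in>t. scal F (q a) a) \<in> span t" by (intro span_sum span_scale span_base)
    ultimately show ?thesis by blast
  qed
  then have "\<forall>x. \<exists>t. finite t \<and> t \<subseteq> ?X \<and> x \<in> span t" by blast
  from choice[OF this] obtain T where T: "\<And>x. finite (T x)" "\<And>x. T x \<subseteq> ?X" "\<And>x. x \<in> span (T x)"
    by blast
  define X' where "X' = \<Union>(T ` B)"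
  have X': "finite X'" "X' \<subseteq> ?X" unfolding X'_def using B(1) T(1,2) by blast+
  have "B \<subseteq> span X'"
  proof
    fix x assume "x \<in> B"
    then have "span (T x) \<subseteq> span X'" unfolding X'_def by (intro span_mono) blast
    then show "x \<in> span X'" using T(3) by blast
  qed
  then have spX': "span X' = UNIV" using B(2) span_minimal[OF _ subspace_span] by blast
  define kf where "kf x = (SOME k::int. x \<in> deg (\<tau> + of_int k))" for x
  have kf: "x \<in> deg (\<tau> + of_int (kf x))" if "x \<in> X'" for x
  proof -
    have "\<exists>k::int. x \<in> deg (\<tau> + of_int k)" using that X'(2) by blast
    then show ?thesis unfolding kf_def by (rule someI_ex)
  qed
  \<comment> \<open>The zero vector lies in every \<open>deg t\<close> and would contribute an
    arbitrary integer.\<close>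
  define K where "K = kf ` (X' - {0})"
  have in_K: "\<exists>k\<in>K. t = \<tau> + of_int k" if v: "v \<in> deg t" "v \<noteq> 0" for v t
  proof -
    have "\<exists>x\<in>X' \<inter> deg t. x \<noteq> 0"
      by (rule deg_in_span_nonzero[OF _ _ v]) (use X X'(2) spX' in blast)+
    then obtain x where x: "x \<in> X'" "x \<in> deg t" "x \<noteq> 0" by blast
    then have "t = \<tau> + of_int (kf x)" using kf deg_unique by blast
    then show ?thesis using x by (auto simp: K_def)
  qed
  have K: "finite K" using X'(1) by (simp add: K_def)
  have "K \<noteq> {}"
  proof -
    obtain xs where "fbr F xs \<noteq> 0" using simple by (auto simp: simple_filippov_def)
    then have "fbr F xs \<in> span X' - {0}" using spX' by blast
    moreover have "span X' \<subseteq> {0}" if "X' - {0} = {}"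
      using that by (intro span_minimal) (auto simp: subspace_single_0)
    ultimately show ?thesis by (auto simp: K_def)
  qed
  have at: "\<exists>v\<in>deg (\<tau> + of_int k). v \<noteq> 0" if "k \<in> K" for k
    using that kf by (auto simp: K_def)
  define a where "a = Min K"
  define n where "n = nat (Max K - a)"
  have a: "a \<in> K" "\<And>k. k \<in> K \<Longrightarrow> a \<le> k" using K \<open>K \<noteq> {}\<close> by (auto simp: a_def)
  have Max: "Max K \<in> K" "\<And>k. k \<in> K \<Longrightarrow> k \<le> Max K" using K \<open>K \<noteq> {}\<close> by auto
  have shift: "\<tau> + of_int k = \<tau> + of_int a + of_nat (nat (k - a))" if "k \<in> K" for k
    using a(2)[OF that] by simp
  show thesis
  proof (rule that)
    show "\<exists>v\<in>deg (\<tau> + of_int a). v \<noteq> 0" using at[OF a(1)] .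
    show "\<exists>v\<in>deg (\<tau> + of_int a + of_nat n). v \<noteq> 0"
      using at[OF Max(1)] unfolding shift[OF Max(1)] n_def .
    fix v t assume "v \<in> deg t" "v \<noteq> 0"
    then obtain k where k: "k \<in> K" "t = \<tau> + of_int k" using in_K by blast
    then have "nat (k - a) \<le> n" using Max(2)[OF k(1)] by (simp add: n_def nat_mono)
    then show "\<exists>i\<le>n. t = \<tau> + of_int a + of_nat i"
      using k shift by blast
  qed
qed

text \<open>The commutator of \<open>z\<close> with the left multiplication is \<open>M\<close>
  times the sum of the degrees times that multiplication. Even elements of \<open>Inder F\<close>
  commute with \<open>z\<close>, so the sum is \<open>0\<close>; an odd one is \<open>P + Q\<close>
  with \<open>P\<close> raising and \<open>Q\<close> lowering the degree by \<open>1\<close>, which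
  makes the square of the sum equal to \<open>1\<close>.\<close>

lemma left_mult_degree:
  assumes ys: "length ys = r - 1" "set ys \<subseteq> hmg" "list_all2 (\<lambda>x d. x \<in> deg d) ys ds"
    and nz: "fbr F (ys @ [x]) \<noteq> 0"
  shows "sum_list ds \<in> {0, 1, - 1}"
    and "sum_list ds = 0 \<Longrightarrow> \<exists>g. \<forall>v. fbr F (ys @ [v]) = (\<Sum>i<m. \<Sum>j<m. scal F (g i j) (e i j v))"
    and "sum_list ds = 1 \<Longrightarrow> \<exists>\<beta>. \<forall>v. fbr F (ys @ [v]) = (\<Sum>i<m. scal F (\<beta> i) (b i v))"
proof -
  let ?L = "left_mult F ys" and ?t = "sum_list ds"
  obtain qs where qs: "homogeneous F ys qs" using ys(2) hmg_homogeneous by blast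
  have L: "?L \<in> part (Inder r F) (sum_list qs)" using left_mult_graded[OF ys(1) qs] .
  have "weights \<subseteq> {v. z (?L v) - ?L (z v) = scal F (M * ?t) (?L v)}"
  proof safe
    fix v assume "v \<in> weights"
    then obtain s where v: "v \<in> hmg" "v \<in> deg s" by (auto simp: weights_def)
    have "z (fbr F (ys @ [v])) = scal F (sum_list (map ((*) M) (ds @ [s]))) (fbr F (ys @ [v]))"
    proof (rule derivation_eigen[OF z_Inder])
      have "list_all2 (\<lambda>x t. z x = scal F t x) ys (map ((*) M) ds)"
        using ys(3) by (simp add: list_all2_map2 deg_def)
      then show "list_all2 (\<lambda>x t. z x = scal F t x) (ys @ [v]) (map ((*) M) (ds @ [s]))"
        using v(2) by (simp add: list_all2_appendI deg_def)
    qed (use ys v arity in auto)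
    then show "z (?L v) - ?L (z v) = scal F (M * ?t) (?L v)"
    proof -
      have "z (?L v) = scal F (M * ?t + M * s) (?L v)"
        using \<open>z (fbr F (ys @ [v])) = _\<close> by (simp add: left_mult_def sum_list_const_mult)
      moreover have "?L (z v) = scal F (M * s) (?L v)"
        using v(2) by (simp add: deg_def Inder_scal[OF L])
      ultimately show ?thesis by (simp add: scale_left_distrib)
    qed
  qed
  moreover have "subspace {v. z (?L v) - ?L (z v) = scal F (M * ?t) (?L v)}"
  proof (rule subspaceI)
    show "0 \<in> {v. z (?L v) - ?L (z v) = scal F (M * ?t) (?L v)}"
      by (simp add: z_simps Inder_zero[OF L])
    fix u v a
    assume u: "u \<in> {v. z (?L v) - ?L (z v) = scal F (M * ?t) (?L v)}"
    show "scal F a u \<in> {v. z (?L v) - ?L (z v) = scal F (M * ?t) (?L v)}"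
    proof -
      have "z (?L (scal F a u)) - ?L (z (scal F a u)) = scal F a (z (?L u) - ?L (z u))"
        by (simp only: z_simps Inder_scal[OF L] scale_right_diff_distrib)
      also have "\<dots> = scal F a (scal F (M * ?t) (?L u))" using u by simp
      also have "\<dots> = scal F (M * ?t) (?L (scal F a u))"
        by (simp only: Inder_scal[OF L] scale_left_commute)
      finally show ?thesis by simp
    qed
    assume v: "v \<in> {v. z (?L v) - ?L (z v) = scal F (M * ?t) (?L v)}"
    have "z (?L (u + v)) - ?L (z (u + v)) = (z (?L u) - ?L (z u)) + (z (?L v) - ?L (z v))"
      by (simp add: z_simps Inder_add[OF L])
    also have "\<dots> = scal F (M * ?t) (?L (u + v))"
      using u v by (simp add: Inder_add[OF L] scale_right_distrib)
    finally show "u + v \<in> {v. z (?L v) - ?L (z v) = scal F (M * ?t) (?L v)}" by simp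
  qed
  ultimately have comm: "z (?L v) - ?L (z v) = scal F (M * ?t) (?L v)" for v
    using span_minimal span_weights by blast
  have Lx: "?L x \<noteq> 0" using nz by (simp add: left_mult_def)
  have "sum_list qs = 0 \<or> sum_list qs = 1" by (cases "sum_list qs") auto
  then have *: "?t \<in> {0, 1, - 1} \<and> (?t = 0 \<longrightarrow> (\<exists>g. \<forall>v. ?L v = (\<Sum>i<m. \<Sum>j<m. scal F (g i j) (e i j v))))
    \<and> (?t = 1 \<longrightarrow> (\<exists>\<beta>. \<forall>v. ?L v = (\<Sum>i<m. scal F (\<beta> i) (b i v))))"
  proof
    assume "sum_list qs = 0"
    then have "?L \<in> part (Inder r F) 0" using L by simp
    then obtain g where g: "\<And>v. ?L v = (\<Sum>i<m. \<Sum>j<m. scal F (g i j) (e i j v))"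
      using Inder_even by blast
    have "z (?L x) = ?L (z x)" unfolding g z_simps by (intro sum.cong refl) (simp add: z_e)
    then have "?t = 0" using comm[of x] Lx M_nonzero by simp
    then show ?thesis using g by auto
  next
    assume "sum_list qs = 1"
    then have "?L \<in> part (Inder r F) 1" using L by simp
    then obtain \<beta> \<gamma> where g: "\<And>v. ?L v = (\<Sum>i<m. scal F (\<beta> i) (b i v)) + (\<Sum>i<m. scal F (\<gamma> i) (c i v))"
      using Inder_odd by blast
    define P where "P v = (\<Sum>i<m. scal F (\<beta> i) (b i v))" for v
    define Q where "Q v = (\<Sum>i<m. scal F (\<gamma> i) (c i v))" for v
    have LPQ: "?L v = P v + Q v" for v using g by (simp add: P_def Q_def)
    have zP: "z (P v) = P (z v) + scal F M (P v)" for v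
      unfolding P_def z_simps scale_sum_right sum.distrib[symmetric]
      by (intro sum.cong refl) (simp add: z_b scale_right_distrib mult.commute)
    have zQ: "z (Q v) = Q (z v) - scal F M (Q v)" for v
      unfolding Q_def z_simps scale_sum_right sum_subtractf[symmetric]
      by (intro sum.cong refl) (simp add: z_c scale_right_diff_distrib mult.commute)
    \<comment> \<open>The commutator of \<open>z\<close> with \<open>P + Q\<close> is
      \<open>M (P - Q)\<close>, and that with \<open>P - Q\<close> is \<open>M (P + Q)\<close>.
      Using both gives \<open>L = t^2 L\<close> without isolating \<open>P\<close> or
      \<open>Q\<close>.\<close>
    have "scal F M (P v - Q v) = scal F M (scal F ?t (P v + Q v))" for v
      using comm[of v] by (simp add: LPQ zP zQ z_simps algebra_simps)
    then have 1: "P v - Q v = scal F ?t (P v + Q v)" for v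
      using M_nonzero scale_left_imp_eq by blast
    have "z (P v - Q v) - (P (z v) - Q (z v)) = scal F ?t (z (P v + Q v) - (P (z v) + Q (z v)))" for v
      using arg_cong[OF 1[of v], of z] 1[of "z v"]
      by (simp only: z_simps scale_right_diff_distrib)
    then have "scal F M (P v + Q v) = scal F M (scal F ?t (P v - Q v))" for v
      by (simp add: z_simps zP zQ algebra_simps)
    then have 2: "P v + Q v = scal F ?t (P v - Q v)" for v
      using M_nonzero scale_left_imp_eq by blast
    have "scal F (?t * ?t) (?L x) = scal F ?t (P x - Q x)" using 1[of x] by (simp add: LPQ)
    then have "?L x = scal F (?t * ?t) (?L x)" using 2[of x] by (simp add: LPQ)
    then have "scal F (1 - ?t * ?t) (?L x) = 0" by (simp add: scale_left_diff_distrib)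
    then have "?t * ?t = 1" using Lx by simp
    then have t: "?t = 1 \<or> ?t = - 1" by (simp add: square_eq_1_iff)
    have "?L v = P v" if "?t = 1" for v
    proof -
      have "scal F 2 (Q v) = Q v + Q v"
        using scale_left_distrib[of 1 1 "Q v"] by simp
      also have "\<dots> = 0" using 1[of v] that by (simp add: algebra_simps)
      finally have "Q v = 0" by simp
      then show ?thesis by (simp add: LPQ)
    qed
    then show ?thesis using t by (auto simp: P_def)
  qed
  then show "?t \<in> {0, 1, - 1}" by blast
  show "\<exists>g. \<forall>v. fbr F (ys @ [v]) = (\<Sum>i<m. \<Sum>j<m. scal F (g i j) (e i j v))" if "?t = 0"
    using * that by (simp add: left_mult_def)
  show "\<exists>\<beta>. \<forall>v. fbr F (ys @ [v]) = (\<Sum>i<m. scal F (\<beta> i) (b i v))" if "?t = 1"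
    using * that by (simp add: left_mult_def)
qed

text \<open>Moving entry \<open>i\<close> to the last place changes the bracket at most by a sign,
  so the remaining entries form a nonzero left multiplication.\<close>

lemma degree_constraint:
  assumes xs: "length xs = r" "set xs \<subseteq> hmg" "list_all2 (\<lambda>x d. x \<in> deg d) xs ds"
    and nz: "fbr F xs \<noteq> 0" and i: "i < r"
  shows "sum_list ds - ds ! i \<in> {0, 1, - 1}"
proof -
  have len: "length ds = r" using xs list_all2_lengthD by metis
  let ?ys = "take i xs @ drop (Suc i) xs" and ?es = "take i ds @ drop (Suc i) ds"
  have sp: "xs = take i xs @ xs ! i # drop (Suc i) xs" "ds = take i ds @ ds ! i # drop (Suc i) ds"
    using i xs(1) len by (simp_all add: id_take_nth_drop)
  have "fbr F (?ys @ [xs ! i]) = fbr F xs \<or> fbr F (?ys @ [xs ! i]) = - fbr F xs"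
  proof (rule fbr_permute[OF _ xs(1,2)])
    show "mset xs = mset (?ys @ [xs ! i])" by (subst sp(1)) simp
  qed
  then have "fbr F (?ys @ [xs ! i]) \<noteq> 0" using nz by auto
  moreover have "set ?ys \<subseteq> hmg" using xs(2) by (auto dest: in_set_takeD in_set_dropD)
  moreover have "list_all2 (\<lambda>x d. x \<in> deg d) ?ys ?es"
    using xs(3) by (intro list_all2_appendI list_all2_takeI list_all2_dropI)
  moreover have "length ?ys = r - 1" using xs(1) i by simp
  ultimately have "sum_list ?es \<in> {0, 1, - 1}" using left_mult_degree(1) by blast
  moreover have "sum_list ds = sum_list ?es + ds ! i" by (subst sp(2)) simp
  ultimately show ?thesis by simp
qed

text \<open>The instance of \<open>eigen_list\<close> for \<open>z\<close>, with the eigenvalues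
  divided by \<open>M\<close>.\<close>

lemma degree_list:
  assumes Q: "Q \<in> part (Inder r F) p"
    and v: "v \<in> hmg" "v \<in> deg s" "Q v \<in> deg s'" "Q v \<noteq> 0"
  obtains ys ds where "length ys = r - 1" "set ys \<subseteq> hmg" "list_all2 (\<lambda>x d. x \<in> deg d) ys ds"
    "fbr F (ys @ [v]) \<noteq> 0" "s' = sum_list ds + s"
proof -
  have "weights \<subseteq> hmg" "\<And>x. x \<in> weights \<Longrightarrow> \<exists>t. z x = scal F t x"
    by (auto simp: weights_def deg_def)
  from eigen_list[OF z_Inder this(1) span_weights this(2) Q v(1), of "M * s" "M * s'"] v(2-4)
  obtain ys ts where ys: "length ys = r - 1" "set ys \<subseteq> weights" "list_all2 (\<lambda>x t. z x = scal F t x) ys ts"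
    "fbr F (ys @ [v]) \<noteq> 0" "M * s' = sum_list ts + M * s"
    by (auto simp: deg_def)
  let ?ds = "map (\<lambda>t. t / M) ts"
  have *: "list_all2 (\<lambda>x d. x \<in> deg d) ys ?ds"
    using ys(3) M_nonzero by (simp add: list_all2_map2 deg_def)
  have "sum_list ?ds = sum_list ts / M"
    by (induction ts) (auto simp: add_divide_distrib)
  also have "\<dots> = s' - s"
    using ys(5) M_nonzero by (simp add: field_simps)
  finally show thesis
    using that[OF ys(1) _ * ys(4)] ys(2) by (auto simp: weights_def)
qed

text \<open>The sign treats both ends at once: \<open>\<sigma> = 1\<close> for the lowest degree and
  \<open>\<sigma> = -1\<close> for the highest. If \<open>\<tau>\<close> were \<open>0\<close>, left
  multiplications by nonzero eigenvectors could shift degrees only by \<open>\<sigma> N\<close> with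
  \<open>N\<close> a natural number, whereas \<open>c 0\<close> or \<open>b 0\<close>, being
  nonzero, shifts by \<open>-\<sigma>\<close>.\<close>

lemma extremal_degree_nonzero:
  assumes \<sigma>: "\<sigma> = 1 \<or> \<sigma> = - 1"
    and range: "\<And>v t. \<lbrakk>v \<in> deg t; v \<noteq> 0\<rbrakk> \<Longrightarrow> \<exists>k. t = \<tau> + \<sigma> * of_nat k"
  shows "\<tau> \<noteq> 0"
proof
  assume \<tau>: "\<tau> = 0"
  let ?Q = "if \<sigma> = 1 then c 0 else b 0"
  have m: "0 < m" using m_ge by simp
  have Q: "?Q \<in> part (Inder r F) 1" using b_Inder[OF m] c_Inder[OF m] by simp
  have "\<exists>v\<in>weights. ?Q v \<noteq> 0"
  proof (rule ccontr)
    assume "\<not> ?thesis"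
    then have "weights \<subseteq> {v. ?Q v = 0}" by auto
    moreover have "subspace {v. ?Q v = 0}"
      using Inder_add[OF Q] Inder_scal[OF Q] Inder_zero[OF Q] by (simp add: subspace_def)
    ultimately have "?Q v = 0" for v using span_minimal span_weights by blast
    then show False using b_nonzero[OF m] c_nonzero[OF m] by metis
  qed
  then obtain v s where v: "v \<in> hmg" "v \<in> deg s" "?Q v \<noteq> 0" by (auto simp: weights_def)
  have "?Q v \<in> deg (s - \<sigma>)" using deg_b[OF m v(2)] deg_c[OF m v(2)] \<sigma> by auto
  then obtain ys ds where ys: "length ys = r - 1" "set ys \<subseteq> hmg" "list_all2 (\<lambda>x d. x \<in> deg d) ys ds"
    "fbr F (ys @ [v]) \<noteq> 0" "s - \<sigma> = sum_list ds + s"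
    using degree_list[OF Q v(1,2) _ v(3)] by blast
  have "0 \<notin> set ys"
    using fbr_zero_entry[of "ys @ [v]"] ys(1,4) arity by auto
  with ys(3) have "\<exists>N::nat. sum_list ds = \<sigma> * of_nat N"
  proof (induction rule: list_all2_induct)
    case Nil
    then show ?case by (intro exI[of _ 0]) simp
  next
    case (Cons x xs d ds)
    then obtain N k where "sum_list ds = \<sigma> * of_nat N" "d = \<sigma> * of_nat k" using range[of x d] \<tau> by fastforce
    then have "sum_list (d # ds) = \<sigma> * of_nat (k + N)" by (simp add: algebra_simps)
    then show ?case ..
  qed
  then obtain N where "\<sigma> * of_nat N + \<sigma> = 0" using ys(5) by (auto simp: algebra_simps)
  then have "\<sigma> * of_nat (Suc N) = 0" by (simp add: algebra_simps)
  then show False using \<sigma> by (auto simp del: of_nat_Suc)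
qed

text \<open>\<open>z\<close> acts on \<open>v\<close> by the nonzero scalar \<open>M \<tau>\<close>,
  so it yields a list of degree sum \<open>0\<close> whose bracket with \<open>v\<close> is nonzero.
  Omitting \<open>ys ! i\<close> instead of \<open>v\<close> leaves the sum
  \<open>\<tau> - ds ! i\<close>, so each entry is at distance \<open>0\<close> or \<open>1\<close>
  from \<open>\<tau>\<close>. The last equation then gives
  \<open>\<tau> = - \<sigma> N / (r - 1)\<close>, where \<open>N\<close> counts the entries at
  distance \<open>1\<close>.\<close>

lemma extremal_degree_list:
  assumes \<sigma>: "\<sigma> = 1 \<or> \<sigma> = - 1"
    and range: "\<And>v t. \<lbrakk>v \<in> deg t; v \<noteq> 0\<rbrakk> \<Longrightarrow> \<exists>k. t = \<tau> + \<sigma> * of_nat k"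
    and v: "v \<in> hmg" "v \<in> deg \<tau>" "v \<noteq> 0"
  obtains ys ks where "length ys = r - 1" "length ks = r - 1" "set ys \<subseteq> hmg" "set ks \<subseteq> {0, 1}"
    "\<And>i. i < r - 1 \<Longrightarrow> ys ! i \<in> deg (\<tau> + \<sigma> * of_nat (ks ! i))"
    "fbr F (ys @ [v]) \<noteq> 0" "of_nat (r - 1) * \<tau> + \<sigma> * of_nat (sum_list ks) = 0"
proof -
  have "\<tau> \<noteq> 0" by (rule extremal_degree_nonzero[OF \<sigma> range])
  have zv: "z v = scal F (M * \<tau>) v" using v by (simp add: deg_def)
  have "z v \<in> deg \<tau>" unfolding zv using v(2) subspace_scale[OF deg_subspace] by blast
  moreover have "z v \<noteq> 0" using zv \<open>\<tau> \<noteq> 0\<close> M_nonzero v(3) by simp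
  ultimately obtain ys ds where ys: "length ys = r - 1" "set ys \<subseteq> hmg"
    "list_all2 (\<lambda>x d. x \<in> deg d) ys ds" "fbr F (ys @ [v]) \<noteq> 0" "\<tau> = sum_list ds + \<tau>"
    using degree_list[OF z_Inder v(1,2)] by blast
  have len: "length ds = r - 1" using ys(1,3) list_all2_lengthD by metis
  have "\<exists>k\<in>{0, 1}. ds ! i = \<tau> + \<sigma> * of_nat k" if i: "i < r - 1" for i
  proof -
    have "ys ! i \<in> deg (ds ! i)" using ys(1,3) i by (simp add: list_all2_conv_all_nth)
    moreover have "ys ! i \<noteq> 0"
    proof
      assume "ys ! i = 0"
      then have "0 \<in> set (ys @ [v])" using nth_mem[of i ys] ys(1) i by simp
      then show False using fbr_zero_entry[of "ys @ [v]"] ys(1,4) arity by simp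
    qed
    ultimately obtain k where k: "ds ! i = \<tau> + \<sigma> * of_nat k" using range by blast
    have "sum_list (ds @ [\<tau>]) - (ds @ [\<tau>]) ! i \<in> {0, 1, - 1}"
      by (rule degree_constraint[of "ys @ [v]"])
        (use ys v i arity in \<open>auto intro: list_all2_appendI\<close>)
    then have "\<tau> - ds ! i \<in> {0, 1, - 1}" using i len ys(5) by (simp add: nth_append)
    moreover have "\<tau> - ds ! i = - \<sigma> * of_nat k" by (simp add: k)
    ultimately have "- \<sigma> * of_nat k \<in> {0, 1, - 1 :: 'k}" by simp
    then have "of_nat k \<in> {0, 1, - 1 :: 'k}" using \<sigma> by (auto simp: minus_equation_iff)
    moreover have "of_nat k \<noteq> (- 1 :: 'k)"
    proof
      assume "of_nat k = (- 1 :: 'k)"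
      then have "of_nat (Suc k) = (0 :: 'k)" by simp
      then show False by (simp only: of_nat_eq_0_iff)
    qed
    ultimately have "of_nat k = (0 :: 'k) \<or> of_nat k = (1 :: 'k)" by blast
    then have "k = 0 \<or> k = 1" by (simp only: of_nat_eq_0_iff of_nat_eq_1_iff)
    then show ?thesis using k by blast
  qed
  then obtain kf where kf: "\<And>i. i < r - 1 \<Longrightarrow> kf i \<in> {0, 1} \<and> ds ! i = \<tau> + \<sigma> * of_nat (kf i)" by metis
  let ?ks = "map kf [0..<r - 1]"
  have ds: "ds = map (\<lambda>i. \<tau> + \<sigma> * of_nat (kf i)) [0..<r - 1]"
    by (rule nth_equalityI) (use len kf in auto)
  have "sum_list (map (\<lambda>i. \<tau> + \<sigma> * of_nat (kf i)) xs)
      = of_nat (length xs) * \<tau> + \<sigma> * of_nat (sum_list (map kf xs))" for xs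
    by (induction xs) (auto simp: algebra_simps)
  then have "sum_list ds = of_nat (r - 1) * \<tau> + \<sigma> * of_nat (sum_list ?ks)"
    unfolding ds by simp
  then have "of_nat (r - 1) * \<tau> + \<sigma> * of_nat (sum_list ?ks) = 0" using ys(5) by simp
  moreover have "ys ! i \<in> deg (\<tau> + \<sigma> * of_nat (?ks ! i))" if "i < r - 1" for i
    using ys(1,3) that kf by (auto simp: list_all2_conv_all_nth)
  moreover have "set ?ks \<subseteq> {0, 1}" using kf by fastforce
  ultimately show thesis using that[OF ys(1) _ ys(2) _ _ ys(4), of ?ks] by simp
qed

end

lemma sum_list_zero_one:
  assumes "set ks \<subseteq> {0, 1 :: nat}"
  shows "sum_list ks \<le> length ks" "sum_list ks = length ks \<Longrightarrow> set ks \<subseteq> {1}"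
proof -
  have "sum_list ks \<le> length ks \<and> (sum_list ks = length ks \<longrightarrow> set ks \<subseteq> {1})"
    using assms by (induction ks) auto
  then show "sum_list ks \<le> length ks" "sum_list ks = length ks \<Longrightarrow> set ks \<subseteq> {1}" by auto
qed

section \<open>Reduction to the degrees \<open>1\<close>, \<open>0\<close> and
  \<open>-1\<close>\<close>

context A0_filippov
begin

lemma self_neg_zero: "x = - x \<Longrightarrow> x = (0::'v)"
proof -
  assume "x = - x"
  then have "x + x = 0" by (metis add.right_inverse)
  then have "scal F 2 x = 0" using scale_left_distrib[of 1 1 x] by simp
  then show "x = 0" by simp
qed

text \<open>If nothing lies in degree \<open>\<mu> + 1\<close>, every \<open>b i\<close> kills
  \<open>deg \<mu>\<close>, so \<open>z\<close> is the sum of the \<open>b i c i\<close> there. If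
  nothing lies in degree \<open>\<mu> - 2\<close>, then \<open>z\<close> is the sum of the
  \<open>c i b i\<close> on \<open>deg (\<mu> - 1)\<close>. The traces of the two sums agree, and
  they are the dimensions times \<open>M \<mu>\<close> and \<open>M (\<mu> - 1)\<close>.\<close>

lemma adjacent_degrees_trace:
  assumes \<mu>: "\<exists>v\<in>deg \<mu>. v \<noteq> 0" and up: "deg (\<mu> + 1) \<subseteq> {0}" and down: "deg (\<mu> - 2) \<subseteq> {0}"
  obtains p q :: nat where "p > 0" "of_nat p * \<mu> = of_nat q * (\<mu> - 1)"
proof -
  obtain B0 where B0: "finite B0" "span B0 = UNIV" using fin by (auto simp: finite_dimensional_def)
  obtain A where A: "A \<subseteq> deg \<mu>" "independent A" "deg \<mu> \<subseteq> span A"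
    using maximal_independent_subset by blast
  obtain B where B: "B \<subseteq> deg (\<mu> - 1)" "independent B" "deg (\<mu> - 1) \<subseteq> span B"
    using maximal_independent_subset by blast
  have fAB: "finite A" "finite B" using independent_span_bound[OF B0(1)] A(2) B(2) B0(2) by auto
  have "of_nat (card A) * (M * \<mu>) = of_nat (card B) * (M * (\<mu> - 1))"
  proof (rule trace_comm[where I = "{..<m}" and b = b and c = c, OF fAB(1) A(2) fAB(2) B(2)])
    fix i assume i: "i \<in> {..<m}"
    then have i': "i < m" by simp
    show "Vector_Spaces.linear (scal F) (scal F) (b i)" "Vector_Spaces.linear (scal F) (scal F) (c i)"
      using Inder_linear b_Inder[OF i'] c_Inder[OF i'] by blast+
    show "c i x \<in> span B" if "x \<in> A" for x using deg_c[OF i', of x \<mu>] that A B by blast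
    show "b i y \<in> span A" if "y \<in> B" for y using deg_b[OF i', of y "\<mu> - 1"] that A B by auto
  next
    fix x assume x: "x \<in> A"
    have "b i (c i x) = e i i x" if "i < m" for i
    proof -
      have "b i x = 0" using deg_b[OF that] x A(1) up by blast
      then show ?thesis using bc[OF that that, of x] by (simp add: c_simps[OF that])
    qed
    then have "(\<Sum>i<m. b i (c i x)) = z x" by (simp add: z_def)
    then show "(\<Sum>i<m. b i (c i x)) = scal F (M * \<mu>) x" using x A(1) by (auto simp: deg_def)
  next
    fix y assume y: "y \<in> B"
    have "c i (b i y) = e i i y" if "i < m" for i
    proof -
      have "c i y \<in> deg (\<mu> - 2)" using deg_c[OF that, of y "\<mu> - 1"] y B(1) by auto
      then have "c i y = 0" using down by blast
      then show ?thesis using bc[OF that that, of y] by (simp add: b_simps[OF that])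
    qed
    then have "(\<Sum>i<m. c i (b i y)) = z y" by (simp add: z_def)
    then show "(\<Sum>i<m. c i (b i y)) = scal F (M * (\<mu> - 1)) y" using y B(1) by (auto simp: deg_def)
  qed
  then have "M * (of_nat (card A) * \<mu>) = M * (of_nat (card B) * (\<mu> - 1))"
    by (simp only: mult.left_commute)
  then have eq: "of_nat (card A) * \<mu> = of_nat (card B) * (\<mu> - 1)"
    using M_nonzero by (simp only: mult_cancel_left) simp
  have "A \<noteq> {}"
  proof
    assume "A = {}"
    then have "deg \<mu> \<subseteq> {0}" using A(3) by simp
    then show False using \<mu> by blast
  qed
  then have "card A > 0" using fAB(1) by (simp add: card_gt_0_iff)
  then show thesis using that eq by blast
qed

text \<open>The highest degree is \<open>N / (r - 1)\<close> and the lowest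
  \<open>- N' / (r - 1)\<close> with \<open>0 < N, N' \<le> r - 1\<close>, so their difference
  \<open>n\<close> is \<open>1\<close> or \<open>2\<close>. Traces exclude \<open>n = 1\<close>, and
  \<open>n = 2\<close> forces \<open>N = N' = r - 1\<close>. Then every entry of a list found for a
  vector of degree \<open>1\<close> is at distance \<open>1\<close> from it, that is, of degree
  \<open>0\<close>.\<close>

lemma three_degrees:
  shows deg_cases: "\<lbrakk>v \<in> deg t; v \<noteq> 0\<rbrakk> \<Longrightarrow> t = 1 \<or> t = 0 \<or> t = - 1"
    and deg_1: "\<exists>v\<in>deg 1. v \<noteq> 0"
    and deg_neg_1: "\<exists>v\<in>deg (- 1). v \<noteq> 0"
    and deg_0_list: "\<lbrakk>u \<in> hmg; u \<in> deg 1; u \<noteq> 0\<rbrakk> \<Longrightarrow>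
      \<exists>ys. length ys = r - 1 \<and> set ys \<subseteq> hmg \<inter> deg 0 \<and> fbr F (ys @ [u]) \<noteq> 0"
proof -
  obtain \<kappa> n where \<kappa>: "\<exists>v\<in>deg \<kappa>. v \<noteq> 0" and \<mu>: "\<exists>v\<in>deg (\<kappa> + of_nat n). v \<noteq> 0"
    and range: "\<And>v t. \<lbrakk>v \<in> deg t; v \<noteq> 0\<rbrakk> \<Longrightarrow> \<exists>i\<le>n. t = \<kappa> + of_nat i"
    using degree_range by metis
  let ?\<mu> = "\<kappa> + of_nat n"
  have bottom: "\<exists>k. t = \<kappa> + 1 * of_nat k" if "v \<in> deg t" "v \<noteq> 0" for v t
    using range[OF that] by auto
  have top: "\<exists>k. t = ?\<mu> + - 1 * of_nat k" if v: "v \<in> deg t" "v \<noteq> 0" for v t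
  proof -
    obtain i where "i \<le> n" "t = \<kappa> + of_nat i" using range[OF v] by blast
    then have "t = ?\<mu> + - 1 * of_nat (n - i)" by (simp add: of_nat_diff)
    then show ?thesis ..
  qed
  obtain v\<kappa> where v\<kappa>: "v\<kappa> \<in> hmg" "v\<kappa> \<in> deg \<kappa>" "v\<kappa> \<noteq> 0" using \<kappa> deg_hmg_nonzero by blast
  obtain v\<mu> where v\<mu>: "v\<mu> \<in> hmg" "v\<mu> \<in> deg ?\<mu>" "v\<mu> \<noteq> 0" using \<mu> deg_hmg_nonzero by blast
  have r1: "r - 1 > 0" using r_ge by simp
  have "\<kappa> \<noteq> 0" by (rule extremal_degree_nonzero[of 1]) (use bottom in auto)
  have "?\<mu> \<noteq> 0" by (rule extremal_degree_nonzero[of "- 1"]) (use top in auto)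
  obtain ys ks where ks: "length ks = r - 1" "set ks \<subseteq> {0, 1}"
    "of_nat (r - 1) * ?\<mu> + - 1 * of_nat (sum_list ks) = 0"
    by (rule extremal_degree_list[of "- 1" ?\<mu> v\<mu>]) (use top v\<mu> in auto)
  obtain ys' ks' where ks': "length ks' = r - 1" "set ks' \<subseteq> {0, 1}"
    "of_nat (r - 1) * \<kappa> + 1 * of_nat (sum_list ks') = 0"
    by (rule extremal_degree_list[of 1 \<kappa> v\<kappa>]) (use bottom v\<kappa> in auto)
  let ?N = "sum_list ks" and ?N' = "sum_list ks'"
  have N: "of_nat (r - 1) * ?\<mu> = of_nat ?N" using ks(3) by simp
  have N': "of_nat (r - 1) * \<kappa> = - of_nat ?N'" using ks'(3) by (simp add: eq_neg_iff_add_eq_0)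
  have "?N \<noteq> 0" using N \<open>?\<mu> \<noteq> 0\<close> r1 by (metis mult_eq_0_iff of_nat_0 of_nat_eq_0_iff less_irrefl)
  have "?N' \<noteq> 0" using N' \<open>\<kappa> \<noteq> 0\<close> r1
    by (metis mult_eq_0_iff of_nat_0 of_nat_eq_0_iff less_irrefl minus_zero)
  have le: "?N \<le> r - 1" "?N' \<le> r - 1" using sum_list_zero_one(1) ks ks' by metis+
  have "of_nat ((r - 1) * n) = (of_nat (?N + ?N') :: 'k)"
    using N N' unfolding of_nat_mult of_nat_add by (simp add: algebra_simps)
  then have nN: "(r - 1) * n = ?N + ?N'" by (simp only: of_nat_eq_iff)
  have "n \<noteq> 1"
  proof
    assume n: "n = 1"
    have "deg (?\<mu> + 1) \<subseteq> {0}"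
    proof safe
      fix v assume "v \<in> deg (?\<mu> + 1)"
      show "v = 0"
      proof (rule ccontr)
        assume "v \<noteq> 0"
        then obtain k where "?\<mu> + 1 = ?\<mu> + - 1 * of_nat k" using top \<open>v \<in> _\<close> by blast
        then have "(of_nat (Suc k) :: 'k) = 0" by (simp add: eq_neg_iff_add_eq_0 add.commute)
        then show False by (simp only: of_nat_eq_0_iff)
      qed
    qed
    moreover have "deg (?\<mu> - 2) \<subseteq> {0}"
    proof safe
      fix v assume "v \<in> deg (?\<mu> - 2)"
      show "v = 0"
      proof (rule ccontr)
        assume "v \<noteq> 0"
        then obtain k where "?\<mu> - 2 = \<kappa> + 1 * of_nat k" using bottom \<open>v \<in> _\<close> by blast
        then have "(of_nat (Suc k) :: 'k) = 0" by (simp add: n algebra_simps)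
        then show False by (simp only: of_nat_eq_0_iff)
      qed
    qed
    ultimately obtain p q :: nat where pq: "p > 0" "of_nat p * ?\<mu> = of_nat q * (?\<mu> - 1)"
      using adjacent_degrees_trace[OF \<mu>] by blast
    \<comment> \<open>Multiplied by \<open>r - 1\<close>, the trace identity reads
      \<open>p N = - q N'\<close>, where \<open>p N\<close> is positive and \<open>q N'\<close> is a
      natural number.\<close>
    have "of_nat (p * ?N) = of_nat p * (of_nat (r - 1) * ?\<mu>)" using N by simp
    also have "\<dots> = of_nat q * (of_nat (r - 1) * \<kappa>)" using pq(2) n by (simp add: mult.left_commute)
    also have "\<dots> = - of_nat (q * ?N')" using N' by simp
    finally have "of_nat (p * ?N + q * ?N') = (0 :: 'k)" by simp
    then show False using pq(1) \<open>?N \<noteq> 0\<close> by (simp only: of_nat_eq_0_iff) simp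
  qed
  moreover have "n \<noteq> 0" using nN \<open>?N \<noteq> 0\<close> by (metis add_is_0 mult_0_right)
  moreover have "n \<le> 2"
  proof -
    have "(r - 1) * n \<le> (r - 1) * 2" using nN le by simp
    then show ?thesis using r1 by simp
  qed
  ultimately have n: "n = 2" by simp
  then have NN: "?N = r - 1" "?N' = r - 1" using nN le by simp_all
  have \<mu>1: "?\<mu> = 1" using N NN r1 by simp
  then have \<kappa>1: "\<kappa> = - 1" using n by (simp add: eq_neg_iff_add_eq_0 add.commute)
  show "t = 1 \<or> t = 0 \<or> t = - 1" if v: "v \<in> deg t" "v \<noteq> 0"
  proof -
    obtain i where i: "i \<le> 2" "t = - 1 + of_nat i" using range[OF v] n \<kappa>1 by auto
    then have "i = 0 \<or> i = 1 \<or> i = 2" by linarith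
    then show ?thesis using i(2) by auto
  qed
  show "\<exists>v\<in>deg 1. v \<noteq> 0" "\<exists>v\<in>deg (- 1). v \<noteq> 0" using \<mu> \<kappa> by (simp_all only: \<mu>1) (simp only: \<kappa>1)
  show "\<exists>ys. length ys = r - 1 \<and> set ys \<subseteq> hmg \<inter> deg 0 \<and> fbr F (ys @ [u]) \<noteq> 0"
    if u: "u \<in> hmg" "u \<in> deg 1" "u \<noteq> 0"
  proof -
    have top': "\<exists>k. t = 1 + - 1 * of_nat k" if "v \<in> deg t" "v \<noteq> 0" for v t
      using top[OF that] unfolding \<mu>1 .
    obtain ys ks where ys: "length ys = r - 1" "length ks = r - 1" "set ys \<subseteq> hmg" "set ks \<subseteq> {0, 1}"
      "\<And>i. i < r - 1 \<Longrightarrow> ys ! i \<in> deg (1 + - 1 * of_nat (ks ! i))"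
      "fbr F (ys @ [u]) \<noteq> 0" "of_nat (r - 1) * (1::'k) + - 1 * of_nat (sum_list ks) = 0"
      by (rule extremal_degree_list[of "- 1" 1 u]) (use top' u in auto)
    have "of_nat (sum_list ks) = (of_nat (r - 1) :: 'k)" using ys(7) by (simp add: eq_neg_iff_add_eq_0)
    then have "sum_list ks = length ks" using ys(2) by (simp only: of_nat_eq_iff)
    then have "set ks \<subseteq> {1}" using sum_list_zero_one(2) ys(4) by blast
    then have "ks ! i = 1" if "i < r - 1" for i 
    proof -
      have "ks ! i \<in> set ks" using that ys(2) by simp
      then show ?thesis using \<open>set ks \<subseteq> {1}\<close> by blast
    qed
    then have "ys ! i \<in> deg 0" if "i < r - 1" for i using ys(5)[OF that] that by simp
    then have "set ys \<subseteq> deg 0" using ys(1) by (auto simp: in_set_conv_nth)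
    then show ?thesis using ys(1,3,6) by blast
  qed
qed

section \<open>Triviality of \<open>sl(m)\<close> in degrees \<open>1\<close> and
  \<open>-1\<close>\<close>

lemma deg_fbr:
  assumes "length xs = r" "set xs \<subseteq> hmg" "list_all2 (\<lambda>x d. x \<in> deg d) xs ds"
  shows "fbr F xs \<in> deg (sum_list ds)"
proof -
  have "z (fbr F xs) = scal F (sum_list (map ((*) M) ds)) (fbr F xs)"
    using assms by (intro derivation_eigen[OF z_Inder]) (simp_all add: list_all2_map2 deg_def)
  then show ?thesis by (simp add: deg_def sum_list_const_mult)
qed

text \<open>If a nonzero combination of the \<open>b i\<close> killed degree \<open>-1\<close>,
  commutators with the \<open>e i j\<close> would make every \<open>b l\<close> kill it. Since the
  \<open>c i\<close> lead from it to degree \<open>-2\<close>, which is zero, it would be a stable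
  subspace, against irreducibility.\<close>

lemma odd_part_not_annihilating:
  assumes D: "\<And>v. D v = (\<Sum>i<m. scal F (\<beta> i) (b i v))" and nz: "D x \<noteq> 0"
  shows "\<exists>w\<in>hmg \<inter> deg (- 1). D w \<noteq> 0"
proof (rule ccontr)
  assume none: "\<not> ?thesis"
  have D_add: "D (v + w) = D v + D w" for v w
    by (simp add: D b_simps scale_right_distrib sum.distrib)
  have D_scal: "D (scal F a v) = scal F a (D v)" for a v
    by (simp add: D b_simps scale_sum_right mult.commute)
  have "subspace {v. D v = 0}"
    using D_add D_scal D_scal[of 0 0] by (auto simp: subspace_def)
  then have Dk: "D v = 0" if "v \<in> deg (- 1)" for v
    using deg_hmg[OF that] none span_minimal[of "hmg \<inter> deg (- 1)" "{v. D v = 0}"] by blast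
  obtain k where k: "k < m" "\<beta> k \<noteq> 0"
  proof -
    have "\<exists>k<m. \<beta> k \<noteq> 0"
    proof (rule ccontr)
      assume "\<not> ?thesis"
      then have "D x = 0" by (simp add: D)
      then show False using nz by simp
    qed
    then show thesis using that by blast
  qed
  \<comment> \<open>For \<open>l \<noteq> k\<close> the commutator of \<open>e k l\<close> with
    \<open>D\<close> is \<open>- \<beta> k\<close> times \<open>b l\<close>.\<close>
  have kl: "b l v = 0" if l: "l < m" "l \<noteq> k" and v: "v \<in> deg (- 1)" for l v
  proof -
    have "e k l (D v) - D (e k l v) = (\<Sum>i<m. scal F (\<beta> i) (e k l (b i v) - b i (e k l v)))"
      using k l by (simp add: D e_simps sum_subtractf scale_right_diff_distrib)
    also have "\<dots> = (\<Sum>i<m. if i = k then - scal F (\<beta> i) (b l v) else 0)"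
      using k l by (intro sum.cong refl) (simp add: eb)
    also have "\<dots> = - scal F (\<beta> k) (b l v)" using k by simp
    finally show ?thesis
      using Dk[OF v] Dk[OF deg_e[OF k(1) l(1) v]] k by (simp add: e_simps[OF k(1) l(1)])
  qed
  have all: "b l v = 0" if l: "l < m" and v: "v \<in> deg (- 1)" for l v
  proof (cases "l = k")
    case True
    \<comment> \<open>A second index exists because \<open>m \<ge> 2\<close>; the commutator of
      \<open>e j k\<close> with \<open>b j\<close> recovers \<open>b k\<close>.\<close>
    obtain j where j: "j < m" "j \<noteq> k"
      using m_ge by (metis Suc_le_lessD less_2_cases_iff less_le_trans one_add_one plus_1_eq_Suc zero_less_one zero_neq_one not_less0 nat_neq_iff)
    have "e j k (b j v) - b j (e j k v) = - b k v" using eb[OF j(1) k(1) j(1)] j by simp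
    then show ?thesis
      using kl[OF j v] kl[OF j deg_e[OF j(1) k(1) v]] True by (simp add: e_simps[OF j(1) k(1)])
  qed (use kl l v in blast)
  obtain y where y: "y \<in> hmg" "y \<in> deg (- 1)" "y \<noteq> 0" using deg_neg_1 deg_hmg_nonzero by blast
  have "span (hmg \<inter> deg (- 1)) = UNIV"
  proof (rule span_UNIV[of _ y])
    fix v i assume v: "v \<in> hmg \<inter> deg (- 1)" and i: "i < m"
    show "e i j v \<in> span (hmg \<inter> deg (- 1))" if "j < m" for j
      using v i that deg_e Inder_hmg[OF e_Inder] by (intro span_base) blast
    show "b i v \<in> span (hmg \<inter> deg (- 1))" using all[OF i] v by (simp add: span_zero)
    have "c i v \<in> deg (- 1 - 1)" using deg_c[OF i] v by blast
    then have "c i v = 0" using deg_cases[of "c i v" "- 1 - 1"] by auto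
    then show "c i v \<in> span (hmg \<inter> deg (- 1))" by (simp add: span_zero)
  qed (use y in auto)
  moreover obtain v where v: "v \<in> deg 1" "v \<noteq> 0" using deg_1 by blast
  ultimately have "\<exists>x\<in>(hmg \<inter> deg (- 1)) \<inter> deg 1. x \<noteq> 0"
    by (intro deg_in_span_nonzero[OF _ _ v]) auto
  then show False using deg_unique[of _ 1 "- 1"] by auto
qed

definition kills :: "('v \<Rightarrow> 'v) \<Rightarrow> bool"
  where "kills f \<longleftrightarrow> (\<forall>v\<in>deg 1 \<union> deg (- 1). f v = 0)"

text \<open>Start from a nonzero bracket of \<open>u\<close> with entries of degree
  \<open>0\<close>. Without the entry \<open>x\<close> it acts as a combination of the
  \<open>b i\<close>, so it is nonzero on some \<open>w\<close> of degree \<open>-1\<close>. Now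
  release \<open>y\<close>: the left multiplication by \<open>u\<close>, \<open>w\<close> and the
  other entries has degree \<open>0\<close> and is nonzero at \<open>y\<close>. An argument of
  degree \<open>d = 1\<close> or \<open>d = -1\<close> would leave the sums \<open>d - 1\<close> and
  \<open>d + 1\<close> when \<open>u\<close> or \<open>w\<close> is omitted, and one of these is
  \<open>2\<close> or \<open>-2\<close>, which is impossible.\<close>

lemma annihilator_exists:
  obtains g x where "kills (\<lambda>v. \<Sum>i<m. \<Sum>j<m. scal F (g i j) (e i j v))"
    "(\<Sum>i<m. \<Sum>j<m. scal F (g i j) (e i j x)) \<noteq> 0"
proof -
  obtain u where u: "u \<in> hmg" "u \<in> deg 1" "u \<noteq> 0" using deg_1 deg_hmg_nonzero by blast
  obtain ys where ys: "length ys = r - 1" "set ys \<subseteq> hmg \<inter> deg 0" "fbr F (ys @ [u]) \<noteq> 0"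
    using deg_0_list[OF u] by blast
  obtain x y zs where xy: "ys = x # y # zs"
    using ys(1) r_ge by (metis One_nat_def Suc_le_length_iff diff_le_mono numeral_3_eq_3 diff_Suc_1)
  have len: "length zs = r - 3" using ys(1) xy r_ge by simp
  have perm: "fbr F xs' \<noteq> 0" if "fbr F xs \<noteq> 0" "mset xs = mset xs'" "length xs = r" "set xs \<subseteq> hmg" for xs xs'
    using fbr_permute[OF that(2-4)] that(1) by auto
  have zs: "list_all2 (\<lambda>x d. x \<in> deg d) zs (replicate (length zs) 0)" "set zs \<subseteq> hmg"
    using ys(2) xy by (auto simp: list_all2_conv_all_nth)
  have xy': "x \<in> hmg" "y \<in> hmg" "x \<in> deg 0" "y \<in> deg 0" using ys(2) xy by auto
  have nzx: "fbr F ((y # zs @ [u]) @ [x]) \<noteq> 0"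
    by (rule perm[OF ys(3)]) (use xy ys u r_ge in auto)
  have dl: "list_all2 (\<lambda>x d. x \<in> deg d) (y # zs @ [u]) (0 # replicate (length zs) 0 @ [1])"
    using zs xy' u by (simp add: list_all2_appendI)
  have rep0: "sum_list (replicate k (0 :: 'k)) = 0" for k by (induction k) auto
  then have "sum_list (0 # replicate (length zs) 0 @ [1 :: 'k]) = 1" by simp
  then have "\<exists>\<beta>. \<forall>v. fbr F ((y # zs @ [u]) @ [v]) = (\<Sum>i<m. scal F (\<beta> i) (b i v))"
    by (intro left_mult_degree(3)[of _ "0 # replicate (length zs) 0 @ [1]" x])
      (use nzx dl len r_ge zs xy' u in auto)
  then obtain \<beta> where \<beta>: "\<And>v. fbr F ((y # zs @ [u]) @ [v]) = (\<Sum>i<m. scal F (\<beta> i) (b i v))" by blast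
  obtain w where w: "w \<in> hmg" "w \<in> deg (- 1)" "fbr F ((y # zs @ [u]) @ [w]) \<noteq> 0"
    using odd_part_not_annihilating[OF \<beta> nzx] by blast
  let ?L = "zs @ [u, w]"
  have nz: "fbr F (?L @ [y]) \<noteq> 0"
    by (rule perm[OF w(3)]) (use len r_ge zs xy' u w in auto)
  have L: "length ?L = r - 1" "set ?L \<subseteq> hmg"
    "list_all2 (\<lambda>x d. x \<in> deg d) ?L (replicate (length zs) 0 @ [1, - 1])"
    using len r_ge zs u w by (auto intro: list_all2_appendI)
  have sum0: "sum_list (replicate (length zs) 0 @ [1, - 1 :: 'k]) = 0" by (simp add: rep0)
  obtain g where g: "\<And>v. fbr F (?L @ [v]) = (\<Sum>i<m. \<Sum>j<m. scal F (g i j) (e i j v))"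
    using left_mult_degree(2)[OF L nz sum0] by blast
  have "fbr F (?L @ [v]) = 0" if v: "v \<in> hmg" "v \<in> deg 1 \<union> deg (- 1)" for v
  proof (rule ccontr)
    assume nz: "fbr F (?L @ [v]) \<noteq> 0"
    obtain d :: 'k where d: "v \<in> deg d" "d = 1 \<or> d = - 1" using v(2) by blast
    let ?ds = "replicate (length zs) 0 @ [1, - 1, d]"
    have len': "length (?L @ [v]) = r" "set (?L @ [v]) \<subseteq> hmg"
      "list_all2 (\<lambda>x d. x \<in> deg d) (?L @ [v]) ?ds"
      using len r_ge zs u w v(1) d(1) by (auto intro: list_all2_appendI)
    have "sum_list ?ds - ?ds ! (length zs) \<in> {0, 1, - 1}" "sum_list ?ds - ?ds ! Suc (length zs) \<in> {0, 1, - 1}"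
      by (rule degree_constraint[OF len' nz]; use len r_ge in simp)+
    then have "d - 1 \<in> {0, 1, - 1 :: 'k}" "d + 1 \<in> {0, 1, - 1 :: 'k}" by (simp_all add: nth_append rep0)
    then show False using d(2) by auto
  qed
  then have *: "hmg \<inter> deg t \<subseteq> {v. fbr F (?L @ [v]) = 0}" if "t = 1 \<or> t = - 1" for t
    using that by blast
  have "subspace {v. fbr F (?L @ [v]) = 0}"
    using left_mult_linear[OF L(1)] fbr_zero_entry[of "?L @ [0]"] L(1) r_ge
    by (auto simp: subspace_def left_mult_def Vector_Spaces.linear_iff)
  from span_minimal[OF * this] have "deg t \<subseteq> {v. fbr F (?L @ [v]) = 0}" if "t = 1 \<or> t = - 1" for t
    using that deg_hmg by blast
  then have "kills (\<lambda>v. fbr F (?L @ [v]))" unfolding kills_def by blast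
  then show thesis using that nz unfolding g by blast
qed

lemma killsD: "\<lbrakk>kills f; v \<in> deg 1 \<or> v \<in> deg (- 1)\<rbrakk> \<Longrightarrow> f v = 0"
  by (auto simp: kills_def)

lemma killsI: "(\<And>v. v \<in> deg 1 \<or> v \<in> deg (- 1) \<Longrightarrow> f v = 0) \<Longrightarrow> kills f"
  by (auto simp: kills_def)

lemma ends_e: "\<lbrakk>v \<in> deg 1 \<or> v \<in> deg (- 1); i < m; j < m\<rbrakk> \<Longrightarrow> e i j v \<in> deg 1 \<or> e i j v \<in> deg (- 1)"
  using deg_e by blast

text \<open>The \<open>e i j\<close> preserve degrees, so their commutators with an operator that
  kills degrees \<open>1\<close> and \<open>-1\<close> kill them too. The double commutator
  \<open>[e j i, [e j i, D]]\<close> equals \<open>- 2 g i j\<close> times \<open>e j i\<close>,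
  which isolates one coefficient at the price of exchanging the indices.\<close>

lemma kills_transpose:
  assumes D: "kills (\<lambda>v. \<Sum>k<m. \<Sum>l<m. scal F (g k l) (e k l v))"
    and ij: "i < m" "j < m" "i \<noteq> j" "g i j \<noteq> 0"
  shows "kills (e j i)"
proof (rule killsI)
  fix v assume v: "v \<in> deg 1 \<or> v \<in> deg (- 1)"
  let ?D = "\<lambda>v. \<Sum>k<m. \<Sum>l<m. scal F (g k l) (e k l v)"
  \<comment> \<open>This is the commutator of \<open>e j i\<close> with \<open>?D\<close>.\<close>
  let ?A = "\<lambda>v. (\<Sum>l<m. scal F (g i l) (e j l v)) - (\<Sum>k<m. scal F (g k j) (e k i v))"
  have A: "e j i (?D v) - ?D (e j i v) = ?A v" for v
  proof -
    have "e j i (?D v) - ?D (e j i v)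
        = (\<Sum>k<m. \<Sum>l<m. scal F (g k l) (e j i (e k l v) - e k l (e j i v)))"
      using ij by (simp add: e_simps sum_subtractf scale_right_diff_distrib)
    also have "\<dots> = (\<Sum>k<m. \<Sum>l<m. (if i = k then scal F (g i l) (e j l v) else 0)
        - (if l = j then scal F (g k j) (e k i v) else 0))"
      using ij by (intro sum.cong refl) (auto simp: ee scale_right_diff_distrib)
    also have "\<dots> = (\<Sum>l<m. \<Sum>k<m. if i = k then scal F (g i l) (e j l v) else 0)
        - (\<Sum>k<m. \<Sum>l<m. if l = j then scal F (g k j) (e k i v) else 0)"
      unfolding sum_subtractf by (subst sum.swap) simp
    also have "\<dots> = ?A v" using ij by simp
    finally show ?thesis .
  qed
  have "e j i (?A v) - ?A (e j i v)
      = (\<Sum>l<m. scal F (g i l) (e j i (e j l v) - e j l (e j i v)))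
        - (\<Sum>k<m. scal F (g k j) (e j i (e k i v) - e k i (e j i v)))"
    using ij by (simp add: e_simps sum_subtractf scale_right_diff_distrib)
  also have "\<dots> = (\<Sum>l<m. if l = j then - scal F (g i j) (e j i v) else 0)
        - (\<Sum>k<m. if i = k then scal F (g i j) (e j i v) else 0)"
  proof (intro arg_cong2[where f = "(-)"] sum.cong refl)
    fix l assume "l \<in> {..<m}"
    then show "scal F (g i l) (e j i (e j l v) - e j l (e j i v))
        = (if l = j then - scal F (g i j) (e j i v) else 0)"
      using ij ee[of j i j l v] by simp
  next
    fix k assume "k \<in> {..<m}"
    then show "scal F (g k j) (e j i (e k i v) - e k i (e j i v))
        = (if i = k then scal F (g i j) (e j i v) else 0)"
      using ij ee[of j i k i v] by simp
  qed
  also have "\<dots> = - scal F (2 * g i j) (e j i v)"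
  proof -
    have "scal F (2 * g i j) (e j i v) = scal F (g i j) (e j i v) + scal F (g i j) (e j i v)"
      by (simp only: mult_2 scale_left_distrib)
    then show ?thesis using ij by simp
  qed
  finally have "e j i (?A v) - ?A (e j i v) = - scal F (2 * g i j) (e j i v)" .
  moreover have v': "e j i v \<in> deg 1 \<or> e j i v \<in> deg (- 1)" using ends_e[OF v ij(2,1)] .
  have "?D v = 0" "?D (e j i v) = 0" "?D (e j i (e j i v)) = 0"
    using killsD[OF D v] killsD[OF D v'] killsD[OF D ends_e[OF v' ij(2,1)]] by simp_all
  then have "?A v = 0" "?A (e j i v) = 0"
    using A[of v] A[of "e j i v"] ij by (simp_all add: e_simps)
  ultimately show "e j i v = 0" using ij by (simp add: e_simps)
qed

text \<open>If the annihilating operator is diagonal, its coefficients are not all equal: otherwise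
  it would be a nonzero multiple of \<open>z\<close>, which acts on degree \<open>1\<close> by
  \<open>M\<close>. For two different coefficients its commutator with \<open>e i j\<close> is a
  nonzero multiple of \<open>e i j\<close>.\<close>

lemma kills_offdiagonal_exists: "\<exists>i<m. \<exists>j<m. i \<noteq> j \<and> kills (e i j)"
proof -
  obtain g x where g: "kills (\<lambda>v. \<Sum>i<m. \<Sum>j<m. scal F (g i j) (e i j v))"
    and x: "(\<Sum>i<m. \<Sum>j<m. scal F (g i j) (e i j x)) \<noteq> 0"
    by (rule annihilator_exists)
  show ?thesis
  proof (cases "\<exists>i<m. \<exists>j<m. i \<noteq> j \<and> g i j \<noteq> 0")
    case True
    then obtain i j where "i < m" "j < m" "i \<noteq> j" "g i j \<noteq> 0" by blast
    with kills_transpose[OF g this] show ?thesis by metis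
  next
    case False
    let ?D = "\<lambda>v. \<Sum>k<m. scal F (g k k) (e k k v)"
    have D: "(\<Sum>i<m. \<Sum>j<m. scal F (g i j) (e i j v)) = ?D v" for v
    proof (intro sum.cong refl)
      fix i assume i: "i \<in> {..<m}"
      then have "(\<Sum>j<m. scal F (g i j) (e i j v)) = (\<Sum>j<m. if j = i then scal F (g i i) (e i i v) else 0)"
        using False by (intro sum.cong refl) auto
      then show "(\<Sum>j<m. scal F (g i j) (e i j v)) = scal F (g i i) (e i i v)" using i by simp
    qed
    have kD: "kills ?D" using g unfolding D .
    have "\<exists>i<m. \<exists>j<m. g i i \<noteq> g j j"
    proof (rule ccontr)
      assume "\<not> ?thesis"
      then have const: "g k k = g 0 0" if "k < m" for k using that by (metis less_nat_zero_code neq0_conv)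
      have Dz: "?D v = scal F (g 0 0) (z v)" for v
        unfolding z_def scale_sum_right
      proof (rule sum.cong[OF refl])
        fix k assume "k \<in> {..<m}"
        then have "g k k = g 0 0" by (intro const) simp
        then show "scal F (g k k) (e k k v) = scal F (g 0 0) (e k k v)" by (simp only:)
      qed
      obtain v where v: "v \<in> deg 1" "v \<noteq> 0" using deg_1 by blast
      have "scal F (g 0 0) (z v) = 0" unfolding Dz[symmetric] using v(1) by (intro killsD[OF kD]) simp
      then have "g 0 0 = 0" using v M_nonzero by (simp add: deg_def)
      then show False using x by (simp add: D Dz)
    qed
    then obtain i j where ij: "i < m" "j < m" "g i i \<noteq> g j j" by blast
    have "kills (e i j)"
    proof (rule killsI)
      fix v assume v: "v \<in> deg 1 \<or> v \<in> deg (- 1)"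
      have "?D (e i j v) - e i j (?D v) = (\<Sum>k<m. scal F (g k k) (e k k (e i j v) - e i j (e k k v)))"
        using ij by (simp add: e_simps sum_subtractf scale_right_diff_distrib)
      also have "\<dots> = (\<Sum>k<m. (if k = i then scal F (g i i) (e i j v) else 0)
          - (if k = j then scal F (g j j) (e i j v) else 0))"
        using ij by (intro sum.cong refl) (auto simp: ee scale_right_diff_distrib)
      also have "\<dots> = scal F (g i i - g j j) (e i j v)"
        using ij by (simp add: sum_subtractf scale_left_diff_distrib)
      finally have "scal F (g i i - g j j) (e i j v) = 0"
        using killsD[OF kD v] killsD[OF kD ends_e[OF v ij(1,2)]] ij by (simp add: e_simps)
      then show "e i j v = 0" using ij(3) by simp
    qed
    moreover have "i \<noteq> j" using ij(3) by blast
    ultimately show ?thesis using ij(1,2) by blast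
  qed
qed

text \<open>Commutators spread one annihilating \<open>e i j\<close> to all off-diagonal pairs:
  \<open>row\<close> and \<open>col\<close> change one index each. Exchanging \<open>i\<close> and
  \<open>j\<close> in this way would take a third index, hence the separate step
  \<open>flip\<close>, which also covers \<open>m = 2\<close>.\<close>

lemma kills_e:
  assumes kl: "k < m" "l < m" "k \<noteq> l"
  shows "kills (e k l)"
proof -
  have row: "kills (e i' j)" if "kills (e i j)" "i < m" "j < m" "i' < m" "i' \<noteq> j" for i i' j
  proof (rule killsI)
    fix v assume v: "v \<in> deg 1 \<or> v \<in> deg (- 1)"
    have "e i' i (e i j v) - e i j (e i' i v) = e i' j v"
      using ee[of i' i i j v] that by simp
    then show "e i' j v = 0"
      using killsD[OF that(1) v] killsD[OF that(1) ends_e[OF v]] that by (simp add: e_simps)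
  qed
  have col: "kills (e i j')" if "kills (e i j)" "i < m" "j < m" "j' < m" "i \<noteq> j'" for i j j'
  proof (rule killsI)
    fix v assume v: "v \<in> deg 1 \<or> v \<in> deg (- 1)"
    have "e i j (e j j' v) - e j j' (e i j v) = e i j' v"
      using ee[of i j j j' v] that by simp
    then show "e i j' v = 0"
      using killsD[OF that(1) v] killsD[OF that(1) ends_e[OF v]] that by (simp add: e_simps)
  qed
  have flip: "kills (e j i)" if "kills (e i j)" "i < m" "j < m" "i \<noteq> j" for i j
  proof (rule kills_transpose[of "\<lambda>k l. if k = i \<and> l = j then 1 else 0"])
    have "(\<Sum>k<m. \<Sum>l<m. scal F (if k = i \<and> l = j then 1 else 0) (e k l v)) = e i j v" for v
    proof -
      have "(\<Sum>k<m. \<Sum>l<m. scal F (if k = i \<and> l = j then 1 else 0) (e k l v))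
          = (\<Sum>k<m. if k = i then (\<Sum>l<m. if l = j then e i j v else 0) else 0)"
        by (intro sum.cong refl) (auto intro!: sum.neutral simp: if_distrib[of "\<lambda>a. scal F a _"] cong: if_cong)
      then show ?thesis using that by simp
    qed
    then show "kills (\<lambda>v. \<Sum>k<m. \<Sum>l<m. scal F (if k = i \<and> l = j then 1 else 0) (e k l v))"
      using that(1) by simp
  qed (use that in auto)
  obtain i j where ij: "i < m" "j < m" "i \<noteq> j" "kills (e i j)" using kills_offdiagonal_exists by blast
  show ?thesis
  proof (cases "k = j")
    case False
    then have "kills (e k j)" using row ij kl by blast
    then show ?thesis using col ij kl by blast
  next
    case True
    then have "kills (e k i)" using flip ij by blast
    then show ?thesis using col ij kl by blast
  qed
qed

text \<open>On degree \<open>1\<close> the \<open>m\<close> operators \<open>e i i\<close> coincide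
  and their sum \<open>z\<close> is \<open>M\<close>; this is their common value.\<close>

definition \<kappa> :: 'k
  where "\<kappa> = M / of_nat m"

lemma m_\<kappa>: "of_nat m * \<kappa> = M"
  using m_ge by (simp add: \<kappa>_def)

text \<open>Off-diagonal operators vanish in these degrees, hence so does
  \<open>[e k i, e i k] = e k k - e i i\<close>. All \<open>e i i\<close> are therefore equal to
  \<open>z\<close> divided by \<open>m\<close>.\<close>

lemma e_ends:
  assumes v: "v \<in> deg t" and t: "t = 1 \<or> t = - 1" and ij: "i < m" "j < m"
  shows "e i j v = (if i = j then scal F (\<kappa> * t) v else 0)"
proof (cases "i = j")
  case False
  then show ?thesis using killsD[OF kills_e[OF ij False]] v t by auto
next
  case True
  have "e k k v = e i i v" if k: "k < m" for k
  proof (cases "k = i")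
    case False
    have "e k i v = 0" "e i k v = 0"
      using killsD[OF kills_e[OF k ij(1) False]] killsD[OF kills_e[OF ij(1) k]] False v t by auto
    then show ?thesis using ee[of k i i k v] k ij by (simp add: e_simps)
  qed simp
  then have "z v = (\<Sum>k<m. e i i v)" by (simp add: z_def)
  then have "scal F (of_nat m) (e i i v) = scal F (M * t) v"
    using v by (simp add: deg_def sum_constant_scale)
  also have "\<dots> = scal F (of_nat m) (scal F (\<kappa> * t) v)" by (simp add: m_\<kappa>[symmetric] mult.assoc)
  finally have "e i i v = scal F (\<kappa> * t) v"
    by (rule scale_left_imp_eq[rotated]) (use m_ge in simp)
  then show ?thesis using True by simp
qed

lemma deg_2: "v \<in> deg t \<Longrightarrow> t = 2 \<or> t = - 2 \<Longrightarrow> v = 0"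
proof (rule ccontr)
  assume "v \<in> deg t" "t = 2 \<or> t = - 2" "v \<noteq> 0"
  then have "(2 :: 'k) \<in> {1, 0, - 1}" using deg_cases[of v t] by (auto simp: minus_equation_iff)
  moreover have "(2 :: 'k) \<noteq> - 1"
  proof
    assume "(2 :: 'k) = - 1"
    then have "(of_nat 3 :: 'k) = 0" by (simp add: eq_neg_iff_add_eq_0)
    then show False by (simp only: of_nat_eq_0_iff)
  qed
  ultimately show False by auto
qed

end

section \<open>The module generated by a vector of degree \<open>1\<close>\<close>

locale A0_filippov_generator = A0_filippov r F m e b c
  for r and F :: "('k::{alg_closed_field,field_char_0}, 'v::ab_group_add) filippov" and m e b c +
  fixes u :: 'v
  assumes u: "u \<in> hmg" "u \<in> deg 1" "u \<noteq> 0"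
begin

lemma e_u: "\<lbrakk>i < m; j < m\<rbrakk> \<Longrightarrow> e i j u = (if i = j then scal F \<kappa> u else 0)"
  using e_ends[OF u(2)] by simp

lemma e_cu:
  "\<lbrakk>i < m; l < m; k < m\<rbrakk> \<Longrightarrow> e i l (c k u)
    = (if i = l then scal F (\<kappa> - 1) (c k u) else 0) + (if l = k then c i u else 0)"
  using ec[of i l k u]
  by (cases "i = l"; cases "l = k") (simp_all add: e_u c_simps scale_left_diff_distrib algebra_simps)

lemma cu_deg: "i < m \<Longrightarrow> c i u \<in> deg 0"
  using deg_c[OF _ u(2), of i] by simp

lemma ccu_deg: "\<lbrakk>i < m; j < m\<rbrakk> \<Longrightarrow> c i (c j u) \<in> deg (- 1)"
  using deg_c[OF _ cu_deg, of i j] by simp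

definition generators :: "'v set"
  where "generators = {u} \<union> {c i u | i. i < m} \<union> {c i (c j u) | i j. i < m \<and> j < m}"

text \<open>As \<open>u\<close> has the top degree, \<open>b i u = 0\<close>, and three factors
  \<open>c\<close> lead below the lowest degree. The relations move \<open>e\<close> and
  \<open>b\<close> past the factors \<open>c\<close> until they reach \<open>u\<close>, where
  \<open>e\<close> acts by scalars.\<close>

lemma span_generators: "span generators = UNIV"
proof (rule span_UNIV[of _ u])
  show "generators \<subseteq> hmg"
    using u(1) Inder_hmg[OF c_Inder] by (auto simp: generators_def)
  show "u \<in> generators" by (simp add: generators_def)
  have gu: "u \<in> span generators" by (auto simp: generators_def intro: span_base)
  have gc: "c i u \<in> span generators" if "i < m" for i
    using that by (auto simp: generators_def intro: span_base)
  have gcc: "c i (c j u) \<in> span generators" if "i < m" "j < m" for i j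
    using that by (auto simp: generators_def intro: span_base)
  fix v assume v: "v \<in> generators"
  then consider (0) "v = u" | (1) k where "k < m" "v = c k u"
    | (2) k l where "k < m" "l < m" "v = c k (c l u)"
    by (auto simp: generators_def)
  note cases = this
  fix i assume i: "i < m"
  show "e i j v \<in> span generators" if j: "j < m" for j
  proof (cases rule: cases)
    case 0
    then show ?thesis using gu i j by (simp add: e_u span_scale span_zero)
  next
    case (1 k)
    then show ?thesis using gc i j by (auto simp: e_cu intro!: span_add span_scale span_zero)
  next
    case (2 k l)
    have "e i j v = c k (e i j (c l u)) + ((if j = k then c i (c l u) else 0) - (if i = j then c k (c l u) else 0))"
      using ec[OF i j 2(1), of "c l u"] 2(3) by (simp add: algebra_simps)
    moreover have "c k (e i j (c l u)) \<in> span generators"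
      using 2 i j gcc by (auto simp: e_cu c_simps intro!: span_add span_scale span_zero)
    ultimately show ?thesis using gcc 2 i by (auto intro!: span_add span_diff span_zero)
  qed
  have bu: "b i u = 0" using deg_2[OF deg_b[OF i u(2)]] by simp
  have bcu: "b i (c k u) = e k i u" if "k < m" for k
    using bc[OF that i, of u] bu that by (simp add: c_simps)
  show "b i v \<in> span generators"
  proof (cases rule: cases)
    case 0
    then show ?thesis by (simp add: bu span_zero)
  next
    case (1 k)
    then show ?thesis using bcu e_u i gu by (simp add: span_scale span_zero)
  next
    case (2 k l)
    have "b i v = e k i (c l u) - c k (e l i u)"
      using bc[OF 2(1) i, of "c l u"] bcu[OF 2(2)] 2(3) by (simp add: algebra_simps)
    then show ?thesis
      using 2 i gc by (auto simp: e_cu e_u c_simps intro!: span_add span_diff span_scale span_zero)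
  qed
  show "c i v \<in> span generators"
  proof (cases rule: cases)
    case (2 k l)
    then have "c i v = 0" using deg_2[OF deg_c[OF i ccu_deg]] by simp
    then show ?thesis by (simp add: span_zero)
  qed (use gc gcc i in auto)
qed (fact u(3))

lemma generators_deg: "x \<in> generators \<Longrightarrow> \<exists>t. x \<in> deg t"
  using u(2) cu_deg ccu_deg by (auto simp: generators_def)

lemma cc_self: "i < m \<Longrightarrow> c i (c i v) = 0"
  using cc[of i i v] self_neg_zero by blast

text \<open>Degree \<open>-1\<close> is not zero, among the generators only the products of two
  \<open>c\<close> reach it, and \<open>c i (c i u)\<close> vanishes.\<close>

lemma ccu_nonzero: "\<exists>i<m. \<exists>j<m. i \<noteq> j \<and> c i (c j u) \<noteq> 0"
proof -
  obtain w where w: "w \<in> deg (- 1)" "w \<noteq> 0" using deg_neg_1 by blast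
  then obtain x where x: "x \<in> generators" "x \<in> deg (- 1)" "x \<noteq> 0"
    using deg_in_span_nonzero[OF generators_deg _ w] span_generators by blast
  have "x \<noteq> u" using deg_unique[OF x(2) _ x(3), of 1] u(2) by auto
  moreover have "x \<noteq> c i u" if "i < m" for i
    using deg_unique[OF x(2) _ x(3), of 0] cu_deg[OF that] by auto
  ultimately obtain i j where "i < m" "j < m" "x = c i (c j u)"
    using x(1) by (auto simp: generators_def)
  then show ?thesis using x(3) cc_self by metis
qed

text \<open>\<open>e i i\<close> commutes with \<open>c i\<close> and acts on \<open>c j u\<close>
  by \<open>\<kappa> - 1\<close>, hence also on \<open>c i (c j u)\<close>. That vector has degree
  \<open>-1\<close>, where \<open>e i i\<close> acts by \<open>-\<kappa>\<close>. So
  \<open>\<kappa> = 1/2\<close>, which means \<open>2 (m - 1) = m\<close>.\<close>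

lemma m_eq_2: "m = 2"
proof -
  obtain i j where ij: "i < m" "j < m" "i \<noteq> j" "c i (c j u) \<noteq> 0" using ccu_nonzero by blast
  let ?w = "c i (c j u)"
  have "e i i ?w = c i (e i i (c j u))"
    using ec[OF ij(1) ij(1) ij(1), of "c j u"] by simp
  also have "\<dots> = scal F (\<kappa> - 1) ?w" using ij by (simp add: e_cu c_simps)
  finally have "scal F (\<kappa> - 1) ?w = scal F (- \<kappa>) ?w"
    using e_ends[OF ccu_deg[OF ij(1,2)] _ ij(1,1)] by simp
  then have "\<kappa> - 1 = - \<kappa>" using ij(4) by (rule scale_right_imp_eq[rotated])
  then have "\<kappa> + \<kappa> = 1" by (simp add: algebra_simps eq_neg_iff_add_eq_0)
  then have "of_nat m * \<kappa> + of_nat m * \<kappa> = of_nat m" by (metis distrib_left mult.right_neutral)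
  then have "M + M = of_nat m" by (simp add: m_\<kappa>)
  then have "of_nat m = (of_nat 2 :: 'k)" by (simp add: M_def algebra_simps)
  then show ?thesis by (simp only: of_nat_eq_iff)
qed

section \<open>The case \<open>m = 2\<close>: weights for \<open>sl(2)\<close>\<close>

definition x0 :: 'v where "x0 = c 0 u"
definition x1 :: 'v where "x1 = c 1 u"
definition w :: 'v where "w = c 0 (c 1 u)"
definition basis :: "'v set" where "basis = {u, x0, x1, w}"

lemma lt_m: "0 < m" "1 < m"
  using m_ge by auto

lemma span_basis: "span basis = UNIV"
proof -
  have b: "x \<in> basis \<Longrightarrow> x \<in> span basis" for x by (rule span_base)
  have c10: "c 1 (c 0 u) = - w" using cc[OF lt_m(2,1), of u] by (simp add: w_def)
  have "generators \<subseteq> span basis"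
  proof
    fix x assume "x \<in> generators"
    then consider "x = u" | i where "i < 2" "x = c i u" | i j where "i < 2" "j < 2" "x = c i (c j u)"
      unfolding generators_def using m_eq_2 by blast
    then show "x \<in> span basis"
    proof cases
      case 1
      then show ?thesis using b by (simp add: basis_def)
    next
      case 2
      then have "i = 0 \<or> i = 1" by linarith
      then show ?thesis using 2 b by (auto simp: basis_def x0_def x1_def)
    next
      case 3
      then have "(i = 0 \<or> i = 1) \<and> (j = 0 \<or> j = 1)" by linarith
      moreover have "- w \<in> span basis" "w \<in> span basis" using b[of w] span_neg by (auto simp: basis_def)
      ultimately show ?thesis using 3(3) c10 cc_self[OF lt_m(1)] cc_self[OF lt_m(2)] span_zero
        by (auto simp: w_def)
    qed
  qed
  then show ?thesis using span_generators span_minimal[OF _ subspace_span] by blast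
qed

lemma basis_deg: "x0 \<in> deg 0" "x1 \<in> deg 0" "w \<in> deg (- 1)"
  using cu_deg[OF lt_m(1)] cu_deg[OF lt_m(2)] ccu_deg[OF lt_m] by (simp_all add: x0_def x1_def w_def)

lemma basis_hmg: "basis \<subseteq> hmg"
  using u(1) Inder_hmg[OF c_Inder[OF lt_m(1)]] Inder_hmg[OF c_Inder[OF lt_m(2)]]
  by (auto simp: basis_def x0_def x1_def w_def)

lemma basis_nonzero: "w \<noteq> 0" "x0 \<noteq> 0" "x1 \<noteq> 0"
proof -
  obtain v where v: "v \<in> deg (- 1)" "v \<noteq> 0" using deg_neg_1 by blast
  have "\<exists>x\<in>basis \<inter> deg (- 1). x \<noteq> 0"
    by (rule deg_in_span_nonzero[OF _ _ v]) (use span_basis basis_deg u(2) in \<open>auto simp: basis_def\<close>)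
  then obtain x where x: "x \<in> basis" "x \<in> deg (- 1)" "x \<noteq> 0" by blast
  then have "x = w"
    using deg_unique[OF x(2) _ x(3), of 1] deg_unique[OF x(2) _ x(3), of 0] u(2) basis_deg
    by (auto simp: basis_def)
  then show w: "w \<noteq> 0" using x(3) by blast
  then show "x1 \<noteq> 0" by (auto simp: w_def x1_def c_simps[OF lt_m(1)])
  have w': "w = - c 1 (c 0 u)" using cc[OF lt_m, of u] by (simp add: w_def)
  show "x0 \<noteq> 0"
  proof
    assume "x0 = 0"
    then have "w = 0" using w' by (simp only: x0_def c_simps[OF lt_m(2)] minus_zero)
    then show False using w by simp
  qed
qed

lemma deg_0_span: "v \<in> deg 0 \<Longrightarrow> v \<in> span {x0, x1}"
proof -
  assume "v \<in> deg 0"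
  then have "v \<in> span (basis \<inter> deg 0)"
    by (intro deg_in_span) (use span_basis basis_deg u(2) in \<open>auto simp: basis_def\<close>)
  moreover have "basis \<inter> deg 0 \<subseteq> {x0, x1}"
    using deg_unique[of u 0 1] deg_unique[of w 0 "- 1"] u basis_deg basis_nonzero by (auto simp: basis_def)
  ultimately show ?thesis using span_mono by blast
qed

text \<open>The standard diagonal element of \<open>sl(2)\<close>. It has eigenvalues
  \<open>1\<close> on \<open>x0\<close> and \<open>-1\<close> on \<open>x1\<close> and kills
  \<open>u\<close> and \<open>w\<close>, so the weight of a list compares the numbers of entries
  \<open>x0\<close> and \<open>x1\<close>.\<close>

definition h :: "'v \<Rightarrow> 'v"
  where "h v = e 0 0 v - e 1 1 v"

lemma h_Inder: "h \<in> part (Inder r F) 0"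
proof -
  have "h = e 0 0 - e 1 1" by (auto simp: h_def)
  then show ?thesis using e_Inder lt_m by (simp add: E.subspace_diff[OF Inder_subspace])
qed

definition wt :: "'v \<Rightarrow> 'k"
  where "wt x = (if x = x0 then 1 else if x = x1 then - 1 else 0)"

lemma h_ends: "v \<in> deg 1 \<or> v \<in> deg (- 1) \<Longrightarrow> h v = 0"
  using e_ends[of v] lt_m by (auto simp: h_def)

lemma h_x: "h x0 = x0" "h x1 = - x1"
  using lt_m by (simp_all add: h_def x0_def x1_def e_cu scale_left_diff_distrib)

lemma x_distinct: "x0 \<noteq> x1"
proof
  assume "x0 = x1"
  then have "x0 = - x0" using h_x by metis
  then show False using basis_nonzero self_neg_zero by blast
qed

lemma h_basis: "x \<in> basis \<Longrightarrow> h x = scal F (wt x) x"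
proof -
  assume "x \<in> basis"
  moreover have "u \<noteq> x0" "u \<noteq> x1" "w \<noteq> x0" "w \<noteq> x1"
    using deg_unique[of u 1 0] deg_unique[of w "- 1" 0] u basis_deg basis_nonzero by auto
  ultimately show ?thesis
    using h_x h_ends u(2) basis_deg x_distinct by (auto simp: basis_def wt_def)
qed

lemma sum_wt: "sum_list (map wt ys) = of_nat (count (mset ys) x0) - of_nat (count (mset ys) x1)"
  using x_distinct by (induction ys) (auto simp: wt_def)

lemma e01: "e 0 1 u = 0" "e 0 1 x0 = 0" "e 0 1 x1 = x0"
  using lt_m by (simp_all add: e_u e_cu x0_def x1_def)

lemma basis_list_exists:
  obtains ys where "length ys = r - 1" "set ys \<subseteq> {x0, x1}" "fbr F (ys @ [u]) \<noteq> 0"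
proof -
  obtain xs where xs: "length xs = r - 1" "set xs \<subseteq> hmg \<inter> deg 0" "fbr F (xs @ [u]) \<noteq> 0"
    using deg_0_list[OF u] by blast
  then have "set xs \<subseteq> span {x0, x1}" using deg_0_span by blast
  then have "fbr F (xs @ [u]) \<in> span {fbr F (ys @ [u]) | ys. length ys = r - 1 \<and> set ys \<subseteq> {x0, x1}}"
    by (rule left_mult_app_in_span[OF xs(1)])
  then have "\<not> {fbr F (ys @ [u]) | ys. length ys = r - 1 \<and> set ys \<subseteq> {x0, x1}} \<subseteq> {0}"
    using xs(3) span_minimal[of _ "{0}"] by (auto simp: subspace_single_0)
  then show thesis using that by blast
qed

text \<open>The bracket has degree \<open>1\<close>, where \<open>h\<close> vanishes; on the other
  hand \<open>h\<close> acts on it by the total weight of the list. So only lists of weight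
  \<open>0\<close> can give a nonzero bracket.\<close>

lemma fbr_u:
  assumes "length ys = r - 1" "set ys \<subseteq> {x0, x1}"
  shows "h (fbr F (ys @ [u])) = 0" "scal F (sum_list (map wt ys)) (fbr F (ys @ [u])) = 0"
proof -
  have hmg: "set (ys @ [u]) \<subseteq> hmg" using assms(2) basis_hmg by (auto simp: basis_def)
  have "fbr F (ys @ [u]) \<in> deg (sum_list (replicate (r - 1) 0 @ [1]))"
  proof (rule deg_fbr)
    have "list_all2 (\<lambda>x d. x \<in> deg d) ys (replicate (r - 1) 0)"
    proof -
      have "ys ! i \<in> deg 0" if "i < length ys" for i
      proof -
        have "ys ! i \<in> {x0, x1}" using nth_mem[OF that] assms(2) by blast
        then show ?thesis using basis_deg(1,2) by auto
      qed
      then show ?thesis using assms(1) by (simp add: list_all2_conv_all_nth)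
    qed
    then show "list_all2 (\<lambda>x d. x \<in> deg d) (ys @ [u]) (replicate (r - 1) 0 @ [1])"
      using u(2) by (simp add: list_all2_appendI)
  qed (use assms(1) arity hmg in auto)
  moreover have "sum_list (replicate k (0 :: 'k)) = 0" for k by (induction k) auto
  ultimately show h: "h (fbr F (ys @ [u])) = 0" by (simp add: h_ends)
  have "h (fbr F (ys @ [u])) = scal F (sum_list (map wt (ys @ [u]))) (fbr F (ys @ [u]))"
  proof (rule derivation_eigen[OF h_Inder _ hmg])
    show "list_all2 (\<lambda>x t. h x = scal F t x) (ys @ [u]) (map wt (ys @ [u]))"
      unfolding list.rel_map using assms(2) h_basis
      by (intro list.rel_refl_strong) (auto simp: basis_def)
  qed (use assms(1) arity in auto)
  moreover have "wt u = 0"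
    using h_basis[of u] h_ends[of u] u by (auto simp: basis_def)
  ultimately show "scal F (sum_list (map wt ys)) (fbr F (ys @ [u])) = 0" using h by simp
qed

lemma count_two: "set ys \<subseteq> {x0, x1} \<Longrightarrow> count (mset ys) x0 + count (mset ys) x1 = length ys"
  using x_distinct by (induction ys) auto

text \<open>
  If \<open>x0\<close> and \<open>x1\<close> are odd, the bracket is symmetric in them, and \<open>[\<dots>, u]\<close> is an \<open>sl(2)\<close>-invariant
  symmetric form on their span. There is none: \<open>e 0 1\<close> maps its value on a list of weight \<open>-2\<close>, which is
  \<open>0\<close>, to a positive multiple of its value on a list of weight \<open>0\<close>.
\<close>

lemma odd_contradiction:
  assumes odd: "x0 \<in> part F 1" "x1 \<in> part F 1"
  shows False
proof -
  obtain ys where ys: "length ys = r - 1" "set ys \<subseteq> {x0, x1}" "fbr F (ys @ [u]) \<noteq> 0"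
    by (rule basis_list_exists)
  have hmg: "x0 \<in> hmg" "x1 \<in> hmg" using odd part_hmg by blast+
  have "sum_list (map wt ys) = 0" using fbr_u(2)[OF ys(1,2)] ys(3) by simp
  then have cnt: "count (mset ys) x0 = count (mset ys) x1" by (simp add: sum_wt)
  have "count (mset ys) x0 > 0"
    using count_two[OF ys(2)] cnt ys(1) r_ge by linarith
  then have "x0 \<in># mset ys" by simp
  then obtain R where R: "mset ys = add_mset x0 R" by (metis insert_DiffM)
  obtain zs where zs: "mset zs = R" using ex_mset by blast
  have setzs: "set zs \<subseteq> {x0, x1}"
    using ys(2) R zs by (metis insert_subset set_mset_add_mset_insert set_mset_mset)
  have lenzs: "length (x1 # zs) = r - 1"
    using ys(1) R zs by (metis length_Cons mset_eq_length mset.simps(2))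
  have perm: "fbr F (ys' @ [u]) = fbr F (ys @ [u])" if "mset ys = mset ys'" for ys'
  proof -
    let ?P = "\<lambda>ys'. length ys' = r - 1 \<and> set ys' \<subseteq> {x0, x1} \<and> fbr F (ys' @ [u]) = fbr F (ys @ [u])"
    have "?P ([] @ ys')"
    proof (rule adjacent_swap_invariant[OF _ that])
      fix as x y bs assume P: "?P (as @ x # y # bs)"
      have xy: "x \<in> part F 1" "y \<in> part F 1" using P odd by auto
      have "fbr F (as @ y # x # (bs @ [u]))
          = - scal F (parity_sign (1 * 1)) (fbr F (as @ x # y # (bs @ [u])))"
        by (rule fbr_swap[OF _ xy(2,1)]) (use P hmg u(1) arity in auto)
      then have "fbr F (as @ y # x # (bs @ [u])) = fbr F (as @ x # y # (bs @ [u]))"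
        by (simp add: parity_sign_def)
      then show "?P (as @ y # x # bs)" using P by auto
    qed (use ys in auto)
    then show ?thesis by simp
  qed
  \<comment> \<open>One \<open>x0\<close> has been replaced by \<open>x1\<close>, so the weight
    drops from \<open>0\<close> to \<open>-2\<close>. The new \<open>x1\<close> stands in front, so
    position \<open>0\<close> is among those counted at the end.\<close>
  let ?ys = "x1 # zs"
  have set': "set ?ys \<subseteq> {x0, x1}" using setzs by simp
  have "count (mset ?ys) x0 + 2 = count (mset ?ys) x1"
    using cnt x_distinct unfolding R zs[symmetric] by simp
  then have "sum_list (map wt ?ys) = of_nat (count (mset ?ys) x0) - of_nat (count (mset ?ys) x0 + 2)"
    using sum_wt[of ?ys] by (simp only:)
  then have "sum_list (map wt ?ys) = - 2" by simp
  then have zero: "fbr F (?ys @ [u]) = 0" using fbr_u(2)[OF lenzs set'] by simp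
  have len: "length (?ys @ [u]) = r" using lenzs arity by simp
  let ?p = "fbr F (ys @ [u])"
  have "0 = e 0 1 (fbr F (?ys @ [u]))" unfolding zero using e_simps(3)[OF lt_m] by simp
  also have "\<dots> = (\<Sum>i<r. fbr F ((?ys @ [u])[i := e 0 1 ((?ys @ [u]) ! i)]))"
    by (rule even_derivation[OF e_Inder[OF lt_m] len]) (use setzs hmg u(1) in auto)
  \<comment> \<open>\<open>e 0 1\<close> kills \<open>u\<close> and \<open>x0\<close>. At an entry
    \<open>x1\<close> it puts \<open>x0\<close>, which restores the multiset of \<open>ys\<close>
    and hence the value \<open>?p\<close>.\<close>
  also have "\<dots> = (\<Sum>i<r. if i < r - 1 \<and> ?ys ! i = x1 then ?p else 0)"
  proof (rule sum.cong[OF refl])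
    fix i assume i: "i \<in> {..<r}"
    let ?x = "e 0 1 ((?ys @ [u]) ! i)"
    have nil: "fbr F ((?ys @ [u])[i := ?x]) = 0" if "?x = 0"
    proof (rule fbr_zero_entry)
      show "0 \<in> set ((?ys @ [u])[i := ?x])"
        using set_update_memI[of i "?ys @ [u]" 0] that i len by auto
      show "length ((?ys @ [u])[i := ?x]) = r" by (simp only: length_list_update len)
    qed
    show "fbr F ((?ys @ [u])[i := ?x]) = (if i < r - 1 \<and> ?ys ! i = x1 then ?p else 0)"
    proof (cases "i < r - 1")
      case False
      then have "i = r - 1" using i by auto
      then have "(?ys @ [u]) ! i = u" using lenzs by (metis nth_append_length)
      then show ?thesis using nil e01(1) False by simp
    next
      case True
      then have nth: "(?ys @ [u]) ! i = ?ys ! i" using lenzs by (simp only: nth_append if_True)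
      have "?ys ! i \<in> {x0, x1}" using set' True lenzs nth_mem[of i ?ys] by auto
      then consider "?ys ! i = x0" | "?ys ! i = x1" by blast
      then show ?thesis
      proof cases
        case 1
        then show ?thesis using nil nth e01(2) x_distinct by simp
      next
        case 2
        have "mset ys = mset (?ys[i := x0])"
          using True lenzs 2 R zs by (subst mset_update) auto
        from perm[OF this] have "fbr F ((?ys @ [u])[i := ?x]) = ?p"
          using True lenzs nth 2 e01(3) by (simp only: list_update_append if_True)
        then show ?thesis using True 2 by simp
      qed
    qed
  qed
  also have "\<dots> = scal F (of_nat (card {i \<in> {..<r}. i < r - 1 \<and> ?ys ! i = x1})) ?p"
    by (subst sum.If_cases) (simp_all add: sum_constant_scale Int_def)
  finally have "card {i \<in> {..<r}. i < r - 1 \<and> ?ys ! i = x1} = 0" using ys(3) by simp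
  moreover have "0 \<in> {i \<in> {..<r}. i < r - 1 \<and> ?ys ! i = x1}" using r_ge by simp
  moreover have "finite {i \<in> {..<r}. i < r - 1 \<and> ?ys ! i = x1}" by simp
  ultimately show False by (simp only: card_0_eq) blast
qed

text \<open>\<open>e 0 1\<close> takes \<open>x1\<close> of weight \<open>-1\<close> to
  \<open>x0\<close> of weight \<open>1\<close>, so some nonzero bracket \<open>[ys, x1]\<close> has
  \<open>ys\<close> of weight \<open>2\<close>. Such a list contains \<open>x0\<close> at least
  twice, and a bracket with a repeated even entry vanishes.\<close>

lemma even_contradiction:
  assumes even: "x0 \<in> part F 0" "x1 \<in> part F 0"
  shows False
proof -
  have hmg: "x0 \<in> hmg" "x1 \<in> hmg" using even part_hmg by blast+
  have hx: "\<exists>t. h x = scal F t x" if "x \<in> basis" for x using h_basis that by blast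
  obtain ys ts where ys: "length ys = r - 1" "set ys \<subseteq> basis" "list_all2 (\<lambda>x t. h x = scal F t x) ys ts"
    "fbr F (ys @ [x1]) \<noteq> 0" "1 = sum_list ts + (- 1 :: 'k)"
    by (rule eigen_list[OF h_Inder basis_hmg span_basis hx e_Inder[OF lt_m] hmg(2), of "- 1" 1])
      (use h_x e01(3) basis_nonzero in auto)
  have "ts = map wt ys"
  proof -
    have nz: "x \<noteq> 0" if "x \<in> basis" for x using that u(3) basis_nonzero by (auto simp: basis_def)
    from ys(3,2) show ?thesis
    proof (induction rule: list_all2_induct)
      case (Cons x xs t ts)
      then have "scal F t x = scal F (wt x) x" "x \<noteq> 0" using h_basis[of x] nz[of x] by auto
      then show ?case using Cons by simp
    qed simp
  qed
  then have "of_nat (count (mset ys) x0) = (of_nat (count (mset ys) x1 + 2) :: 'k)"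
    using ys(5) by (simp add: sum_wt algebra_simps)
  then have "count (mset ys) x0 = count (mset ys) x1 + 2" by (simp only: of_nat_eq_iff)
  then have "replicate_mset 2 x0 \<subseteq># mset ys" by (simp add: count_le_replicate_mset_subset_eq[symmetric])
  then obtain R where "mset ys = replicate_mset 2 x0 + R" by (metis mset_subset_eq_exists_conv)
  moreover obtain zs where "mset zs = R" using ex_mset by blast
  ultimately have mset: "mset (ys @ [x1]) = mset ([] @ x0 # x0 # (zs @ [x1]))"
    by (simp add: numeral_2_eq_2)
  have len: "length (ys @ [x1]) = r" using ys(1) arity by simp
  have set: "set (ys @ [x1]) \<subseteq> hmg" using ys(2) basis_hmg hmg by auto
  have "fbr F ([] @ x0 # x0 # (zs @ [x1])) = - scal F (parity_sign (0 * 0)) (fbr F ([] @ x0 # x0 # (zs @ [x1])))"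
  proof (rule fbr_swap[OF _ even(1) even(1)])
    show "length ([] @ x0 # x0 # (zs @ [x1])) = r" using len mset_eq_length[OF mset] by (simp only:)
    show "set (zs @ [x1]) \<subseteq> hmg" using set unfolding mset_eq_setD[OF mset] by simp
  qed simp
  then have "fbr F ([] @ x0 # x0 # (zs @ [x1])) = 0"
    using self_neg_zero by (simp add: parity_sign_def)
  then show False using fbr_permute[OF mset len set] ys(4) by auto
qed

lemma contradiction: False
proof -
  obtain p where p: "u \<in> part F p" using u(1) hmg_part by blast
  \<comment> \<open>The operators \<open>c 0\<close> and \<open>c 1\<close> are both odd, so
    \<open>x0\<close> and \<open>x1\<close> have the same parity and two cases suffice.\<close>
  have x: "x0 \<in> part F (1 + p)" "x1 \<in> part F (1 + p)"
    using Inder_graded[OF c_Inder[OF lt_m(1)] p] Inder_graded[OF c_Inder[OF lt_m(2)] p]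
    by (simp_all only: x0_def x1_def)
  have "1 + p = 0 \<or> 1 + p = 1" by (cases p) auto
  then show False using x odd_contradiction even_contradiction by metis
qed

end

lemma (in A0_filippov) no_such_algebra: False
proof -
  obtain u where u: "u \<in> hmg" "u \<in> deg 1" "u \<noteq> 0" using deg_1 deg_hmg_nonzero by blast
  interpret A0_filippov_generator r F m e b c u
    by unfold_locales (use u in auto)
  show False by (fact contradiction)
qed

section \<open>From matrices to operators\<close>

lemma gl1_part_iff:
  "A \<in> gl1_part m p \<longleftrightarrow> A \<in> carrier_mat (Suc m) (Suc m) \<and>
     (\<forall>i\<le>m. \<forall>j\<le>m. ((i = 0) = (j = 0)) \<noteq> (p = 0) \<longrightarrow> A $$ (i, j) = 0)" (is "_ \<longleftrightarrow> ?R")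
proof
  assume "A \<in> gl1_part m p"
  then show ?R
    by (auto simp: gl1_part_def split: if_splits)
next
  assume R: ?R
  let ?A = "mat 1 1 (\<lambda>_. A $$ (0, 0))" and ?B = "mat 1 m (\<lambda>(_, j). A $$ (0, Suc j))"
    and ?C = "mat m 1 (\<lambda>(i, _). A $$ (Suc i, 0))" and ?D = "mat m m (\<lambda>(i, j). A $$ (Suc i, Suc j))"
  show "A \<in> gl1_part m p"
  proof (cases "p = 0")
    case True
    then have "A = four_block_mat ?A (0\<^sub>m 1 m) (0\<^sub>m m 1) ?D"
      using R by (intro eq_matI) auto
    then show ?thesis unfolding gl1_part_def using True by force
  next
    case False
    then have "A = four_block_mat (0\<^sub>m 1 1) ?B ?C (0\<^sub>m m m)"
      using R by (intro eq_matI) auto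
    then show ?thesis unfolding gl1_part_def using False by force
  qed
qed

lemma sl1_iff:
  "A \<in> sl1 m \<longleftrightarrow> A \<in> carrier_mat (Suc m) (Suc m) \<and> A $$ (0, 0) = (\<Sum>i<m. A $$ (Suc i, Suc i))"
  (is "_ \<longleftrightarrow> ?R")
proof
  assume "A \<in> sl1 m"
  then show ?R by (auto simp: sl1_def mat_trace_def)
next
  assume R: ?R
  let ?A = "mat 1 1 (\<lambda>_. A $$ (0, 0))" and ?B = "mat 1 m (\<lambda>(_, j). A $$ (0, Suc j))"
    and ?C = "mat m 1 (\<lambda>(i, _). A $$ (Suc i, 0))" and ?D = "mat m m (\<lambda>(i, j). A $$ (Suc i, Suc j))"
  have block: "A = four_block_mat ?A ?B ?C ?D" using R by (intro eq_matI) auto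
  have trace: "mat_trace ?A = mat_trace ?D" using R by (simp add: mat_trace_def)
  show "A \<in> sl1 m"
    unfolding sl1_def mem_Collect_eq
    by (rule exI[of _ ?A], rule exI[of _ ?B], rule exI[of _ ?C], rule exI[of _ ?D])
      (intro conjI block trace; simp)
qed

lemma hcomp_eqI:
  assumes "x \<in> gr p" "a - x \<in> gr (p + 1)"
    and "\<And>y. \<lbrakk>y \<in> gr p; a - y \<in> gr (p + 1)\<rbrakk> \<Longrightarrow> y = x"
  shows "hcomp gr p a = x"
  unfolding hcomp_def using assms by (intro the_equality) blast+

lemma hcomp_gl1:
  assumes A: "A \<in> carrier_mat (Suc m) (Suc m)"
  shows "hcomp (gl1_part m) p A
    = mat (Suc m) (Suc m) (\<lambda>(i, j). if ((i = 0) = (j = 0)) = (p = 0) then A $$ (i, j) else 0)"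
proof (rule hcomp_eqI)
  have p1: "(p + 1 = 0) \<longleftrightarrow> p \<noteq> 0" by (cases p) auto
  show "mat (Suc m) (Suc m) (\<lambda>(i, j). if ((i = 0) = (j = 0)) = (p = 0) then A $$ (i, j) else 0) \<in> gl1_part m p"
    by (auto simp: gl1_part_iff)
  show "A - mat (Suc m) (Suc m) (\<lambda>(i, j). if ((i = 0) = (j = 0)) = (p = 0) then A $$ (i, j) else 0)
      \<in> gl1_part m (p + 1)"
    using A unfolding gl1_part_iff p1 by auto
  fix Y assume Y: "Y \<in> gl1_part m p" "A - Y \<in> gl1_part m (p + 1)"
  show "Y = mat (Suc m) (Suc m) (\<lambda>(i, j). if ((i = 0) = (j = 0)) = (p = 0) then A $$ (i, j) else 0)"
  proof (rule eq_matI)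
    fix i j
    assume "i < dim_row (mat (Suc m) (Suc m) (\<lambda>(i, j). if ((i = 0) = (j = 0)) = (p = 0) then A $$ (i, j) else 0))"
      "j < dim_col (mat (Suc m) (Suc m) (\<lambda>(i, j). if ((i = 0) = (j = 0)) = (p = 0) then A $$ (i, j) else 0))"
    then have ij: "i \<le> m" "j \<le> m" by auto
    have Y': "Y \<in> carrier_mat (Suc m) (Suc m)" "((i = 0) = (j = 0)) \<noteq> (p = 0) \<Longrightarrow> Y $$ (i, j) = 0"
      "((i = 0) = (j = 0)) = (p = 0) \<Longrightarrow> (A - Y) $$ (i, j) = 0"
      using Y ij unfolding gl1_part_iff p1 by blast+
    moreover have "(A - Y) $$ (i, j) = A $$ (i, j) - Y $$ (i, j)" using A Y'(1) ij by simp
    ultimately show "Y $$ (i, j)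
      = mat (Suc m) (Suc m) (\<lambda>(i, j). if ((i = 0) = (j = 0)) = (p = 0) then A $$ (i, j) else 0) $$ (i, j)"
      using ij by auto
  qed (use Y in \<open>auto simp: gl1_part_iff\<close>)
qed

lemma hcomp_gl1_same: "A \<in> gl1_part m p \<Longrightarrow> hcomp (gl1_part m) p A = A"
  by (subst hcomp_gl1) (auto simp: gl1_part_iff intro!: eq_matI)

lemma hcomp_gl1_other: "A \<in> gl1_part m p \<Longrightarrow> q \<noteq> p \<Longrightarrow> hcomp (gl1_part m) q A = 0\<^sub>m (Suc m) (Suc m)"
  by (subst hcomp_gl1; cases p; cases q) (auto simp: gl1_part_iff intro!: eq_matI)

text \<open>The definition splits both arguments into components; for homogeneous arguments three of
  its four summands are zero.\<close>

lemma supercommutator_gl1: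
  assumes A: "A \<in> gl1_part m p" and B: "B \<in> gl1_part m q"
  shows "supercommutator (gl1_part m) (*) A B = (if p = 1 \<and> q = 1 then A * B + B * A else A * B - B * A)"
proof -
  have car: "A \<in> carrier_mat (Suc m) (Suc m)" "B \<in> carrier_mat (Suc m) (Suc m)"
    using A B by (auto simp: gl1_part_iff)
  have "p = 0 \<or> p = 1" "q = 0 \<or> q = 1" by (cases p; simp) (cases q; simp)
  show ?thesis
  proof -
    have mults: "A * B \<in> carrier_mat (Suc m) (Suc m)" "B * A \<in> carrier_mat (Suc m) (Suc m)"
      using car by auto
    have zero: "A * 0\<^sub>m (Suc m) (Suc m) = 0\<^sub>m (Suc m) (Suc m)" "0\<^sub>m (Suc m) (Suc m) * A = 0\<^sub>m (Suc m) (Suc m)"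
      "B * 0\<^sub>m (Suc m) (Suc m) = 0\<^sub>m (Suc m) (Suc m)" "0\<^sub>m (Suc m) (Suc m) * B = 0\<^sub>m (Suc m) (Suc m)"
      using car by simp_all
    have add0: "C + 0\<^sub>m (Suc m) (Suc m) = C" "0\<^sub>m (Suc m) (Suc m) + C = C"
      if "C \<in> carrier_mat (Suc m) (Suc m)" for C :: "'a mat"
      using that by simp_all
    have diff: "A * B - B * A \<in> carrier_mat (Suc m) (Suc m)"
      using mults(2) by (rule minus_carrier_mat)
    have diff0: "0\<^sub>m (Suc m) (Suc m) - 0\<^sub>m (Suc m) (Suc m) = (0\<^sub>m (Suc m) (Suc m) :: 'a mat)" by auto
    have "(0 :: bit) \<noteq> 1" by simp
    then consider "p = 0" "q = 0" | "p = 0" "q = 1" | "p = 1" "q = 0" | "p = 1" "q = 1"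
      using \<open>p = 0 \<or> p = 1\<close> \<open>q = 0 \<or> q = 1\<close> by blast
    then show ?thesis
      by cases (use mults hcomp_gl1_same[OF A] hcomp_gl1_same[OF B] hcomp_gl1_other[OF A] hcomp_gl1_other[OF B]
        in \<open>simp_all add: supercommutator_def Let_def zero diff0 add0[OF diff]\<close>)
  qed
qed

section \<open>Closure of \<open>Inder\<close> under the supercommutator\<close>

context filippov_superalgebra
begin

lemma hcomp_end_same: "f \<in> end_part F p \<Longrightarrow> hcomp (end_part F) p f = f"
proof (rule hcomp_eqI)
  assume f: "f \<in> end_part F p"
  show "f - f \<in> end_part F (p + 1)" using E.subspace_0[OF end_part_subspace] by simp
  fix y assume "y \<in> end_part F p" "f - y \<in> end_part F (p + 1)"
  then have "f - y = 0"
    using f E.subspace_diff[OF end_part_subspace] end_part_Int by blast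
  then show "y = f" by simp
qed

lemma hcomp_end_other:
  assumes "f \<in> end_part F p" "q \<noteq> p"
  shows "hcomp (end_part F) q f = 0"
proof (rule hcomp_eqI)
  have q: "p = q + 1" using assms(2) by (cases p; cases q) auto
  show "0 \<in> end_part F q" using E.subspace_0[OF end_part_subspace] .
  show "f - 0 \<in> end_part F (q + 1)" using assms(1) q by simp
  fix y assume "y \<in> end_part F q" "f - y \<in> end_part F (q + 1)"
  then have "y \<in> end_part F (q + 1)"
    using E.subspace_diff[OF end_part_subspace, of f "q + 1" "f - y"] assms(1) q by simp
  then show "y = 0" using end_part_Int \<open>y \<in> end_part F q\<close> by blast
qed

lemma supercommutator_end:
  assumes f: "f \<in> end_part F p" and g: "g \<in> end_part F q"
  shows "supercommutator (end_part F) (\<circ>) f g = (f \<circ> g) - end_scal F (parity_sign (p * q)) (g \<circ> f)"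
proof -
  have "d 0 = 0" if "d \<in> end_part F p'" for d p'
  proof -
    have "d (scal F 0 0) = scal F 0 (d 0)"
      using that unfolding end_part_def Vector_Spaces.linear_iff by blast
    then show ?thesis by simp
  qed
  then have "f 0 = 0" "g 0 = 0" using f g by blast+
  then have z: "f \<circ> 0 = 0" "0 \<circ> f = 0" "g \<circ> 0 = 0" "0 \<circ> g = 0" by (auto simp: fun_eq_iff)
  have z0: "(0 :: 'v \<Rightarrow> 'v) \<circ> 0 = 0" by (auto simp: fun_eq_iff)
  have s: "end_scal F 1 (g \<circ> f) = g \<circ> f" "end_scal F (- 1) (g \<circ> f) = - (g \<circ> f)"
    by (auto simp: end_scal_def)
  have "p = 0 \<or> p = 1" "q = 0 \<or> q = 1" by (cases p; auto) (cases q; auto)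
  then show ?thesis
    using hcomp_end_same[OF f] hcomp_end_same[OF g] hcomp_end_other[OF f] hcomp_end_other[OF g]
    by (elim disjE) (simp_all add: supercommutator_def Let_def z z0 s parity_sign_def)
qed

text \<open>This is the fundamental identity with the last argument \<open>v\<close> left free. The
  summand in which \<open>ys\<close> acts on \<open>v\<close> is the product in the opposite order;
  taken to the other side, it completes the supercommutator.\<close>

lemma left_mult_bracket:
  assumes ys: "length ys = r - 1" "homogeneous F ys qs" and xs: "length xs = r - 1" "homogeneous F xs ps"
  shows "(left_mult F ys \<circ> left_mult F xs)
      - end_scal F (parity_sign (sum_list qs * sum_list ps)) (left_mult F xs \<circ> left_mult F ys)
    = (\<Sum>i<r - 1. end_scal F (parity_sign (sum_list qs * sum_list (take i ps)))
        (left_mult F (xs[i := fbr F (ys @ [xs ! i])])))" (is "?l = ?R")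
proof -
  let ?s = "\<lambda>i. parity_sign (sum_list qs * sum_list (take i ps))"
  have lps: "length ps = r - 1" using xs by (simp add: homogeneous_def list_all2_lengthD)
  have r: "r = Suc (r - 1)" using arity by simp
  have R: "?R v = (\<Sum>i<r - 1. scal F (?s i) (fbr F (xs[i := fbr F (ys @ [xs ! i])] @ [v])))" for v
  proof -
    have "(\<Sum>i\<in>I. f i) v = (\<Sum>i\<in>I. f i v)" for I :: "nat set" and f :: "nat \<Rightarrow> 'v \<Rightarrow> 'v"
      by (induction I rule: infinite_finite_induct) auto
    then show ?thesis by (simp add: end_scal_def left_mult_def)
  qed
  have "hmg \<subseteq> {v. ?l v = ?R v}"
  proof safe
    fix v assume "v \<in> hmg"
    then obtain p where p: "v \<in> part F p" using hmg_part by blast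
    have hom: "homogeneous F (xs @ [v]) (ps @ [p])"
      using xs(2) p by (simp add: homogeneous_def list_all2_appendI)
    have len: "length (xs @ [v]) = r" using xs(1) arity by simp
    have "fbr F (ys @ [fbr F (xs @ [v])])
        = (\<Sum>i<Suc (r - 1). scal F (parity_sign (sum_list qs * sum_list (take i (ps @ [p]))))
            (fbr F ((xs @ [v])[i := fbr F (ys @ [(xs @ [v]) ! i])])))"
      using fbr_fundamental[OF ys len hom] r by simp
    also have "\<dots> = (\<Sum>i<r - 1. scal F (?s i) (fbr F (xs[i := fbr F (ys @ [xs ! i])] @ [v])))
        + scal F (parity_sign (sum_list qs * sum_list ps)) (fbr F (xs @ [fbr F (ys @ [v])]))"
    proof -
      have "(xs @ [v]) ! (r - 1) = v" "(xs @ [v])[r - 1 := a] = xs @ [a]" "take (r - 1) (ps @ [p]) = ps" for a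
        using xs(1) lps by (simp_all add: nth_append list_update_append)
      moreover have "(\<Sum>i<r - 1. scal F (parity_sign (sum_list qs * sum_list (take i (ps @ [p]))))
            (fbr F ((xs @ [v])[i := fbr F (ys @ [(xs @ [v]) ! i])])))
          = (\<Sum>i<r - 1. scal F (?s i) (fbr F (xs[i := fbr F (ys @ [xs ! i])] @ [v])))"
        using xs(1) lps by (intro sum.cong refl) (simp add: nth_append list_update_append)
      ultimately show ?thesis by (simp only: sum.lessThan_Suc)
    qed
    finally show "?l v = ?R v"
      unfolding R by (simp add: left_mult_def end_scal_def)
  qed
  moreover have "subspace {v. ?l v = ?R v}"
  proof -
    have L: "Vector_Spaces.linear (scal F) (scal F) (left_mult F zs)" if "length zs = r - 1" for zs
      using left_mult_linear[OF that] .
    have lin: "left_mult F zs (a + b) = left_mult F zs a + left_mult F zs b"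
      "left_mult F zs (scal F k a) = scal F k (left_mult F zs a)" if "length zs = r - 1" for zs a b k
      using L[OF that] by (auto simp: Vector_Spaces.linear_iff)
    have Rl: "?R v = (\<Sum>i<r - 1. scal F (?s i) (left_mult F (xs[i := fbr F (ys @ [xs ! i])]) v))" for v
      unfolding R by (simp add: left_mult_def)
    have lz: "left_mult F zs 0 = 0" if "length zs = r - 1" for zs
      using lin(2)[OF that, of 0 0] by simp
    show ?thesis
    proof (rule subspaceI)
      show "0 \<in> {v. ?l v = ?R v}"
        unfolding mem_Collect_eq Rl using ys(1) xs(1) by (simp add: end_scal_def lz)
    next
      fix a b assume "a \<in> {v. ?l v = ?R v}" "b \<in> {v. ?l v = ?R v}"
      moreover have "?l (a + b) = ?l a + ?l b"
        using ys(1) xs(1) by (simp add: end_scal_def lin scale_right_distrib)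
      moreover have "?R (a + b) = ?R a + ?R b"
        unfolding Rl using xs(1) by (simp add: lin scale_right_distrib sum.distrib)
      ultimately show "a + b \<in> {v. ?l v = ?R v}" by simp
    next
      fix k a assume "a \<in> {v. ?l v = ?R v}"
      moreover have "?l (scal F k a) = scal F k (?l a)"
        using ys(1) xs(1) by (simp add: end_scal_def lin scale_right_diff_distrib mult.commute)
      moreover have "?R (scal F k a) = scal F k (?R a)"
        unfolding Rl using xs(1) by (simp add: lin scale_sum_right mult.commute)
      ultimately show "scal F k a \<in> {v. ?l v = ?R v}" by simp
    qed
  qed
  ultimately have "?l v = ?R v" for v using span_minimal span_hmg by blast
  then show ?thesis by blast
qed

text \<open>Bilinearity extends \<open>left_mult_bracket\<close> to the spans, first in
  \<open>g\<close> and then in \<open>f\<close>. The isomorphism is injective only on the carrier of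
  \<open>Inder r F\<close>, so a supercommutator must be known to lie there before its matrix can
  identify it.\<close>

lemma Inder_bracket:
  assumes f: "f \<in> part (Inder r F) p" and g: "g \<in> part (Inder r F) q"
  shows "(f \<circ> g) - end_scal F (parity_sign (p * q)) (g \<circ> f) \<in> part (Inder r F) (p + q)"
proof -
  let ?I = "E.span {left_mult F xs | xs. length xs = r - 1}"
  let ?br = "\<lambda>f g. (f \<circ> g) - end_scal F (parity_sign (p * q)) (g \<circ> f)"
  have linear: "d (a + b) = d a + d b" "d (scal F k a) = scal F k (d a)"
    if "d \<in> end_part F q'" for d a b k q'
    using that by (auto simp: end_part_def Vector_Spaces.linear_iff)
  have hL: "hmg_left_mults q' \<subseteq> part (Inder r F) q'" for q'
    using left_mult_graded by (auto simp: hmg_left_mults_def)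
  have hLe: "d \<in> end_part F q'" if "d \<in> hmg_left_mults q'" for d q'
    using hL that by (auto simp: Inder_def)
  have base: "?br d d' \<in> ?I" if d: "d \<in> hmg_left_mults p" "d' \<in> hmg_left_mults q" for d d'
  proof -
    obtain ys qs where ys: "d = left_mult F ys" "length ys = r - 1" "homogeneous F ys qs" "sum_list qs = p"
      using d(1) unfolding hmg_left_mults_def by blast
    obtain xs ps where xs: "d' = left_mult F xs" "length xs = r - 1" "homogeneous F xs ps" "sum_list ps = q"
      using d(2) unfolding hmg_left_mults_def by blast
    have "?br d d' = (\<Sum>i<r - 1. end_scal F (parity_sign (sum_list qs * sum_list (take i ps)))
        (left_mult F (xs[i := fbr F (ys @ [xs ! i])])))"
      using left_mult_bracket[OF ys(2,3) xs(2,3)] ys(1,4) xs(1,4) by simp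
    also have "\<dots> \<in> ?I"
      using xs(2) by (intro E.span_sum E.span_scale E.span_base) auto
    finally show ?thesis .
  qed
  have right: "?br d g \<in> ?I" if d: "d \<in> hmg_left_mults p" for d
  proof -
    have "E.span (hmg_left_mults q) \<subseteq> {g. ?br d g \<in> ?I}"
    proof (rule E.span_minimal)
      show "E.subspace {g. ?br d g \<in> ?I}"
      proof (rule E.subspaceI)
        have "?br d 0 = 0" using linear(2)[OF hLe[OF d], of 0 0] by (auto simp: end_scal_def)
        then show "0 \<in> {g. ?br d g \<in> ?I}" by (simp add: E.span_zero)
      next
        fix a b assume "a \<in> {g. ?br d g \<in> ?I}" "b \<in> {g. ?br d g \<in> ?I}"
        then have "?br d a + ?br d b \<in> ?I" by (simp add: E.span_add)
        moreover have "?br d (a + b) = ?br d a + ?br d b"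
          using linear(1)[OF hLe[OF d]] by (auto simp: fun_eq_iff end_scal_def scale_right_distrib)
        ultimately show "a + b \<in> {g. ?br d g \<in> ?I}" by simp
      next
        fix k a assume "a \<in> {g. ?br d g \<in> ?I}"
        then have "end_scal F k (?br d a) \<in> ?I" by (simp add: E.span_scale)
        moreover have "?br d (end_scal F k a) = end_scal F k (?br d a)"
          using linear(2)[OF hLe[OF d]] by (auto simp: fun_eq_iff end_scal_def scale_right_diff_distrib mult.commute)
        ultimately show "end_scal F k a \<in> {g. ?br d g \<in> ?I}" by simp
      qed
    qed (use base[OF d] in blast)
    then show ?thesis using Inder_span_hmg[OF g] by blast
  qed
  have ge: "g \<in> end_part F q" and fe: "f \<in> end_part F p" using f g by (auto simp: Inder_def)
  have "E.span (hmg_left_mults p) \<subseteq> {f. ?br f g \<in> ?I}"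
  proof (rule E.span_minimal)
    show "E.subspace {f. ?br f g \<in> ?I}"
    proof (rule E.subspaceI)
      have "?br 0 g = 0" using linear(2)[OF ge, of 0 0] by (auto simp: end_scal_def)
      then show "0 \<in> {f. ?br f g \<in> ?I}" by (simp add: E.span_zero)
    next
      fix a b assume "a \<in> {f. ?br f g \<in> ?I}" "b \<in> {f. ?br f g \<in> ?I}"
      then have "?br a g + ?br b g \<in> ?I" by (simp add: E.span_add)
      moreover have "?br (a + b) g = ?br a g + ?br b g"
        using linear(1)[OF ge] by (auto simp: fun_eq_iff end_scal_def scale_right_distrib)
      ultimately show "a + b \<in> {f. ?br f g \<in> ?I}" by simp
    next
      fix k a assume "a \<in> {f. ?br f g \<in> ?I}"
      then have "end_scal F k (?br a g) \<in> ?I" by (simp add: E.span_scale)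
      moreover have "?br (end_scal F k a) g = end_scal F k (?br a g)"
        using linear(2)[OF ge] by (auto simp: fun_eq_iff end_scal_def scale_right_diff_distrib mult.commute)
      ultimately show "end_scal F k a \<in> {f. ?br f g \<in> ?I}" by simp
    qed
  qed (use right in blast)
  then have "?br f g \<in> ?I" using Inder_span_hmg[OF f] by blast
  moreover have "?br f g \<in> end_part F (p + q)"
  proof -
    have comp: "d \<circ> d' \<in> end_part F (p' + q')" if "d \<in> end_part F p'" "d' \<in> end_part F q'" for d d' p' q'
    proof -
      have "d (d' x) \<in> part F (p' + q' + s)" if "x \<in> part F s" for x s
      proof -
        have "d' x \<in> part F (q' + s)" using \<open>d' \<in> _\<close> that unfolding end_part_def by blast
        then have "d (d' x) \<in> part F (p' + (q' + s))" using \<open>d \<in> _\<close> unfolding end_part_def by blast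
        then show ?thesis by (simp only: add.assoc)
      qed
      then show ?thesis
        using linear[OF that(1)] linear[OF that(2)] vector_space_axioms
        by (auto simp: end_part_def Vector_Spaces.linear_iff image_subset_iff simp del: add_bit_eq_xor)
    qed
    have "g \<circ> f \<in> end_part F (p + q)" using comp[OF ge fe] by (simp only: add.commute)
    then show ?thesis
      by (intro E.subspace_diff[OF end_part_subspace] E.subspace_scale[OF end_part_subspace] comp[OF fe ge])
  qed
  ultimately show ?thesis unfolding Inder_def by simp
qed

end

section \<open>Transport of the relations of \<open>sl(1,m)\<close> along the isomorphism\<close>

locale A0_type = filippov_superalgebra r F
  for r :: nat and F :: "('k::field, 'v::ab_group_add) filippov" +
  fixes n m :: nat and \<phi> :: "('v \<Rightarrow> 'v) \<Rightarrow> 'k mat"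
  assumes iso: "lie_superalgebra_iso (Inder r F) (lie_A0 n) \<phi>" and m: "m = n + 1"
begin

definition G :: "('v \<Rightarrow> 'v) set"
  where "G = lie_carrier (Inder r F)"

lemma G_subspace: "E.subspace G"
  unfolding G_def lie_carrier_def by (intro E.subspace_sums Inder_subspace)

lemma part_G: "f \<in> part (Inder r F) p \<Longrightarrow> f \<in> G"
proof -
  assume f: "f \<in> part (Inder r F) p"
  have "(0 :: 'v \<Rightarrow> 'v) \<in> part (Inder r F) q" for q
    by (rule E.subspace_0[OF Inder_subspace])
  then show ?thesis
    using f unfolding G_def lie_carrier_def
    by (cases p) (force intro: exI[of _ f] exI[of _ 0])+
qed

lemma part_A0:
  "part (lie_A0 n) p = {A \<in> carrier_mat (Suc m) (Suc m). A $$ (0, 0) = (\<Sum>i<m. A $$ (Suc i, Suc i)) \<and>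
     (\<forall>i\<le>m. \<forall>j\<le>m. ((i = 0) = (j = 0)) \<noteq> (p = 0) \<longrightarrow> A $$ (i, j) = 0)}"
proof -
  have "part (lie_A0 n) p = sl1 m \<inter> gl1_part m p" by (simp add: lie_A0_def m)
  then show ?thesis
    unfolding set_eq_iff Int_iff mem_Collect_eq sl1_iff gl1_part_iff by blast
qed

lemma iso_facts:
  shows "bij_betw \<phi> G (lie_carrier (lie_A0 n))"
    and \<phi>_add: "\<And>f g. \<lbrakk>f \<in> G; g \<in> G\<rbrakk> \<Longrightarrow> \<phi> (f + g) = \<phi> f + \<phi> g"
    and \<phi>_scal: "\<And>f a. f \<in> G \<Longrightarrow> \<phi> (end_scal F a f) = a \<cdot>\<^sub>m \<phi> f"
    and "\<And>p. \<phi> ` part (Inder r F) p = part (lie_A0 n) p"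
    and "\<And>f g. \<lbrakk>f \<in> G; g \<in> G\<rbrakk> \<Longrightarrow> \<phi> (lbr (Inder r F) f g) = lbr (lie_A0 n) (\<phi> f) (\<phi> g)"
  using iso by (simp_all add: lie_superalgebra_iso_def G_def) (simp_all add: Inder_def lie_A0_def)

lemma \<phi>_part: "f \<in> part (Inder r F) p \<Longrightarrow> \<phi> f \<in> part (lie_A0 n) p"
  using iso_facts(4)[of p] by (metis imageI)

lemma \<phi>_surj: "A \<in> part (lie_A0 n) p \<Longrightarrow> \<exists>f. f \<in> part (Inder r F) p \<and> \<phi> f = A"
  unfolding iso_facts(4)[symmetric] by (elim imageE) blast

lemma \<phi>_inj: "\<lbrakk>f \<in> G; g \<in> G; \<phi> f = \<phi> g\<rbrakk> \<Longrightarrow> f = g"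
  using iso_facts(1) by (simp add: bij_betw_def inj_on_def)

lemma \<phi>_carrier: "f \<in> G \<Longrightarrow> \<phi> f \<in> carrier_mat (Suc m) (Suc m)"
proof -
  assume f: "f \<in> G"
  then have "\<phi> f \<in> lie_carrier (lie_A0 n)"
    using iso_facts(1) by (metis bij_betwE)
  then show ?thesis by (auto simp: lie_carrier_def part_A0)
qed

lemma \<phi>_add_index: "\<lbrakk>f \<in> G; g \<in> G; i \<le> m; j \<le> m\<rbrakk> \<Longrightarrow> \<phi> (f + g) $$ (i, j) = \<phi> f $$ (i, j) + \<phi> g $$ (i, j)"
  using \<phi>_carrier[of g] by (simp add: \<phi>_add)

lemma \<phi>_scal_index: "\<lbrakk>f \<in> G; i \<le> m; j \<le> m\<rbrakk> \<Longrightarrow> \<phi> (end_scal F a f) $$ (i, j) = a * \<phi> f $$ (i, j)"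
  using \<phi>_carrier[of f] by (simp add: \<phi>_scal)

lemma \<phi>_zero_index: "\<lbrakk>i \<le> m; j \<le> m\<rbrakk> \<Longrightarrow> \<phi> 0 $$ (i, j) = 0"
  using \<phi>_scal_index[of 0 i j 0] E.subspace_0[OF G_subspace] by simp

lemma \<phi>_sum_index:
  assumes "\<And>k. k \<in> K \<Longrightarrow> f k \<in> G" "i \<le> m" "j \<le> m"
  shows "\<phi> (\<Sum>k\<in>K. f k) $$ (i, j) = (\<Sum>k\<in>K. \<phi> (f k) $$ (i, j))"
  using assms(1)
proof (induction K rule: infinite_finite_induct)
  case (insert k K)
  then have "(\<Sum>k\<in>K. f k) \<in> G" by (intro E.subspace_sum[OF G_subspace]) auto
  then have "\<phi> (f k + (\<Sum>k\<in>K. f k)) $$ (i, j) = \<phi> (f k) $$ (i, j) + \<phi> (\<Sum>k\<in>K. f k) $$ (i, j)"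
    using insert.prems assms(2,3) by (intro \<phi>_add_index) auto
  then show ?case using insert by (simp only: sum.insert[OF insert.hyps(1,2)]) simp
qed (use assms in \<open>simp_all add: \<phi>_zero_index\<close>)

lemma \<phi>_eqI:
  assumes "f \<in> G" "g \<in> G" "\<And>i j. \<lbrakk>i \<le> m; j \<le> m\<rbrakk> \<Longrightarrow> \<phi> f $$ (i, j) = \<phi> g $$ (i, j)"
  shows "f = g"
proof (rule \<phi>_inj[OF assms(1,2)])
  show "\<phi> f = \<phi> g"
    using \<phi>_carrier[OF assms(1)] \<phi>_carrier[OF assms(2)] assms(3) by (intro eq_matI) auto
qed

lemma \<phi>_bracket:
  assumes f: "f \<in> part (Inder r F) p" and g: "g \<in> part (Inder r F) q"
  shows "(f \<circ> g) - end_scal F (parity_sign (p * q)) (g \<circ> f) \<in> G"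
    and "\<phi> ((f \<circ> g) - end_scal F (parity_sign (p * q)) (g \<circ> f))
      = (if p = 1 \<and> q = 1 then \<phi> f * \<phi> g + \<phi> g * \<phi> f else \<phi> f * \<phi> g - \<phi> g * \<phi> f)"
proof -
  show "(f \<circ> g) - end_scal F (parity_sign (p * q)) (g \<circ> f) \<in> G"
    using part_G[OF Inder_bracket[OF f g]] .
  have "\<phi> (lbr (Inder r F) f g) = lbr (lie_A0 n) (\<phi> f) (\<phi> g)"
    by (rule iso_facts(5)[OF part_G[OF f] part_G[OF g]])
  moreover have "lbr (Inder r F) f g = (f \<circ> g) - end_scal F (parity_sign (p * q)) (g \<circ> f)"
    using supercommutator_end[of f p g q] f g by (simp add: Inder_def)
  moreover have "\<phi> f \<in> gl1_part m p" "\<phi> g \<in> gl1_part m q"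
    using \<phi>_part[OF f] \<phi>_part[OF g] by (simp_all add: lie_A0_def m)
  then have "lbr (lie_A0 n) (\<phi> f) (\<phi> g)
      = (if p = 1 \<and> q = 1 then \<phi> f * \<phi> g + \<phi> g * \<phi> f else \<phi> f * \<phi> g - \<phi> g * \<phi> f)"
    using supercommutator_gl1[of "\<phi> f" m p "\<phi> g" q] by (simp add: lie_A0_def m)
  ultimately show "\<phi> ((f \<circ> g) - end_scal F (parity_sign (p * q)) (g \<circ> f))
      = (if p = 1 \<and> q = 1 then \<phi> f * \<phi> g + \<phi> g * \<phi> f else \<phi> f * \<phi> g - \<phi> g * \<phi> f)" by simp
qed

definition U :: "nat \<Rightarrow> nat \<Rightarrow> 'k mat"
  where "U i j = mat (Suc m) (Suc m) (\<lambda>(k, l). if k = i \<and> l = j then 1 else 0)"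

text \<open>The corner entry in the case \<open>i = j\<close> balances the trace of the lower
  block.\<close>

definition e_mat :: "nat \<Rightarrow> nat \<Rightarrow> 'k mat"
  where "e_mat i j = mat (Suc m) (Suc m)
    (\<lambda>(k, l). if k = Suc i \<and> l = Suc j \<or> i = j \<and> k = 0 \<and> l = 0 then 1 else 0)"

lemma e_mat_part: "\<lbrakk>i < m; j < m\<rbrakk> \<Longrightarrow> e_mat i j \<in> part (lie_A0 n) 0"
proof -
  assume ij: "i < m" "j < m"
  have "(\<Sum>k<m. e_mat i j $$ (Suc k, Suc k)) = (\<Sum>k<m. if k = i then (if i = j then 1 else 0) else 0)"
    by (intro sum.cong refl) (auto simp: e_mat_def)
  also have "\<dots> = e_mat i j $$ (0, 0)" using ij by (simp add: e_mat_def)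
  finally show ?thesis by (auto simp: part_A0) (auto simp: e_mat_def)
qed

lemma U_part: "i < m \<Longrightarrow> U 0 (Suc i) \<in> part (lie_A0 n) 1" "i < m \<Longrightarrow> U (Suc i) 0 \<in> part (lie_A0 n) 1"
  by (auto simp: part_A0 U_def)

text \<open>For indices below \<open>m\<close> the choice is unique, since \<open>\<phi>\<close> is
  injective on \<open>G\<close>.\<close>

definition e :: "nat \<Rightarrow> nat \<Rightarrow> 'v \<Rightarrow> 'v"
  where "e i j = (SOME f. f \<in> part (Inder r F) 0 \<and> \<phi> f = e_mat i j)"

definition b :: "nat \<Rightarrow> 'v \<Rightarrow> 'v"
  where "b i = (SOME f. f \<in> part (Inder r F) 1 \<and> \<phi> f = U 0 (Suc i))"

definition c :: "nat \<Rightarrow> 'v \<Rightarrow> 'v"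
  where "c i = (SOME f. f \<in> part (Inder r F) 1 \<and> \<phi> f = U (Suc i) 0)"

lemma e: "\<lbrakk>i < m; j < m\<rbrakk> \<Longrightarrow> e i j \<in> part (Inder r F) 0 \<and> \<phi> (e i j) = e_mat i j"
  unfolding e_def by (rule someI_ex[OF \<phi>_surj[OF e_mat_part]])

lemma b: "i < m \<Longrightarrow> b i \<in> part (Inder r F) 1 \<and> \<phi> (b i) = U 0 (Suc i)"
  unfolding b_def by (rule someI_ex[OF \<phi>_surj[OF U_part(1)]])

lemma c: "i < m \<Longrightarrow> c i \<in> part (Inder r F) 1 \<and> \<phi> (c i) = U (Suc i) 0"
  unfolding c_def by (rule someI_ex[OF \<phi>_surj[OF U_part(2)]])

lemma e_G: "\<lbrakk>i < m; j < m\<rbrakk> \<Longrightarrow> e i j \<in> G"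
  using e part_G by blast

lemma bc_G: "i < m \<Longrightarrow> b i \<in> G" "i < m \<Longrightarrow> c i \<in> G"
  using b c part_G by blast+

lemma U_carrier: "U i j \<in> carrier_mat (Suc m) (Suc m)" "e_mat i j \<in> carrier_mat (Suc m) (Suc m)"
  by (simp_all add: U_def e_mat_def)

lemma e_mat_U: "e_mat i j = U (Suc i) (Suc j) + (if i = j then 1 else 0) \<cdot>\<^sub>m U 0 0"
  by (rule eq_matI) (auto simp: e_mat_def U_def)

text \<open>Each relation below has the form \<open>[f, g] = a x - d y\<close> with \<open>a\<close>
  and \<open>d\<close> equal to \<open>0\<close> or \<open>1\<close>, so one lemma reduces them all
  to comparisons of matrix entries. The factor \<open>s\<close> is the sign of the product
  \<open>g f\<close> in the supercommutator.\<close>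

lemma bracket_eqI:
  assumes f: "f \<in> part (Inder r F) p" and g: "g \<in> part (Inder r F) q"
    and s: "s = (if p = 1 \<and> q = 1 then 1 else - 1)"
    and x: "x \<in> G" and y: "y \<in> G"
    and eq: "\<And>i j. \<lbrakk>i \<le> m; j \<le> m\<rbrakk> \<Longrightarrow>
      (\<phi> f * \<phi> g) $$ (i, j) + s * (\<phi> g * \<phi> f) $$ (i, j) = a * \<phi> x $$ (i, j) - d * \<phi> y $$ (i, j)"
  shows "f (g v) + scal F s (g (f v)) = scal F a (x v) - scal F d (y v)"
proof -
  have ps: "parity_sign (p * q) = - s" unfolding s by (cases p; cases q) (auto simp: parity_sign_def)
  have car: "\<phi> f \<in> carrier_mat (Suc m) (Suc m)" "\<phi> g \<in> carrier_mat (Suc m) (Suc m)"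
    using \<phi>_carrier part_G f g by blast+
  have xy: "end_scal F a x \<in> G" "end_scal F (- d) y \<in> G"
    by (rule E.subspace_scale[OF G_subspace x], rule E.subspace_scale[OF G_subspace y])
  have "(f \<circ> g) - end_scal F (parity_sign (p * q)) (g \<circ> f) = end_scal F a x + end_scal F (- d) y"
  proof (rule \<phi>_eqI)
    fix i j assume ij: "i \<le> m" "j \<le> m"
    have "\<phi> ((f \<circ> g) - end_scal F (parity_sign (p * q)) (g \<circ> f)) $$ (i, j)
        = (\<phi> f * \<phi> g) $$ (i, j) + s * (\<phi> g * \<phi> f) $$ (i, j)"
      unfolding \<phi>_bracket(2)[OF f g] s using car ij by auto
    also have "\<dots> = \<phi> (end_scal F a x + end_scal F (- d) y) $$ (i, j)"
      unfolding eq[OF ij] \<phi>_add_index[OF xy ij] \<phi>_scal_index[OF x ij] \<phi>_scal_index[OF y ij] by simp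
    finally show "\<phi> ((f \<circ> g) - end_scal F (parity_sign (p * q)) (g \<circ> f)) $$ (i, j)
        = \<phi> (end_scal F a x + end_scal F (- d) y) $$ (i, j)" .
  qed (use \<phi>_bracket(1)[OF f g] E.subspace_add[OF G_subspace xy] in auto)
  then have "((f \<circ> g) - end_scal F (parity_sign (p * q)) (g \<circ> f)) v = (end_scal F a x + end_scal F (- d) y) v"
    by simp
  then show ?thesis unfolding ps by (simp add: end_scal_def)
qed

lemma mult_U_index:
  assumes "A \<in> carrier_mat (Suc m) (Suc m)" "i \<le> m" "j \<le> m" "k \<le> m" "l \<le> m"
  shows "(A * U k l) $$ (i, j) = (if j = l then A $$ (i, k) else 0)"
    and "(U k l * A) $$ (i, j) = (if i = k then A $$ (l, j) else 0)"
proof -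
  have "(A * U k l) $$ (i, j) = (\<Sum>x<Suc m. A $$ (i, x) * U k l $$ (x, j))"
    using assms U_carrier(1)[of k l]
    by (simp add: scalar_prod_def atLeast0LessThan)
  also have "\<dots> = (\<Sum>x<Suc m. if x = k then (if j = l then A $$ (i, k) else 0) else 0)"
    using assms by (intro sum.cong refl) (auto simp: U_def)
  finally show "(A * U k l) $$ (i, j) = (if j = l then A $$ (i, k) else 0)"
    using assms by (simp)
  have "(U k l * A) $$ (i, j) = (\<Sum>x<Suc m. U k l $$ (i, x) * A $$ (x, j))"
    using assms U_carrier(1)[of k l]
    by (simp add: scalar_prod_def atLeast0LessThan)
  also have "\<dots> = (\<Sum>x<Suc m. if x = l then (if i = k then A $$ (l, j) else 0) else 0)"
    using assms by (intro sum.cong refl) (auto simp: U_def)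
  finally show "(U k l * A) $$ (i, j) = (if i = k then A $$ (l, j) else 0)"
    using assms by (simp)
qed

lemma mult_e_mat_index:
  assumes A: "A \<in> carrier_mat (Suc m) (Suc m)" and ij: "i \<le> m" "j \<le> m" and kl: "k < m" "l < m"
  shows "(A * e_mat k l) $$ (i, j)
      = (if j = Suc l then A $$ (i, Suc k) else 0) + (if k = l \<and> j = 0 then A $$ (i, 0) else 0)"
    and "(e_mat k l * A) $$ (i, j)
      = (if i = Suc k then A $$ (Suc l, j) else 0) + (if k = l \<and> i = 0 then A $$ (0, j) else 0)"
proof -
  let ?U = "U (Suc k) (Suc l)" and ?V = "(if k = l then 1 else 0) \<cdot>\<^sub>m U 0 0"
  have car: "?U \<in> carrier_mat (Suc m) (Suc m)" "?V \<in> carrier_mat (Suc m) (Suc m)"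
    "U 0 0 \<in> carrier_mat (Suc m) (Suc m)"
    using U_carrier by auto
  have 1: "A * e_mat k l = A * ?U + (if k = l then 1 else 0) \<cdot>\<^sub>m (A * U 0 0)"
    unfolding e_mat_U using mult_add_distrib_mat[OF A car(1,2)] mult_smult_distrib[OF A car(3)] by simp
  have 2: "e_mat k l * A = ?U * A + (if k = l then 1 else 0) \<cdot>\<^sub>m (U 0 0 * A)"
    unfolding e_mat_U using add_mult_distrib_mat[OF car(1,2) A] mult_smult_assoc_mat[OF car(3) A] by simp
  have add: "(X + a \<cdot>\<^sub>m Y) $$ (i, j) = X $$ (i, j) + a * Y $$ (i, j)"
    if "Y \<in> carrier_mat (Suc m) (Suc m)" for X Y :: "'k mat" and a
    using that ij by simp
  show "(A * e_mat k l) $$ (i, j)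
      = (if j = Suc l then A $$ (i, Suc k) else 0) + (if k = l \<and> j = 0 then A $$ (i, 0) else 0)"
    unfolding 1 add[OF mult_carrier_mat[OF A car(3)]]
    using mult_U_index(1)[OF A ij, of "Suc k" "Suc l"] mult_U_index(1)[OF A ij, of 0 0] kl by simp
  show "(e_mat k l * A) $$ (i, j)
      = (if i = Suc k then A $$ (Suc l, j) else 0) + (if k = l \<and> i = 0 then A $$ (0, j) else 0)"
    unfolding 2 add[OF mult_carrier_mat[OF car(3) A]]
    using mult_U_index(2)[OF A ij, of "Suc k" "Suc l"] mult_U_index(2)[OF A ij, of 0 0] kl by simp
qed

lemma e_mat_index: "\<lbrakk>k \<le> m; l \<le> m\<rbrakk> \<Longrightarrow>
    e_mat i j $$ (k, l) = (if k = Suc i \<and> l = Suc j \<or> i = j \<and> k = 0 \<and> l = 0 then 1 else 0)"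
  by (simp add: e_mat_def)

lemma U_index: "\<lbrakk>k \<le> m; l \<le> m\<rbrakk> \<Longrightarrow> U i j $$ (k, l) = (if k = i \<and> l = j then 1 else 0)"
  by (simp add: U_def)

lemma ee:
  assumes "i < m" "j < m" "k < m" "l < m"
  shows "e i j (e k l v) - e k l (e i j v) = (if j = k then e i l v else 0) - (if l = i then e k j v else 0)"
proof -
  have "e i j (e k l v) + scal F (- 1) (e k l (e i j v))
      = scal F (if j = k then 1 else 0) (e i l v) - scal F (if l = i then 1 else 0) (e k j v)"
  proof (rule bracket_eqI[where f = "e i j" and p = 0 and g = "e k l" and q = 0 and x = "e i l" and y = "e k j"])
    show "(\<phi> (e i j) * \<phi> (e k l)) $$ (s, t) + - 1 * (\<phi> (e k l) * \<phi> (e i j)) $$ (s, t)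
        = (if j = k then 1 else 0) * \<phi> (e i l) $$ (s, t) - (if l = i then 1 else 0) * \<phi> (e k j) $$ (s, t)"
      if st: "s \<le> m" "t \<le> m" for s t
      using e assms st
      by (cases s; cases t) (auto simp: mult_e_mat_index[OF U_carrier(2)] e_mat_index)
  qed (use e assms e_G bc_G in auto)
  then show ?thesis by (auto split: if_splits)
qed

lemma eb:
  assumes "i < m" "l < m" "k < m"
  shows "e i l (b k v) - b k (e i l v) = (if i = l then b k v else 0) - (if k = i then b l v else 0)"
proof -
  have "e i l (b k v) + scal F (- 1) (b k (e i l v))
      = scal F (if i = l then 1 else 0) (b k v) - scal F (if k = i then 1 else 0) (b l v)"
  proof (rule bracket_eqI[where f = "e i l" and p = 0 and g = "b k" and q = 1 and x = "b k" and y = "b l"])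
    show "(\<phi> (e i l) * \<phi> (b k)) $$ (s, t) + - 1 * (\<phi> (b k) * \<phi> (e i l)) $$ (s, t)
        = (if i = l then 1 else 0) * \<phi> (b k) $$ (s, t) - (if k = i then 1 else 0) * \<phi> (b l) $$ (s, t)"
      if st: "s \<le> m" "t \<le> m" for s t
      using e b assms st
      by (cases s; cases t) (auto simp: mult_e_mat_index[OF U_carrier(1)] U_index)
  qed (use e b assms e_G bc_G in auto)
  then show ?thesis by (auto split: if_splits)
qed

lemma ec:
  assumes "i < m" "l < m" "k < m"
  shows "e i l (c k v) - c k (e i l v) = (if l = k then c i v else 0) - (if i = l then c k v else 0)"
proof -
  have "e i l (c k v) + scal F (- 1) (c k (e i l v))
      = scal F (if l = k then 1 else 0) (c i v) - scal F (if i = l then 1 else 0) (c k v)"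
  proof (rule bracket_eqI[where f = "e i l" and p = 0 and g = "c k" and q = 1 and x = "c i" and y = "c k"])
    show "(\<phi> (e i l) * \<phi> (c k)) $$ (s, t) + - 1 * (\<phi> (c k) * \<phi> (e i l)) $$ (s, t)
        = (if l = k then 1 else 0) * \<phi> (c i) $$ (s, t) - (if i = l then 1 else 0) * \<phi> (c k) $$ (s, t)"
      if st: "s \<le> m" "t \<le> m" for s t
      using e c assms st
      by (cases s; cases t) (auto simp: mult_e_mat_index[OF U_carrier(1)] U_index)
  qed (use e c assms e_G bc_G in auto)
  then show ?thesis by (auto split: if_splits)
qed

lemma bc:
  assumes "i < m" "l < m"
  shows "b l (c i v) + c i (b l v) = e i l v"
proof -
  have "b l (c i v) + scal F 1 (c i (b l v)) = scal F 1 (e i l v) - scal F 0 (e i l v)"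
  proof (rule bracket_eqI[where f = "b l" and p = 1 and g = "c i" and q = 1 and x = "e i l" and y = "e i l"])
    show "(\<phi> (b l) * \<phi> (c i)) $$ (s, t) + 1 * (\<phi> (c i) * \<phi> (b l)) $$ (s, t)
        = 1 * \<phi> (e i l) $$ (s, t) - 0 * \<phi> (e i l) $$ (s, t)"
      if st: "s \<le> m" "t \<le> m" for s t
      using e b c assms st by (auto simp: mult_U_index[OF U_carrier(1)] U_index e_mat_index)
  qed (use e b c assms e_G bc_G in auto)
  then show ?thesis by simp
qed

lemma cc:
  assumes "i < m" "l < m"
  shows "c i (c l v) = - c l (c i v)"
proof -
  have "c i (c l v) + scal F 1 (c l (c i v)) = scal F 0 (c i v) - scal F 0 (c i v)"
  proof (rule bracket_eqI[where f = "c i" and p = 1 and g = "c l" and q = 1 and x = "c i" and y = "c i"])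
    show "(\<phi> (c i) * \<phi> (c l)) $$ (s, t) + 1 * (\<phi> (c l) * \<phi> (c i)) $$ (s, t)
        = 0 * \<phi> (c i) $$ (s, t) - 0 * \<phi> (c i) $$ (s, t)"
      if st: "s \<le> m" "t \<le> m" for s t
      using c assms st by (auto simp: mult_U_index[OF U_carrier(1)] U_index)
  qed (use c assms e_G bc_G in auto)
  then show ?thesis by (simp add: eq_neg_iff_add_eq_0)
qed

lemma sum_app: "(\<Sum>k\<in>K. f k) v = (\<Sum>k\<in>K. f k v)" for f :: "nat \<Rightarrow> 'v \<Rightarrow> 'v"
  by (induction K rule: infinite_finite_induct) auto

lemma scal_G: "f \<in> G \<Longrightarrow> end_scal F a f \<in> G"
  by (rule E.subspace_scale[OF G_subspace])

text \<open>The lower block of the matrix supplies the coefficients. The corner entry then agrees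
  automatically, because both sides satisfy the trace condition.\<close>

lemma Inder_even:
  assumes L: "L \<in> part (Inder r F) 0"
  shows "\<exists>g. \<forall>v. L v = (\<Sum>i<m. \<Sum>j<m. scal F (g i j) (e i j v))"
proof -
  let ?A = "\<phi> L"
  let ?g = "\<lambda>i j. ?A $$ (Suc i, Suc j)"
  have A: "?A $$ (0, 0) = (\<Sum>i<m. ?g i i)" "\<And>i j. \<lbrakk>i \<le> m; j \<le> m; (i = 0) \<noteq> (j = 0)\<rbrakk> \<Longrightarrow> ?A $$ (i, j) = 0"
    using \<phi>_part[OF L] by (auto simp: part_A0)
  have eG: "e i j \<in> G" if "i < m" "j < m" for i j using e that part_G by blast
  have row: "(\<Sum>j<m. end_scal F (?g i j) (e i j)) \<in> G" if "i < m" for i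
    using that eG by (intro E.subspace_sum[OF G_subspace] scal_G) auto
  have "L = (\<Sum>i<m. \<Sum>j<m. end_scal F (?g i j) (e i j))"
  proof (rule \<phi>_eqI)
    show "L \<in> G" using part_G[OF L] .
    show "(\<Sum>i<m. \<Sum>j<m. end_scal F (?g i j) (e i j)) \<in> G"
      by (rule E.subspace_sum[OF G_subspace]) (use row in auto)
    fix s t assume st: "s \<le> m" "t \<le> m"
    have "\<phi> (\<Sum>i<m. \<Sum>j<m. end_scal F (?g i j) (e i j)) $$ (s, t)
        = (\<Sum>i<m. \<phi> (\<Sum>j<m. end_scal F (?g i j) (e i j)) $$ (s, t))"
      using row st by (intro \<phi>_sum_index) auto
    also have "\<dots> = (\<Sum>i<m. \<Sum>j<m. \<phi> (end_scal F (?g i j) (e i j)) $$ (s, t))"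
      using eG st by (intro sum.cong refl \<phi>_sum_index scal_G) auto
    also have "\<dots> = (\<Sum>i<m. \<Sum>j<m. ?g i j * e_mat i j $$ (s, t))"
      using e eG st by (intro sum.cong refl) (simp add: \<phi>_scal_index)
    also have "\<dots> = ?A $$ (s, t)"
    proof (cases "s = 0 \<or> t = 0")
      case True
      show ?thesis
      proof (cases "s = 0 \<and> t = 0")
        case True
        then have "(\<Sum>i<m. \<Sum>j<m. ?g i j * e_mat i j $$ (s, t)) = (\<Sum>i<m. \<Sum>j<m. if j = i then ?g i i else 0)"
          by (intro sum.cong refl) (auto simp: e_mat_index)
        also have "\<dots> = ?A $$ (s, t)" using True A(1) by (simp)
        finally show ?thesis .
      next
        case False
        then have "e_mat i j $$ (s, t) = 0" for i j using True st by (auto simp: e_mat_index)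
        then show ?thesis using A(2)[OF st] True False by auto
      qed
    next
      case False
      then obtain s' t' where s't': "s = Suc s'" "t = Suc t'" by (meson not0_implies_Suc)
      then have "(\<Sum>i<m. \<Sum>j<m. ?g i j * e_mat i j $$ (s, t))
          = (\<Sum>i<m. \<Sum>j<m. if j = t' then (if i = s' then ?g s' t' else 0) else 0)"
        using st by (intro sum.cong refl) (auto simp: e_mat_index)
      then show ?thesis using s't' st by (simp)
    qed
    finally show "\<phi> L $$ (s, t) = \<phi> (\<Sum>i<m. \<Sum>j<m. end_scal F (?g i j) (e i j)) $$ (s, t)" by simp
  qed
  then have "L v = (\<Sum>i<m. \<Sum>j<m. end_scal F (?g i j) (e i j)) v" for v by (rule fun_cong)
  then have "L v = (\<Sum>i<m. \<Sum>j<m. scal F (?g i j) (e i j v))" for v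
    unfolding sum_app end_scal_def .
  then show ?thesis by (intro exI[of _ ?g] allI)
qed

lemma Inder_odd:
  assumes L: "L \<in> part (Inder r F) 1"
  shows "\<exists>\<beta> \<gamma>. \<forall>v. L v = (\<Sum>i<m. scal F (\<beta> i) (b i v)) + (\<Sum>i<m. scal F (\<gamma> i) (c i v))"
proof -
  let ?A = "\<phi> L"
  let ?\<beta> = "\<lambda>i. ?A $$ (0, Suc i)" and ?\<gamma> = "\<lambda>i. ?A $$ (Suc i, 0)"
  have A: "\<And>i j. \<lbrakk>i \<le> m; j \<le> m; (i = 0) = (j = 0)\<rbrakk> \<Longrightarrow> ?A $$ (i, j) = 0"
    using \<phi>_part[OF L] by (auto simp: part_A0)
  have G: "b i \<in> G" "c i \<in> G" if "i < m" for i using b c that part_G by blast+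
  let ?P = "\<Sum>i<m. end_scal F (?\<beta> i) (b i)" and ?Q = "\<Sum>i<m. end_scal F (?\<gamma> i) (c i)"
  have PQ: "?P \<in> G" "?Q \<in> G"
    using G by (auto intro!: E.subspace_sum[OF G_subspace] scal_G)
  have "L = ?P + ?Q"
  proof (rule \<phi>_eqI)
    show "L \<in> G" using part_G[OF L] .
    show "?P + ?Q \<in> G" using PQ by (intro E.subspace_add[OF G_subspace])
    fix s t assume st: "s \<le> m" "t \<le> m"
    have "\<phi> ?P $$ (s, t) = (\<Sum>i<m. \<phi> (end_scal F (?\<beta> i) (b i)) $$ (s, t))"
      using G st by (intro \<phi>_sum_index scal_G) auto
    also have "\<dots> = (\<Sum>i<m. if t = Suc i then (if s = 0 then ?\<beta> i else 0) else 0)"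
      using b G st by (intro sum.cong refl) (simp add: \<phi>_scal_index U_index)
    finally have P: "\<phi> ?P $$ (s, t) = (\<Sum>i<m. if t = Suc i then (if s = 0 then ?\<beta> i else 0) else 0)" .
    have "\<phi> ?Q $$ (s, t) = (\<Sum>i<m. \<phi> (end_scal F (?\<gamma> i) (c i)) $$ (s, t))"
      using G st by (intro \<phi>_sum_index scal_G) auto
    also have "\<dots> = (\<Sum>i<m. if s = Suc i then (if t = 0 then ?\<gamma> i else 0) else 0)"
      using c G st by (intro sum.cong refl) (simp add: \<phi>_scal_index U_index)
    finally have Q: "\<phi> ?Q $$ (s, t) = (\<Sum>i<m. if s = Suc i then (if t = 0 then ?\<gamma> i else 0) else 0)" .
    show "\<phi> L $$ (s, t) = \<phi> (?P + ?Q) $$ (s, t)"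
      using A[OF st] st unfolding \<phi>_add_index[OF PQ st] P Q
      by (cases s; cases t) (simp_all)
  qed
  then have "L v = (?P + ?Q) v" for v by (rule fun_cong)
  then have "L v = (\<Sum>i<m. scal F (?\<beta> i) (b i v)) + (\<Sum>i<m. scal F (?\<gamma> i) (c i v))" for v
    unfolding plus_fun_def sum_app end_scal_def .
  then show ?thesis by (intro exI[of _ ?\<beta>] exI[of _ ?\<gamma>] allI)
qed

lemma bc_nonzero:
  assumes "i < m"
  shows "\<exists>v. b i v \<noteq> 0" "\<exists>v. c i v \<noteq> 0"
proof -
  show "\<exists>v. b i v \<noteq> 0"
  proof (rule ccontr)
    assume "\<not> ?thesis"
    then have "b i = 0" by (simp add: fun_eq_iff)
    then have "U 0 (Suc i) $$ (0, Suc i) = 0" using b[OF assms] \<phi>_zero_index[of 0 "Suc i"] assms by simp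
    then show False using assms by (simp add: U_index)
  qed
  show "\<exists>v. c i v \<noteq> 0"
  proof (rule ccontr)
    assume "\<not> ?thesis"
    then have "c i = 0" by (simp add: fun_eq_iff)
    then have "U (Suc i) 0 $$ (Suc i, 0) = 0" using c[OF assms] \<phi>_zero_index[of "Suc i" 0] assms by simp
    then show False using assms by (simp add: U_index)
  qed
qed

end

theorem theorem5p1:
  fixes n r :: nat
  assumes "n \<ge> 1" and "r \<ge> 3"
  shows "\<nexists>F :: ('k::{alg_closed_field,field_char_0}, 'v::ab_group_add) filippov.
           filippov_superalgebra r F \<and> finite_dimensional F \<and> simple_filippov r F \<and>
           has_type r F (lie_A0 n :: ('k, 'k mat) lie_superalgebra)"
proof
  assume "\<exists>F :: ('k, 'v) filippov.
    filippov_superalgebra r F \<and> finite_dimensional F \<and> simple_filippov r F \<and>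
    has_type r F (lie_A0 n :: ('k, 'k mat) lie_superalgebra)"
  then obtain F :: "('k, 'v) filippov" and \<phi> :: "('v \<Rightarrow> 'v) \<Rightarrow> 'k mat" where
    F: "filippov_superalgebra r F" "finite_dimensional F" "simple_filippov r F"
    and iso: "lie_superalgebra_iso (Inder r F) (lie_A0 n) \<phi>"
    unfolding has_type_def lie_superalgebra_isomorphic_def by blast
  interpret F: filippov_superalgebra r F by (fact F(1))
  interpret T: A0_type r F n "n + 1" \<phi> by unfold_locales (use iso in simp_all)
  have n: "n + 1 \<ge> 2" using assms(1) by simp
  interpret A: A0_filippov r F "n + 1" T.e T.b T.c
    by unfold_locales
      (fact n F(2,3) assms(2) | (rule T.ee T.eb T.ec T.bc T.cc T.Inder_even T.Inder_odd T.bc_nonzero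
          conjunct1[OF T.e] conjunct1[OF T.b] conjunct1[OF T.c]; assumption))+
  show False by (fact A.no_such_algebra)
qed

end
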